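(* Let $N$ be a lattice of rank $r$ with dual $M$, and let $\deg\colon N\to\mathbb C$ be a function for which there is a complete rational polyhedral fan $\Sigma$ in $N\otimes\mathbb R$ such that $\deg$ is linear on every cone of $\Sigma$ and $\deg(d)\notin\mathbb Z$ for the primitive generator $d$ of every one-dimensional cone of $\Sigma$. For $m\in M$ put $\rho(q,m)=\sum_{C\in\Sigma}(-1)^{\operatorname{codim}C}f_C(q,m)$. Then: (1) there exists $\varepsilon>0$ such that the series $\sum_{m\in M}\rho(q,m)$ converges absolutely and uniformly for all $|q|<\varepsilon$; (2) each $\rho(q,m)$ has an expansion around $q=0$ involving only nonnegative powers of $q$, and for each fixed integer $k$ only finitely many $m\in M$ contribute nontrivially to the coefficient of $q^k$.
   Context: $M=\mathrm{Hom}_{\mathbb Z}(N,\mathbb Z)$ with pairing $m\cdot n$. Fans: collections of rational polyhedral cones (finite intersections of half-spaces $\{m_j\cdot x\ge0\}$ with $m_j\in M$, containing no line) closed under faces, pairwise intersecting in common faces; complete if their union is $N\otimes\mathbb R$. $\operatorname{codim}C=r-\dim C$. "$\deg$ linear on $C$" means $\deg|_{C\cap N}$ is the restriction of an additive map $N\to\mathbb C$. For $C\in\Sigma$ and $m\in M$, the formal series $\sum_{n\in C\cap N}e^{2\pi i\deg(n)}x^n$ in Laurent monomials $x^n$ is a rational function of $x$, and $f_C(q,m)$ is this rational function evaluated at $x^n=q^{m\cdot n}$; when $m\cdot n>0$ for all $n\in C\setminus\{0\}$ it equals $\sum_{n\in C\cap N}q^{m\cdot n}e^{2\pi i\deg(n)}$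 for small $|q|$, and in general it is the analytic continuation of this in $q$. The sum $\sum_{m\in M}\rho(q,m)$ is (by definition) the toric form $f_{N,\deg}(q)$, with $q=e^{2\pi i\tau}$. *)

theory Defs
  imports "HOL-Complex_Analysis.Complex_Analysis" "HOL-Library.Poly_Mapping"
begin

section \<open>Lattices\<close>

text \<open>A lattice is realised inside a Euclidean space that may be larger than its real span, so
  that rank 0 is included. Its real span plays the role of the tensor product of \<open>N\<close> with the
  reals.\<close>

definition lattice_of_rank :: "'v::euclidean_space set \<Rightarrow> nat \<Rightarrow> bool" where
  "lattice_of_rank N r \<longleftrightarrow>
     (\<exists>B. finite B \<and> independent B \<and> card B = r \<and>
          N = {(\<Sum>b\<in>B. of_int (c b) *\<^sub>R b) | c :: 'v \<Rightarrow> int. True})"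

text \<open>The dual \<open>M = Hom(N, \<int>)\<close>: a homomorphism is represented by the unique vector \<open>m\<close> of the
  span with \<open>n \<mapsto> m \<bullet> n\<close> equal to it, so that the pairing of \<open>M\<close> and \<open>N\<close> is the inner product
  (see \<open>bij_betw_dual_lattice_Hom\<close> below).\<close>

definition dual_lattice :: "'v::euclidean_space set \<Rightarrow> 'v set" where
  "dual_lattice N = {m \<in> span N. \<forall>n\<in>N. m \<bullet> n \<in> \<int>}"

definition additive_on :: "'v::ab_group_add set \<Rightarrow> ('v \<Rightarrow> 'a::ab_group_add) \<Rightarrow> bool" where
  "additive_on N h \<longleftrightarrow> (\<forall>x\<in>N. \<forall>y\<in>N. h (x + y) = h x + h y)"

definition primitive_in :: "'v::real_vector set \<Rightarrow> 'v \<Rightarrow> bool" where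
  "primitive_in N d \<longleftrightarrow> d \<in> N \<and> (\<forall>n\<in>N. \<forall>k::nat. d = of_nat k *\<^sub>R n \<longrightarrow> k = 1)"

section \<open>Fans\<close>

definition rational_polyhedral_cone :: "'v::euclidean_space set \<Rightarrow> 'v set \<Rightarrow> bool" where
  "rational_polyhedral_cone N C \<longleftrightarrow>
     (\<exists>S. finite S \<and> S \<subseteq> dual_lattice N \<and> C = {x \<in> span N. \<forall>m\<in>S. 0 \<le> m \<bullet> x}) \<and>
     (\<forall>a v. (\<forall>t::real. a + t *\<^sub>R v \<in> C) \<longrightarrow> v = 0)"

text \<open>The library relation \<open>face_of\<close> admits the empty set as a face; faces of cones are
  understood to be nonempty. Fans are finite, since toric forms involve sums over all cones.\<close>

definition rational_fan :: "'v::euclidean_space set \<Rightarrow> 'v set set \<Rightarrow> bool" where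
  "rational_fan N \<Sigma> \<longleftrightarrow>
     finite \<Sigma> \<and>
     (\<forall>C\<in>\<Sigma>. rational_polyhedral_cone N C) \<and>
     (\<forall>C\<in>\<Sigma>. \<forall>F. F face_of C \<and> F \<noteq> {} \<longrightarrow> F \<in> \<Sigma>) \<and>
     (\<forall>C\<in>\<Sigma>. \<forall>D\<in>\<Sigma>. C \<inter> D face_of C \<and> C \<inter> D face_of D)"

definition complete_fan :: "'v::euclidean_space set \<Rightarrow> 'v set set \<Rightarrow> bool" where
  "complete_fan N \<Sigma> \<longleftrightarrow> rational_fan N \<Sigma> \<and> \<Union>\<Sigma> = span N"

definition linear_on_cone ::
    "'v::euclidean_space set \<Rightarrow> ('v \<Rightarrow> complex) \<Rightarrow> 'v set \<Rightarrow> bool" where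
  "linear_on_cone N deg C \<longleftrightarrow> (\<exists>L. additive_on N L \<and> (\<forall>n\<in>C \<inter> N. deg n = L n))"

section \<open>Formal Laurent series and their values as rational functions\<close>

text \<open>A Laurent polynomial is a finitely supported map from exponents to coefficients, a formal
  series is an arbitrary such map, and a point of the torus is a multiplicative map \<open>\<xi>\<close>
  giving the values of the monomials.\<close>

definition laurent_mult ::
    "('v::ab_group_add \<Rightarrow>\<^sub>0 complex) \<Rightarrow> ('v \<Rightarrow> complex) \<Rightarrow> 'v \<Rightarrow> complex" where
  "laurent_mult Q S n =
     (\<Sum>k\<in>Poly_Mapping.keys Q. Poly_Mapping.lookup Q k * S (n - k))"

definition laurent_eval ::
    "('v::ab_group_add \<Rightarrow> complex) \<Rightarrow> ('v \<Rightarrow>\<^sub>0 complex) \<Rightarrow> complex" where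
  "laurent_eval \<xi> P = (\<Sum>k\<in>Poly_Mapping.keys P. Poly_Mapping.lookup P k * \<xi> k)"

text \<open>\<open>is_rational_value N S \<xi> v\<close>: the series \<open>S\<close> is the rational function \<open>P / Q\<close>, meaning
  \<open>Q S = P\<close>, with \<open>Q\<close> not vanishing at \<open>\<xi>\<close>, and \<open>v\<close> is its value at \<open>\<xi>\<close>. There is at most
  one such \<open>v\<close> (\<open>is_rational_value_unique\<close> below).\<close>

definition is_rational_value ::
    "'v::ab_group_add set \<Rightarrow> ('v \<Rightarrow> complex) \<Rightarrow> ('v \<Rightarrow> complex) \<Rightarrow> complex \<Rightarrow> bool" where
  "is_rational_value N S \<xi> v \<longleftrightarrow>
     (\<exists>P Q. Poly_Mapping.keys P \<subseteq> N \<and> Poly_Mapping.keys Q \<subseteq> N \<and>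
            laurent_mult Q S = Poly_Mapping.lookup P \<and>
            laurent_eval \<xi> Q \<noteq> 0 \<and> v = laurent_eval \<xi> P / laurent_eval \<xi> Q)"

section \<open>The functions \<open>f\<^sub>C\<close> and \<open>\<rho>\<close>\<close>

definition cone_series ::
    "'v::euclidean_space set \<Rightarrow> ('v \<Rightarrow> complex) \<Rightarrow> 'v set \<Rightarrow> 'v \<Rightarrow> complex" where
  "cone_series N deg C n =
     (if n \<in> C \<inter> N then exp (2 * complex_of_real pi * \<i> * deg n) else 0)"

text \<open>For \<open>m\<close> in the dual lattice and \<open>n\<close> in \<open>N\<close> the floor below just reads \<open>m \<bullet> n\<close> as an
  integer.\<close>

definition monomial_at :: "complex \<Rightarrow> 'v::euclidean_space \<Rightarrow> 'v \<Rightarrow> complex" where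
  "monomial_at q m n = q powi \<lfloor>m \<bullet> n\<rfloor>"

text \<open>The point given by \<open>x\<^sup>n = q\<^bsup>m \<bullet> n\<^esup>\<close> lies on the torus only for \<open>q \<noteq> 0\<close>; the value
  at \<open>q = 0\<close> is the analytic continuation.\<close>

definition cone_fun ::
    "'v::euclidean_space set \<Rightarrow> ('v \<Rightarrow> complex) \<Rightarrow> 'v set \<Rightarrow> complex \<Rightarrow> 'v \<Rightarrow> complex" where
  "cone_fun N deg C q m =
     (let f = (\<lambda>t. THE v. is_rational_value N (cone_series N deg C) (monomial_at t m) v)
      in if q = 0 then Lim (at 0) f else f q)"

definition toric_rho ::
    "'v::euclidean_space set \<Rightarrow> nat \<Rightarrow> ('v \<Rightarrow> complex) \<Rightarrow> 'v set set \<Rightarrow>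
     complex \<Rightarrow> 'v \<Rightarrow> complex" where
  "toric_rho N r deg \<Sigma> q m = (\<Sum>C\<in>\<Sigma>. (-1) ^ (r - dim C) * cone_fun N deg C q m)"

section \<open>Justification of the encodings\<close>

lemma laurent_mult_commute:
  "laurent_mult Q (laurent_mult Q' S) = laurent_mult Q' (laurent_mult Q S)"
proof
  fix n
  have "laurent_mult Q (laurent_mult Q' S) n =
     (\<Sum>k\<in>Poly_Mapping.keys Q. \<Sum>l\<in>Poly_Mapping.keys Q'.
        Poly_Mapping.lookup Q k * (Poly_Mapping.lookup Q' l * S (n - k - l)))"
    by (simp add: laurent_mult_def sum_distrib_left)
  also have "\<dots> = (\<Sum>l\<in>Poly_Mapping.keys Q'. \<Sum>k\<in>Poly_Mapping.keys Q.
        Poly_Mapping.lookup Q k * (Poly_Mapping.lookup Q' l * S (n - k - l)))"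
    by (rule sum.swap)
  also have "\<dots> = laurent_mult Q' (laurent_mult Q S) n"
    by (simp add: laurent_mult_def sum_distrib_left mult.left_commute diff_diff_eq add.commute)
  finally show "laurent_mult Q (laurent_mult Q' S) n = laurent_mult Q' (laurent_mult Q S) n" .
qed

lemma laurent_mult_eval:
  assumes T: "finite T" "\<And>k l. k \<in> Poly_Mapping.keys Q \<Longrightarrow> l \<in> Poly_Mapping.keys P \<Longrightarrow> k + l \<in> T"
    and N: "Poly_Mapping.keys P \<subseteq> N" "Poly_Mapping.keys Q \<subseteq> N"
    and hom: "\<And>x y. x \<in> N \<Longrightarrow> y \<in> N \<Longrightarrow> \<xi> (x + y) = \<xi> x * \<xi> y"
  shows "(\<Sum>n\<in>T. laurent_mult Q (Poly_Mapping.lookup P) n * \<xi> n) =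
         laurent_eval \<xi> Q * laurent_eval \<xi> P"
proof -
  have inner: "(\<Sum>n\<in>T. Poly_Mapping.lookup P (n - k) * \<xi> n) = \<xi> k * laurent_eval \<xi> P"
    if k: "k \<in> Poly_Mapping.keys Q" for k
  proof -
    have "(\<Sum>n\<in>T. Poly_Mapping.lookup P (n - k) * \<xi> n) =
          (\<Sum>n\<in>(\<lambda>l. k + l) ` Poly_Mapping.keys P. Poly_Mapping.lookup P (n - k) * \<xi> n)"
    proof (rule sum.mono_neutral_right)
      show "(\<lambda>l. k + l) ` Poly_Mapping.keys P \<subseteq> T"
        using T(2) k by auto
      show "\<forall>n\<in>T - (\<lambda>l. k + l) ` Poly_Mapping.keys P. Poly_Mapping.lookup P (n - k) * \<xi> n = 0"
      proof
        fix n assume n: "n \<in> T - (\<lambda>l. k + l) ` Poly_Mapping.keys P"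
        have "n = k + (n - k)" by simp
        with n have "n - k \<notin> Poly_Mapping.keys P" by blast
        then show "Poly_Mapping.lookup P (n - k) * \<xi> n = 0"
          by (simp add: in_keys_iff)
      qed
    qed (rule T)
    also have "\<dots> = (\<Sum>l\<in>Poly_Mapping.keys P. Poly_Mapping.lookup P l * \<xi> (k + l))"
      by (subst sum.reindex) (auto simp: inj_on_def)
    also have "\<dots> = (\<Sum>l\<in>Poly_Mapping.keys P. \<xi> k * (Poly_Mapping.lookup P l * \<xi> l))"
    proof (rule sum.cong)
      fix l assume "l \<in> Poly_Mapping.keys P"
      then have "\<xi> (k + l) = \<xi> k * \<xi> l" using N k hom by blast
      then show "Poly_Mapping.lookup P l * \<xi> (k + l) = \<xi> k * (Poly_Mapping.lookup P l * \<xi> l)"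
        by simp
    qed simp
    finally show ?thesis by (simp add: laurent_eval_def sum_distrib_left)
  qed
  have "(\<Sum>n\<in>T. laurent_mult Q (Poly_Mapping.lookup P) n * \<xi> n) =
        (\<Sum>n\<in>T. \<Sum>k\<in>Poly_Mapping.keys Q.
           Poly_Mapping.lookup Q k * (Poly_Mapping.lookup P (n - k) * \<xi> n))"
    by (simp add: laurent_mult_def sum_distrib_right mult.assoc)
  also have "\<dots> = (\<Sum>k\<in>Poly_Mapping.keys Q. \<Sum>n\<in>T.
           Poly_Mapping.lookup Q k * (Poly_Mapping.lookup P (n - k) * \<xi> n))"
    by (rule sum.swap)
  also have "\<dots> = (\<Sum>k\<in>Poly_Mapping.keys Q. Poly_Mapping.lookup Q k * (\<xi> k * laurent_eval \<xi> P))"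
    by (intro sum.cong) (simp_all add: sum_distrib_left[symmetric] inner)
  also have "\<dots> = laurent_eval \<xi> Q * laurent_eval \<xi> P"
    by (simp add: laurent_eval_def[of \<xi> Q] sum_distrib_right mult.assoc)
  finally show ?thesis .
qed

lemma is_rational_value_unique:
  assumes hom: "\<And>x y. x \<in> N \<Longrightarrow> y \<in> N \<Longrightarrow> \<xi> (x + y) = \<xi> x * \<xi> y"
    and "is_rational_value N S \<xi> v" "is_rational_value N S \<xi> w"
  shows "v = w"
proof -
  obtain P Q where 1: "Poly_Mapping.keys P \<subseteq> N" "Poly_Mapping.keys Q \<subseteq> N"
    "laurent_mult Q S = Poly_Mapping.lookup P" "laurent_eval \<xi> Q \<noteq> 0"
    "v = laurent_eval \<xi> P / laurent_eval \<xi> Q"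
    using assms(2) unfolding is_rational_value_def by blast
  obtain P' Q' where 2: "Poly_Mapping.keys P' \<subseteq> N" "Poly_Mapping.keys Q' \<subseteq> N"
    "laurent_mult Q' S = Poly_Mapping.lookup P'" "laurent_eval \<xi> Q' \<noteq> 0"
    "w = laurent_eval \<xi> P' / laurent_eval \<xi> Q'"
    using assms(3) unfolding is_rational_value_def by blast
  define T where "T = (\<lambda>(k, l). k + l) ` (Poly_Mapping.keys Q' \<times> Poly_Mapping.keys P) \<union>
                      (\<lambda>(k, l). k + l) ` (Poly_Mapping.keys Q \<times> Poly_Mapping.keys P')"
  have T: "finite T" by (simp add: T_def)
  have "laurent_eval \<xi> Q' * laurent_eval \<xi> P =
        (\<Sum>n\<in>T. laurent_mult Q' (Poly_Mapping.lookup P) n * \<xi> n)"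
    by (rule laurent_mult_eval[symmetric, OF T _ 1(1) 2(2) hom]) (auto simp: T_def)
  also have "laurent_mult Q' (Poly_Mapping.lookup P) = laurent_mult Q (Poly_Mapping.lookup P')"
    using laurent_mult_commute[of Q' Q S] 1(3) 2(3) by simp
  also have "(\<Sum>n\<in>T. laurent_mult Q (Poly_Mapping.lookup P') n * \<xi> n) =
             laurent_eval \<xi> Q * laurent_eval \<xi> P'"
    by (rule laurent_mult_eval[OF T _ 2(1) 1(2) hom]) (auto simp: T_def)
  finally show ?thesis
    unfolding 1(5) 2(5) using 1(4) 2(4) by (simp add: frac_eq_eq mult.commute)
qed

lemma bij_betw_dual_lattice_Hom:
  assumes "lattice_of_rank N r"
  shows "bij_betw (\<lambda>m. restrict (\<lambda>n. m \<bullet> n) N) (dual_lattice N)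
           {h \<in> extensional N. additive_on N h \<and> h ` N \<subseteq> \<int>}"
proof -
  obtain B where B: "finite B" "independent B"
    and N: "N = {(\<Sum>b\<in>B. of_int (c b) *\<^sub>R b) | c. True}"
    using assms unfolding lattice_of_rank_def by blast
  have add: "x + y \<in> N" if "x \<in> N" "y \<in> N" for x y
  proof -
    from that obtain c d where "x = (\<Sum>b\<in>B. of_int (c b) *\<^sub>R b)" "y = (\<Sum>b\<in>B. of_int (d b) *\<^sub>R b)"
      unfolding N by blast
    then have "x + y = (\<Sum>b\<in>B. of_int (c b + d b) *\<^sub>R b)"
      by (simp add: scaleR_left_distrib sum.distrib)
    then show ?thesis unfolding N by (intro CollectI exI[of _ "\<lambda>b. c b + d b"]) simp
  qed
  have scale: "of_int i *\<^sub>R b \<in> N" if "b \<in> B" for b i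
  proof -
    have "of_int i *\<^sub>R b = (\<Sum>a\<in>B. of_int (if a = b then i else 0) *\<^sub>R a)"
      using that B(1)
      by (simp add: if_distrib[of of_int] if_distrib[of "\<lambda>x. x *\<^sub>R _"] cong: if_cong)
    then show ?thesis unfolding N by (intro CollectI exI[of _ "\<lambda>a. if a = b then i else 0"]) simp
  qed
  have BN: "B \<subseteq> N" using scale[of _ 1] by auto
  have zero: "0 \<in> N" unfolding N by (intro CollectI exI[of _ "\<lambda>_. 0"]) simp
  have inj: "inj_on (\<lambda>m. restrict (\<lambda>n. m \<bullet> n) N) (dual_lattice N)"
  proof (rule inj_onI)
    fix m m' assume m: "m \<in> dual_lattice N" "m' \<in> dual_lattice N"
      and eq: "restrict (\<lambda>n. m \<bullet> n) N = restrict (\<lambda>n. m' \<bullet> n) N"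
    have "(m - m') \<bullet> n = 0" if "n \<in> N" for n
      using fun_cong[OF eq, of n] that by (simp add: inner_diff_left)
    then have "(m - m') \<bullet> x = 0" if "x \<in> span N" for x
      using that orthogonal_to_span[of x N "m - m'"] by (auto simp: orthogonal_def)
    moreover have "m - m' \<in> span N" using m by (simp add: dual_lattice_def span_diff)
    ultimately have "(m - m') \<bullet> (m - m') = 0" by blast
    then show "m = m'" by simp
  qed
  have into: "restrict (\<lambda>n. m \<bullet> n) N \<in> {h \<in> extensional N. additive_on N h \<and> h ` N \<subseteq> \<int>}"
    if "m \<in> dual_lattice N" for m
    using that add by (auto simp: additive_on_def dual_lattice_def inner_add_right)
  have onto: "h \<in> (\<lambda>m. restrict (\<lambda>n. m \<bullet> n) N) ` dual_lattice N"
    if h: "h \<in> extensional N" "additive_on N h" "h ` N \<subseteq> \<int>" for h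
  proof -
    have h0: "h 0 = 0" using h(2) zero unfolding additive_on_def
      by (metis add_cancel_right_right)
    have hmult: "h (of_nat j *\<^sub>R x) = of_nat j * h x \<and> of_nat j *\<^sub>R x \<in> N" if "x \<in> N" for j x
    proof (induction j)
      case 0 then show ?case using h0 zero by simp
    next
      case (Suc j)
      then have "h (x + of_nat j *\<^sub>R x) = h x + of_nat j * h x" "x + of_nat j *\<^sub>R x \<in> N"
        using h(2) that add unfolding additive_on_def by auto
      then show ?case by (simp add: algebra_simps)
    qed
    have hscale: "h (of_int i *\<^sub>R b) = of_int i * h b" if b: "b \<in> B" for i b
    proof (cases "i \<ge> 0")
      case True
      then show ?thesis using hmult[of b "nat i"] b BN by auto
    next
      case False
      have "h (of_int i *\<^sub>R b + of_nat (nat (-i)) *\<^sub>R b) = h (of_int i *\<^sub>R b) + h (of_nat (nat (-i)) *\<^sub>R b)"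
        using h(2) scale[OF b] hmult[of b] b BN unfolding additive_on_def by blast
      moreover have "of_int i *\<^sub>R b + of_nat (nat (-i)) *\<^sub>R b = 0"
        using False by (simp flip: scaleR_left_distrib)
      ultimately show ?thesis
        using hmult[of b "nat (-i)"] b BN h0 False by auto
    qed
    obtain g where g: "linear g" "\<And>b. b \<in> B \<Longrightarrow> g b = h b"
      using linear_independent_extend[OF B(2), of h] by blast
    have sum_in: "(\<Sum>b\<in>A. of_int (c b) *\<^sub>R b) \<in> N \<and>
                  h (\<Sum>b\<in>A. of_int (c b) *\<^sub>R b) = g (\<Sum>b\<in>A. of_int (c b) *\<^sub>R b)"
      if "finite A" "A \<subseteq> B" for A and c :: "'a \<Rightarrow> int"
      using that
    proof (induction A rule: finite_induct)
      case empty then show ?case using h0 zero linear_0[OF g(1)] by simp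
    next
      case (insert a A)
      then have a: "a \<in> B" and IH: "(\<Sum>b\<in>A. of_int (c b) *\<^sub>R b) \<in> N"
        "h (\<Sum>b\<in>A. of_int (c b) *\<^sub>R b) = g (\<Sum>b\<in>A. of_int (c b) *\<^sub>R b)" by auto
      have "h (of_int (c a) *\<^sub>R a + (\<Sum>b\<in>A. of_int (c b) *\<^sub>R b)) =
            h (of_int (c a) *\<^sub>R a) + h (\<Sum>b\<in>A. of_int (c b) *\<^sub>R b)"
        using h(2) scale[OF a] IH(1) unfolding additive_on_def by blast
      then show ?case
        using insert.hyps a IH g hscale[OF a] add[OF scale[OF a] IH(1)]
        by (simp add: linear_add linear_scale)
    qed
    have hg: "h n = g n" if n: "n \<in> N" for n
    proof -
      obtain c where "n = (\<Sum>b\<in>B. of_int (c b) *\<^sub>R b)" using n unfolding N by blast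
      then show ?thesis using sum_in[OF B(1) subset_refl, of c] by simp
    qed
    define w where "w = adjoint g (1 :: real)"
    have w: "w \<bullet> x = g x" for x
      using adjoint_works[OF g(1), of x "1 :: real"] by (simp add: w_def inner_commute)
    obtain y z where yz: "y \<in> span N" "\<And>x. x \<in> span N \<Longrightarrow> orthogonal z x" "w = y + z"
      using orthogonal_subspace_decomp_exists[of N w] by blast
    have y: "y \<bullet> n = h n" if "n \<in> N" for n
      using w[of n] yz(2)[OF span_base[OF that]] yz(3) hg[OF that]
      by (simp add: inner_add_left orthogonal_def)
    have "y \<in> dual_lattice N" using yz(1) y h(3) by (auto simp: dual_lattice_def)
    moreover have "h = restrict (\<lambda>n. y \<bullet> n) N"
      using h(1) y by (auto simp: extensional_def restrict_def)
    ultimately show ?thesis by blast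
  qed
  show ?thesis unfolding bij_betw_def using inj into onto by blast
qed

end

theory Submission
  imports Defs
begin

text \<open>
  The fan \<open>\<Sigma>\<close> has a simplicial refinement with the same rays. Every cone function \<open>f\<^sub>C\<close> is the sum of
  the functions of the relatively open simplicial cones contained in \<open>C\<close>, and the alternating sum
  over the cones containing a given point is 1 by an Euler characteristic argument. Hence \<open>\<rho>\<close> is
  the sum of the functions of all open simplicial cones, each a finite sum of terms
  \<open>\<chi> v * q\<^bsup>m \<bullet> v\<^esup> / (\<Prod>d. 1 - \<chi> d * q\<^bsup>m \<bullet> d\<^esup>)\<close> with \<open>\<chi> n = exp (2 \<pi> \<i> deg n)\<close>. For small \<open>q\<close> the
  denominators stay away from 0, uniformly in \<open>m\<close>: this is where \<open>\<chi> d \<noteq> 1\<close> is needed.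

  When \<open>m\<close> tends to infinity in the direction of \<open>u\<close>, all terms decay like \<open>|q|\<close> to a multiple of
  \<open>norm m\<close>, except on simplices where \<open>u \<le> 0\<close>; there the function is, up to such an error and a
  sign, that of the face orthogonal to \<open>u\<close>. For a fixed face these signs add up to zero, again
  by an Euler characteristic argument. Compactness of the sphere of directions gives a bound
  \<open>|\<rho>(q, m)| \<le> K |q|\<^bsup>\<delta> norm m\<^esup>\<close>, from which both claims follow.\<close>

section \<open>The Euler characteristic of partitions into open convex cells\<close>

text \<open>The condition on \<open>deg\<close> speaks of the given rays only, so a simplicial
  refinement by star subdivision at new rays would lose control of the denominators; pulling along
  the given generators keeps it. The single functions f_C do not decay in \<open>m\<close>: the cone
  {0} alone contributes 1 for every \<open>m\<close>. Convergence therefore rests on cancellation,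
  and the cancellation is combinatorial. Both Euler relations are local statements about the cells
  meeting a small open convex window, and both come from one fact: (-1)^dim is additive when a
  relatively open convex set is cut by a hyperplane. Lattice points of an open cone are tiled with
  box coefficients \<open>a\<close> in (0, 1]. After estimating the denominators, the exponent of
  |q| at a ray \<open>j\<close> is a (m . j) or (a - 1) (m . j), according to the sign of m . j. It
  is never negative, and it vanishes exactly when m . j = 0, or when m . j < 0 and a = 1. The second
  case is what survives at rays negative on \<open>u\<close> and produces the signs. All estimates
  are made for \<open>q \<noteq> 0\<close>; removable singularities and continuity carry them to
  \<open>q = 0\<close>.\<close>

definition euler_cell :: "'a::euclidean_space set \<Rightarrow> int" where
  "euler_cell X = (if X = {} then 0 else (- 1) ^ nat (aff_dim X))"

definition rel_open_convex :: "'a::euclidean_space set \<Rightarrow> bool" where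
  "rel_open_convex X \<longleftrightarrow> convex X \<and> openin (top_of_set (affine hull X)) X"

lemma rel_open_convexI:
  assumes "convex X" "affine A" "openin (top_of_set A) X"
  shows "rel_open_convex X"
proof (cases "X = {}")
  case False
  then have "affine hull X = A"
    using affine_hull_openin[of A X] assms(2,3) by (simp add: hull_same)
  with assms show ?thesis by (simp add: rel_open_convex_def)
qed (simp add: rel_open_convex_def)

text \<open>\<open>euler_cell\<close> is the Euler characteristic with compact supports, and this is
  its additivity. If the hyperplane really cuts \<open>X\<close>, both open sides keep the dimension
  d and the section has dimension d - 1, and (-1)^d = 2 (-1)^d + (-1)^(d-1). Otherwise at most one
  piece is nonempty. The empty set has \<open>aff_dim\<close> -1, which \<open>nat\<close> would
  turn into 0; hence the separate case in the definition.\<close>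

lemma rel_open_convex_split:
  assumes X: "rel_open_convex X"
  shows "rel_open_convex (X \<inter> {x. h \<bullet> x < c})" "rel_open_convex (X \<inter> {x. h \<bullet> x > c})"
    "rel_open_convex (X \<inter> {x. h \<bullet> x = c})"
    and "euler_cell X = euler_cell (X \<inter> {x. h \<bullet> x < c}) + euler_cell (X \<inter> {x. h \<bullet> x > c})
           + euler_cell (X \<inter> {x. h \<bullet> x = c})"
proof -
  let ?L = "{x. h \<bullet> x < c}" and ?G = "{x. h \<bullet> x > c}" and ?E = "{x. h \<bullet> x = c}"
  let ?A = "affine hull X"
  have cX: "convex X" and oX: "openin (top_of_set ?A) X"
    using X by (auto simp: rel_open_convex_def)
  have oL: "openin (top_of_set ?A) (X \<inter> ?L)" and oG: "openin (top_of_set ?A) (X \<inter> ?G)"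
    using oX by (auto intro!: openin_Int_open simp: open_halfspace_lt open_halfspace_gt)
  have oE: "openin (top_of_set (?A \<inter> ?E)) (X \<inter> ?E)"
    using oX by (auto simp: openin_open)
  have aE: "affine (?A \<inter> ?E)" by (intro affine_Int) (auto simp: affine_hyperplane)
  show "rel_open_convex (X \<inter> ?L)"
    by (rule rel_open_convexI[OF _ affine_affine_hull oL]) (rule convex_Int[OF cX convex_halfspace_lt])
  show "rel_open_convex (X \<inter> ?G)"
    by (rule rel_open_convexI[OF _ affine_affine_hull oG]) (rule convex_Int[OF cX convex_halfspace_gt])
  show "rel_open_convex (X \<inter> ?E)"
    by (rule rel_open_convexI[OF _ aE oE]) (rule convex_Int[OF cX convex_hyperplane])
  have dL: "aff_dim (X \<inter> ?L) = aff_dim X" if "X \<inter> ?L \<noteq> {}"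
    using aff_dim_openin[OF oL _ that] by simp
  have dG: "aff_dim (X \<inter> ?G) = aff_dim X" if "X \<inter> ?G \<noteq> {}"
    using aff_dim_openin[OF oG _ that] by simp
  have dE: "aff_dim (X \<inter> ?E) = aff_dim (?A \<inter> ?E)" if "X \<inter> ?E \<noteq> {}"
    using aff_dim_openin[OF oE aE that] by simp
  have dE': "aff_dim (X \<inter> ?E) = aff_dim X - 1" if "X \<inter> ?E \<noteq> {}" "\<not> X \<subseteq> ?E"
  proof -
    have "?A \<inter> ?E \<noteq> {}" using that(1) hull_subset[of X affine] by blast
    moreover have "\<not> ?A \<subseteq> ?E" using that(2) hull_subset[of X affine] by blast
    ultimately show ?thesis
      using dE[OF that(1)] aff_dim_affine_Int_hyperplane[of ?A h c] by simp
  qed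
  \<comment> \<open>Relative openness lets a segment in \<open>X\<close> be prolonged beyond its
    endpoint. Hence if \<open>X\<close> meets the hyperplane without lying in it, it has points on
    both sides.\<close>
  have prolong: "\<exists>e>0. x + e *\<^sub>R (x - y) \<in> X" if xy: "x \<in> X" "y \<in> X" for x y
  proof -
    have "rel_interior X = X" using oX rel_interior_openin by blast
    then have "x \<in> rel_interior X" using that by simp
    then obtain e where "e > 1" "(1 - e) *\<^sub>R y + e *\<^sub>R x \<in> X"
      using convex_rel_interior_iff[OF cX, of x] xy by blast
    then show ?thesis by (intro exI[of _ "e - 1"]) (simp add: algebra_simps)
  qed
  show "euler_cell X = euler_cell (X \<inter> ?L) + euler_cell (X \<inter> ?G) + euler_cell (X \<inter> ?E)"
  proof (cases "X \<subseteq> ?E")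
    case True
    then have "X \<inter> ?L = {}" "X \<inter> ?G = {}" "X \<inter> ?E = X" by auto
    then show ?thesis by (simp add: euler_cell_def)
  next
    case False
    show ?thesis
    proof (cases "X \<inter> ?E = {}")
      case True
      have "X \<inter> ?L = {} \<or> X \<inter> ?G = {}"
      proof (rule ccontr)
        assume "\<not> ?thesis"
        then obtain x y where "x \<in> X" "h \<bullet> x < c" "y \<in> X" "h \<bullet> y > c" by auto
        then have "\<exists>z\<in>X. h \<bullet> z = c"
          using connected_ivt_hyperplane[OF convex_connected[OF cX], of x y h c] by auto
        with True show False by auto
      qed
      moreover have "X = (X \<inter> ?L) \<union> (X \<inter> ?G)" using True by auto
      ultimately show ?thesis using True
        by (metis add_0 add.right_neutral euler_cell_def sup_bot.right_neutral sup_bot_left)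
    next
      case E: False
      then obtain x where x: "x \<in> X" "h \<bullet> x = c" by auto
      obtain y where y: "y \<in> X" "h \<bullet> y \<noteq> c" using False by auto
      obtain e where e: "e > 0" "x + e *\<^sub>R (x - y) \<in> X" using prolong[OF x(1) y(1)] by blast
      have val: "h \<bullet> (x + e *\<^sub>R (x - y)) = c + e * (c - h \<bullet> y)"
        using x by (simp add: inner_add_right inner_diff_right)
      have "X \<inter> ?L \<noteq> {} \<and> X \<inter> ?G \<noteq> {}"
      proof (cases "h \<bullet> y < c")
        case True
        then have "h \<bullet> (x + e *\<^sub>R (x - y)) > c" using e val by simp
        then show ?thesis using True y e by blast
      next
        case False
        then have "e * (c - h \<bullet> y) < 0" using e y by (simp add: mult_pos_neg)
        then have "h \<bullet> (x + e *\<^sub>R (x - y)) < c" using val by simp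
        then show ?thesis using False y e by force
      qed
      moreover have "aff_dim X \<ge> 1"
        using dE'[OF E False] E by (metis aff_dim_negative_iff diff_ge_0_iff_ge linorder_not_less)
      moreover have "X \<noteq> {}" using x by auto
      ultimately show ?thesis using dL dG dE'[OF E False] E
        by (simp add: euler_cell_def nat_diff_distrib power_diff)
    qed
  qed
qed

text \<open>Induction on the set \<open>S\<close> of functionals: a cut by one of them replaces
  \<open>X\<close> by three pieces on which its sign is constant, and additivity reassembles both
  sides of the equation. Once \<open>S\<close> is used up, a single \<open>P i\<close> contains all
  of \<open>X\<close>.\<close>

lemma euler_cell_partition:
  assumes "finite S" "finite I" "rel_open_convex X" "\<And>i. i \<in> I \<Longrightarrow> rel_open_convex (X \<inter> P i)"
    and "\<And>x. x \<in> X \<Longrightarrow> \<exists>!i. i \<in> I \<and> x \<in> P i"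
    and "\<And>i x y. i \<in> I \<Longrightarrow> x \<in> X \<inter> P i \<Longrightarrow> y \<in> X \<Longrightarrow>
           (\<And>s. s \<in> S \<Longrightarrow> sgn (s \<bullet> x) = sgn (s \<bullet> y)) \<Longrightarrow> y \<in> P i"
  shows "euler_cell X = (\<Sum>i\<in>I. euler_cell (X \<inter> P i))"
  using assms(1,3-)
proof (induction S arbitrary: X rule: finite_induct)
  case empty
  show ?case
  proof (cases "X = {}")
    case False
    then obtain x where x: "x \<in> X" by auto
    then obtain i where i: "i \<in> I" "x \<in> P i"
      using empty.prems(3) by blast
    have "X \<subseteq> P i" using empty.prems(4)[of i x] i x by auto
    moreover have "X \<inter> P j = {}" if "j \<in> I" "j \<noteq> i" for j
      using ex1_implies_ex[OF empty.prems(3)] empty.prems(3) \<open>X \<subseteq> P i\<close> i(1) that by (metis Int_iff ex_in_conv subsetD)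
    ultimately have "euler_cell (X \<inter> P j) = (if j = i then euler_cell X else 0)" if "j \<in> I" for j
      using that by (auto simp: euler_cell_def Int_absorb2)
    then show ?thesis using i assms(2) by (simp cong: sum.cong)
  qed (simp add: euler_cell_def)
next
  case (insert s S)
  have step: "euler_cell (X \<inter> Y) = (\<Sum>i\<in>I. euler_cell (X \<inter> P i \<inter> Y))"
    if Y: "Y \<in> {{x. s \<bullet> x < 0}, {x. s \<bullet> x > 0}, {x. s \<bullet> x = 0}}" for Y
  proof -
    have sg: "sgn (s \<bullet> x) = sgn (s \<bullet> y)" if "x \<in> Y" "y \<in> Y" for x y
      using that Y by auto
    have "euler_cell (X \<inter> Y) = (\<Sum>i\<in>I. euler_cell (X \<inter> Y \<inter> P i))"
    proof (rule insert.IH)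
      show "rel_open_convex (X \<inter> Y)"
        using Y rel_open_convex_split(1-3)[OF insert.prems(1)] by auto
      show "rel_open_convex (X \<inter> Y \<inter> P i)" if "i \<in> I" for i
        using Y rel_open_convex_split(1-3)[OF insert.prems(2)[OF that]]
        by (auto simp: Int_ac)
      show "\<exists>!i. i \<in> I \<and> x \<in> P i" if "x \<in> X \<inter> Y" for x
        using insert.prems(3) that by blast
      show "y \<in> P i" if "i \<in> I" "x \<in> X \<inter> Y \<inter> P i" "y \<in> X \<inter> Y"
        "\<And>t. t \<in> S \<Longrightarrow> sgn (t \<bullet> x) = sgn (t \<bullet> y)" for i x y
        using insert.prems(4)[of i x y] that sg[of x y] by auto
    qed
    then show ?thesis by (simp add: Int_ac)
  qed
  show ?case
    by (subst rel_open_convex_split(4)[OF insert.prems(1), of s 0])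
      (simp add: step sum.distrib[symmetric]
        rel_open_convex_split(4)[OF insert.prems(2), of _ s 0, symmetric])
qed

text \<open>A local Euler relation: the open convex window \<open>K\<close> sees only the cells that
  it meets, and neither \<open>V\<close> nor such a cell loses dimension inside \<open>K\<close>.
  Different windows yield the different relations below.\<close>

lemma euler_sum_open:
  fixes V :: "'a::euclidean_space set"
  assumes V: "subspace V" and fin: "finite S" "finite I"
    and P: "\<And>i. i \<in> I \<Longrightarrow> rel_open_convex (P i)" "\<And>i. i \<in> I \<Longrightarrow> P i \<subseteq> V"
    and part: "\<And>x. x \<in> V \<Longrightarrow> \<exists>!i. i \<in> I \<and> x \<in> P i"
    and inv: "\<And>i x y. i \<in> I \<Longrightarrow> x \<in> P i \<Longrightarrow> y \<in> V \<Longrightarrow>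
           (\<And>s. s \<in> S \<Longrightarrow> sgn (s \<bullet> x) = sgn (s \<bullet> y)) \<Longrightarrow> y \<in> P i"
    and K: "open K" "convex K" "V \<inter> K \<noteq> {}"
  shows "(\<Sum>i | i \<in> I \<and> P i \<inter> K \<noteq> {}. (- 1) ^ nat (aff_dim (P i))) = (- 1 :: int) ^ dim V"
proof -
  have aV: "affine V" using V by (simp add: subspace_imp_affine)
  have oVK: "openin (top_of_set V) (V \<inter> K)" using K by (simp add: openin_open_Int)
  have VK: "rel_open_convex (V \<inter> K)"
    using K V by (intro rel_open_convexI[OF _ aV oVK] convex_Int) (auto simp: subspace_imp_convex)
  have oPK: "openin (top_of_set (affine hull P i)) (P i \<inter> K)" if "i \<in> I" for i
    using P(1)[OF that] K by (intro openin_Int_open) (auto simp: rel_open_convex_def)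
  have "euler_cell (V \<inter> K) = (\<Sum>i\<in>I. euler_cell (V \<inter> K \<inter> P i))"
  proof (rule euler_cell_partition[OF fin VK])
    fix i assume i: "i \<in> I"
    have "V \<inter> K \<inter> P i = P i \<inter> K" using P(2)[OF i] by auto
    moreover have "rel_open_convex (P i \<inter> K)"
      using P(1)[OF i] K by (intro rel_open_convexI[OF _ _ oPK[OF i]] convex_Int)
        (auto simp: rel_open_convex_def)
    ultimately show "rel_open_convex (V \<inter> K \<inter> P i)" by simp
  qed (use part inv in blast)+
  also have "\<dots> = (\<Sum>i\<in>I. if P i \<inter> K \<noteq> {} then (- 1) ^ nat (aff_dim (P i)) else 0)"
  proof (rule sum.cong)
    fix i assume i: "i \<in> I"
    have "V \<inter> K \<inter> P i = P i \<inter> K" using P(2)[OF i] by auto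
    moreover have "aff_dim (P i \<inter> K) = aff_dim (P i)" if "P i \<inter> K \<noteq> {}"
      using aff_dim_openin[OF oPK[OF i] _ that] by simp
    ultimately show "euler_cell (V \<inter> K \<inter> P i) =
        (if P i \<inter> K \<noteq> {} then (- 1) ^ nat (aff_dim (P i)) else 0)"
      by (simp add: euler_cell_def)
  qed simp
  also have "\<dots> = (\<Sum>i | i \<in> I \<and> P i \<inter> K \<noteq> {}. (- 1) ^ nat (aff_dim (P i)))"
    using fin by (simp add: sum.inter_filter)
  finally have "(\<Sum>i | i \<in> I \<and> P i \<inter> K \<noteq> {}. (- 1) ^ nat (aff_dim (P i))) = euler_cell (V \<inter> K)"
    by simp
  also have "aff_dim (V \<inter> K) = aff_dim V" using aff_dim_openin[OF oVK aV] K by simp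
  then have "euler_cell (V \<inter> K) = (- 1) ^ dim V"
    using K V by (simp add: euler_cell_def aff_dim_subspace)
  finally show ?thesis .
qed

section \<open>Fans and open cones\<close>

definition open_cone :: "'a::real_vector set \<Rightarrow> 'a set" where
  "open_cone J = {(\<Sum>j\<in>J. a j *\<^sub>R j) | a. \<forall>j\<in>J. 0 < a j}"

lemma open_coneI: "(\<And>j. j \<in> J \<Longrightarrow> 0 < a j) \<Longrightarrow> (\<Sum>j\<in>J. a j *\<^sub>R j) \<in> open_cone J"
  unfolding open_cone_def by blast

lemma open_coneD: "x \<in> open_cone J \<Longrightarrow> \<exists>a. x = (\<Sum>j\<in>J. a j *\<^sub>R j) \<and> (\<forall>j\<in>J. 0 < a j)"
  unfolding open_cone_def by blast

lemma open_cone_empty [simp]: "open_cone {} = {0}"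
  by (auto simp: open_cone_def)

lemma open_cone_insert:
  assumes "finite J" "e \<notin> J"
  shows "x \<in> open_cone (insert e J) \<longleftrightarrow> (\<exists>s>0. \<exists>y\<in>open_cone J. x = s *\<^sub>R e + y)"
proof
  assume "x \<in> open_cone (insert e J)"
  then obtain a where "x = (\<Sum>j\<in>insert e J. a j *\<^sub>R j)" "\<And>j. j \<in> insert e J \<Longrightarrow> 0 < a j"
    by (blast dest: open_coneD)
  then show "\<exists>s>0. \<exists>y\<in>open_cone J. x = s *\<^sub>R e + y"
    using assms open_coneI[of J a] by auto
next
  assume "\<exists>s>0. \<exists>y\<in>open_cone J. x = s *\<^sub>R e + y"
  then obtain s a where s: "s > 0" "\<And>j. j \<in> J \<Longrightarrow> 0 < a j" "x = s *\<^sub>R e + (\<Sum>j\<in>J. a j *\<^sub>R j)"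
    by (blast dest: open_coneD)
  define b where "b = (\<lambda>j. if j = e then s else a j)"
  have "(\<Sum>j\<in>J. a j *\<^sub>R j) = (\<Sum>j\<in>J. b j *\<^sub>R j)"
    using assms by (intro sum.cong) (auto simp: b_def)
  then have "x = (\<Sum>j\<in>insert e J. b j *\<^sub>R j)" using assms s by (simp add: b_def)
  then show "x \<in> open_cone (insert e J)" using open_coneI[of "insert e J" b] s(1,2) unfolding b_def by fastforce
qed

locale fan =
  fixes V :: "'a::euclidean_space set" and \<Sigma> :: "'a set set"
  assumes subspace_V: "subspace V"
    and finite_fan: "finite \<Sigma>"
    and closed_cone: "C \<in> \<Sigma> \<Longrightarrow> closed C"
    and convex_cone: "C \<in> \<Sigma> \<Longrightarrow> convex C"
    and cone_cone: "C \<in> \<Sigma> \<Longrightarrow> cone C"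
    and zero_in: "C \<in> \<Sigma> \<Longrightarrow> 0 \<in> C"
    and pointed: "C \<in> \<Sigma> \<Longrightarrow> v \<in> C \<Longrightarrow> - v \<in> C \<Longrightarrow> v = 0"
    and face_in: "C \<in> \<Sigma> \<Longrightarrow> F face_of C \<Longrightarrow> F \<noteq> {} \<Longrightarrow> F \<in> \<Sigma>"
    and Int_face: "C \<in> \<Sigma> \<Longrightarrow> D \<in> \<Sigma> \<Longrightarrow> C \<inter> D face_of C"
    and complete: "\<Union>\<Sigma> = V"
begin

lemma scale_in: "C \<in> \<Sigma> \<Longrightarrow> x \<in> C \<Longrightarrow> 0 \<le> t \<Longrightarrow> t *\<^sub>R x \<in> C"
  using cone_cone unfolding cone_def by blast

lemma add_in: "C \<in> \<Sigma> \<Longrightarrow> x \<in> C \<Longrightarrow> y \<in> C \<Longrightarrow> x + y \<in> C"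
  using convex_cone[of C] cone_cone[of C] Convex.convex_cone[of C] by blast

lemma sum_in: "C \<in> \<Sigma> \<Longrightarrow> (\<And>j. j \<in> J \<Longrightarrow> f j \<in> C) \<Longrightarrow> sum f J \<in> C"
  by (induction J rule: infinite_finite_induct) (auto intro: add_in zero_in)

lemma cone_subset_V: "C \<in> \<Sigma> \<Longrightarrow> C \<subseteq> V"
  using complete by blast

text \<open>The face property in additive form: half of \<open>x + y\<close> is the midpoint of the
  segment from \<open>x\<close> to \<open>y\<close> and lies in the face \<open>C \<inter> D\<close>
  of \<open>C\<close>. For \<open>x = y\<close> the open segment is empty, and scaling does the
  work.\<close>

lemma face_split:
  assumes "C \<in> \<Sigma>" "D \<in> \<Sigma>" "x \<in> C" "y \<in> C" "x + y \<in> D"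
  shows "x \<in> D"
proof (cases "x = y")
  case True
  then have "(1 / 2) *\<^sub>R (x + x) \<in> D" using scale_in[of D "x + x" "1/2"] assms by simp
  then show ?thesis by (simp flip: scaleR_2)
next
  case False
  have "(1 / 2) *\<^sub>R (x + y) \<in> C" "(1 / 2) *\<^sub>R (x + y) \<in> D"
    using scale_in[OF assms(1) add_in[OF assms(1,3,4)], of "1/2"] scale_in[OF assms(2,5), of "1/2"]
    by auto
  moreover have "midpoint x y \<in> open_segment x y" using False by simp
  ultimately have "x \<in> C \<inter> D"
    using face_ofD[OF Int_face[OF assms(1,2)], of "midpoint x y" x y] assms
    by (simp add: midpoint_def)
  then show ?thesis by simp
qed

text \<open>The smallest cone of the fan containing \<open>X\<close>, provided that some cone
  contains \<open>X\<close>; otherwise the intersection runs over the empty family and is the whole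
  type.\<close>

definition hull_cone :: "'a set \<Rightarrow> 'a set" where
  "hull_cone X = \<Inter>{C \<in> \<Sigma>. X \<subseteq> C}"

lemma subset_hull_cone: "X \<subseteq> hull_cone X"
  by (auto simp: hull_cone_def)

lemma hull_cone_subset: "C \<in> \<Sigma> \<Longrightarrow> X \<subseteq> C \<Longrightarrow> hull_cone X \<subseteq> C"
  by (auto simp: hull_cone_def)

lemma hull_cone_mono: "X \<subseteq> Y \<Longrightarrow> hull_cone X \<subseteq> hull_cone Y"
  by (auto simp: hull_cone_def)

lemma Int_in: "C \<in> \<Sigma> \<Longrightarrow> D \<in> \<Sigma> \<Longrightarrow> C \<inter> D \<in> \<Sigma>"
  using face_in[of C "C \<inter> D"] Int_face[of C D] zero_in[of C] zero_in[of D] by blast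

lemma hull_cone_in: assumes "C \<in> \<Sigma>" "X \<subseteq> C" shows "hull_cone X \<in> \<Sigma>"
proof -
  have inter: "\<Inter>F \<in> \<Sigma>" if "finite F" "F \<noteq> {}" "F \<subseteq> \<Sigma>" for F
    using that by (induction F rule: finite_ne_induct) (auto intro: Int_in)
  then show ?thesis unfolding hull_cone_def using finite_fan assms by (intro inter) auto
qed

section \<open>Smallest cones and relative interiors\<close>

lemma hull_cone_point_in: "x \<in> V \<Longrightarrow> hull_cone {x} \<in> \<Sigma>"
proof -
  assume "x \<in> V"
  then obtain C where "C \<in> \<Sigma>" "x \<in> C" using complete by blast
  then show ?thesis using hull_cone_in[of C "{x}"] by simp
qed

lemma in_hull_cone_point: "x \<in> hull_cone {x}"
  using subset_hull_cone[of "{x}"] by simp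

text \<open>Were \<open>x\<close> on the relative boundary, a supporting hyperplane at
  \<open>x\<close> would cut out a proper face. That face is again a cone of the fan and contains
  \<open>x\<close>, against minimality.\<close>

lemma rel_interior_hull_cone:
  assumes "x \<in> V" shows "x \<in> rel_interior (hull_cone {x})"
proof (rule ccontr)
  let ?C = "hull_cone {x}"
  assume n: "x \<notin> rel_interior ?C"
  have C: "?C \<in> \<Sigma>" by (rule hull_cone_point_in[OF assms])
  obtain a where a: "\<And>y. y \<in> ?C \<Longrightarrow> a \<bullet> x \<le> a \<bullet> y" "\<And>y. y \<in> rel_interior ?C \<Longrightarrow> a \<bullet> x < a \<bullet> y"
    by (rule supporting_hyperplane_rel_boundary[OF convex_cone[OF C] in_hull_cone_point n]) metis
  let ?F = "?C \<inter> {y. a \<bullet> y = a \<bullet> x}"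
  have "?F face_of ?C"
    using face_of_Int_supporting_hyperplane_ge[OF convex_cone[OF C] a(1)] by simp
  moreover have xF: "x \<in> ?F" using in_hull_cone_point by simp
  ultimately have "?F \<in> \<Sigma>" using face_in[OF C] by blast
  then have "?C \<subseteq> ?F" using xF by (intro hull_cone_subset) auto
  moreover obtain y where "y \<in> rel_interior ?C"
    using rel_interior_eq_empty[OF convex_cone[OF C]] in_hull_cone_point by blast
  ultimately show False using a(2)[of y] rel_interior_subset[of ?C] by auto
qed

text \<open>A face that meets the relative interior of \<open>C\<close> is all of \<open>C\<close>;
  apply this to the face \<open>C \<inter> hull_cone {x}\<close>. Consequently the relative
  interiors of the cones partition \<open>V\<close>.\<close>

lemma rel_interior_iff_hull_cone:
  assumes "C \<in> \<Sigma>" "x \<in> V"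
  shows "x \<in> rel_interior C \<longleftrightarrow> hull_cone {x} = C"
proof
  assume x: "x \<in> rel_interior C"
  then have "x \<in> C" using rel_interior_subset by blast
  then have sub: "hull_cone {x} \<subseteq> C" using assms by (intro hull_cone_subset) auto
  have "C \<inter> hull_cone {x} face_of C"
    by (rule Int_face[OF assms(1) hull_cone_point_in[OF assms(2)]])
  moreover have "x \<in> (C \<inter> hull_cone {x}) \<inter> rel_interior C"
    using x \<open>x \<in> C\<close> in_hull_cone_point[of x] by simp
  ultimately have "C \<subseteq> C \<inter> hull_cone {x}" using subset_of_face_of[of _ C C] by blast
  with sub show "hull_cone {x} = C" by auto
qed (use rel_interior_hull_cone[OF assms(2)] in auto)

text \<open>A relative interior point can be moved a little away from any \<open>y\<close> of the
  cone. Rescaling the moved point by \<open>1 / t\<close> turns it into \<open>x\<close> minus a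
  multiple of \<open>y\<close>.\<close>

lemma hull_cone_prolong:
  assumes x: "x \<in> V" and y: "y \<in> hull_cone {x}"
  shows "\<exists>e>0. x - e *\<^sub>R y \<in> hull_cone {x}"
proof -
  let ?C = "hull_cone {x}"
  have C: "?C \<in> \<Sigma>" by (rule hull_cone_point_in[OF x])
  obtain t where t: "t > 1" "(1 - t) *\<^sub>R y + t *\<^sub>R x \<in> ?C"
    using convex_rel_interior_iff[OF convex_cone[OF C], of x] rel_interior_hull_cone[OF x] y by blast
  then have "(1 / t) *\<^sub>R ((1 - t) *\<^sub>R y + t *\<^sub>R x) \<in> ?C" using C by (intro scale_in) auto
  moreover have "(1 / t) *\<^sub>R ((1 - t) *\<^sub>R y + t *\<^sub>R x) = x - ((t - 1) / t) *\<^sub>R y"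
    using t(1) by (simp add: algebra_simps diff_divide_distrib)
  ultimately show ?thesis using t(1) by (intro exI[of _ "(t - 1) / t"]) simp
qed

lemma hull_cone_zero: "hull_cone {0} = {0}"
proof -
  have "y = 0" if y: "y \<in> hull_cone {0}" for y
  proof -
    have V0: "0 \<in> V" using subspace_0[OF subspace_V] .
    obtain e where e: "e > 0" "0 - e *\<^sub>R y \<in> hull_cone {0}"
      using hull_cone_prolong[OF V0 y] by blast
    then have "(1 / e) *\<^sub>R (- (e *\<^sub>R y)) \<in> hull_cone {0}"
      using hull_cone_point_in[OF V0] by (intro scale_in) auto
    then show "y = 0" using pointed[OF hull_cone_point_in[OF V0] y] e by simp
  qed
  then show ?thesis using in_hull_cone_point by blast
qed

lemma zero_cone_in: "{0} \<in> \<Sigma>"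
  using hull_cone_point_in[of 0] subspace_0[OF subspace_V] by (simp add: hull_cone_zero)

lemma hull_cone_empty: "hull_cone {} = {0}"
proof
  show "hull_cone {} \<subseteq> {0}" using hull_cone_mono[of "{}" "{0}"] hull_cone_zero by simp
  show "{0} \<subseteq> hull_cone {}" unfolding hull_cone_def using zero_in by blast
qed

text \<open>The set of admissible \<open>t\<close> is closed. It is bounded, since otherwise
  dividing \<open>x - t *\<^sub>R e\<close> by \<open>t\<close> and letting \<open>t\<close> grow
  would put \<open>- e\<close> into the pointed cone \<open>C\<close>. So its supremum is
  attained.\<close>

lemma pull_back:
  assumes C: "C \<in> \<Sigma>" and e: "e \<in> C" "e \<noteq> 0" and x: "x \<in> C"
  obtains s where "s \<ge> 0" "x - s *\<^sub>R e \<in> C" "\<And>t. t > s \<Longrightarrow> x - t *\<^sub>R e \<notin> C"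
proof -
  define T where "T = {t. 0 \<le> t \<and> x - t *\<^sub>R e \<in> C}"
  have "closed ((\<lambda>t. x - t *\<^sub>R e) -` C)"
    using closed_cone[OF C] by (intro continuous_closed_vimage) auto
  then have cl: "closed T"
    unfolding T_def by (auto simp: Collect_conj_eq vimage_def intro!: closed_Collect_le)
  have T0: "0 \<in> T" using x by (simp add: T_def)
  have bdd: "bdd_above T"
  proof (rule ccontr)
    assume nb: "\<not> bdd_above T"
    have "\<exists>t\<in>T. t > real (Suc n)" for n using nb unfolding bdd_above_def by (meson not_le)
    then obtain t where t: "\<And>n. t n \<in> T" "\<And>n. t n > real (Suc n)" by metis
    have tpos: "t n > 0" for n using t(2)[of n] by linarith
    have "(1 / t n) *\<^sub>R x - e \<in> C" for n
    proof -
      have "(1 / t n) *\<^sub>R (x - t n *\<^sub>R e) \<in> C"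
        using t(1)[of n] tpos[of n] C unfolding T_def by (intro scale_in) auto
      then show ?thesis using tpos[of n] by (simp add: scaleR_diff_right)
    qed
    moreover have "(\<lambda>n. (1 / t n) *\<^sub>R x - e) \<longlonglongrightarrow> 0 *\<^sub>R x - e"
    proof (intro tendsto_intros)
      have "(\<lambda>n. inverse (real (Suc n))) \<longlonglongrightarrow> 0" by (rule LIMSEQ_inverse_real_of_nat)
      then show "(\<lambda>n. 1 / t n) \<longlonglongrightarrow> 0"
      proof (rule Lim_null_comparison[rotated])
        have "norm (1 / t n) \<le> inverse (real (Suc n))" for n
          using t(2)[of n] tpos[of n] by (simp add: inverse_eq_divide frac_le)
        then show "eventually (\<lambda>n. norm (1 / t n) \<le> inverse (real (Suc n))) sequentially"
          by simp
      qed
    qed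
    ultimately have "0 *\<^sub>R x - e \<in> C" by (rule closed_sequentially[OF closed_cone[OF C]])
    then show False using pointed[OF C e(1)] e(2) by simp
  qed
  have "Sup T \<in> T" using closed_contains_Sup[OF _ bdd cl] T0 by blast
  moreover have "x - t *\<^sub>R e \<notin> C" if "t > Sup T" for t
  proof
    assume "x - t *\<^sub>R e \<in> C"
    then have "t \<in> T" using that cSup_upper[OF T0 bdd] by (simp add: T_def)
    then show False using cSup_upper[OF _ bdd] that by fastforce
  qed
  ultimately show ?thesis using that[of "Sup T"] unfolding T_def by blast
qed

text \<open>Otherwise pulling a point of a minimal nonzero cone back along an independent direction
  would produce a smaller one.\<close>

lemma exists_one_dimensional:
  assumes "C \<in> \<Sigma>" "C \<noteq> {0}"
  obtains R where "R \<in> \<Sigma>" "R \<subseteq> C" "dim R = 1"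
proof -
  let ?F = "{R \<in> \<Sigma>. R \<subseteq> C \<and> R \<noteq> {0}}"
  have "finite ?F" "C \<in> ?F" using finite_fan assms by auto
  then obtain R where R: "R \<in> ?F" "\<And>S. S \<in> ?F \<Longrightarrow> S \<subseteq> R \<Longrightarrow> S = R"
    using finite_has_minimal[of ?F] by (metis (no_types, lifting) empty_iff)
  have RS: "R \<in> \<Sigma>" using R by simp
  obtain x where x: "x \<in> R" "x \<noteq> 0" using R zero_in[OF RS] by blast
  have "R \<subseteq> span {x}"
  proof
    fix y assume y: "y \<in> R"
    obtain s where s: "s \<ge> 0" "y - s *\<^sub>R x \<in> R" "\<And>t. t > s \<Longrightarrow> y - t *\<^sub>R x \<notin> R"
      using pull_back[OF RS x y] by blast
    define z where "z = y - s *\<^sub>R x"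
    have zV: "z \<in> V" using s(2) cone_subset_V[OF RS] by (auto simp: z_def)
    have sub: "hull_cone {z} \<subseteq> R" using s(2) RS by (intro hull_cone_subset) (auto simp: z_def)
    have "hull_cone {z} \<noteq> R"
    proof
      assume eq: "hull_cone {z} = R"
      then obtain e where "e > 0" "z - e *\<^sub>R x \<in> R"
        using hull_cone_prolong[OF zV, of x] x by auto
      then show False using s(3)[of "s + e"] by (simp add: z_def algebra_simps)
    qed
    then have "hull_cone {z} = {0}"
      using R(1) R(2)[of "hull_cone {z}"] sub hull_cone_point_in[OF zV] by blast
    then have "z = 0" using in_hull_cone_point[of z] by simp
    then show "y \<in> span {x}" by (simp add: z_def span_base span_scale)
  qed
  then have "dim R \<le> dim (span {x})" by (rule dim_subset)
  moreover have "dim {x} \<le> dim R" using x by (intro dim_subset) auto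
  moreover have "dim {x} = 1" using x(2) by simp
  ultimately have "dim R = 1" by (simp add: dim_span)
  moreover have "R \<subseteq> C" using R(1) by simp
  ultimately show ?thesis using that[OF RS] by blast
qed

end

section \<open>A simplicial refinement without new rays\<close>

text \<open>The pulling triangulation: \<open>J\<close> is a simplex iff its least element is the least element of
  \<open>D\<close> in the smallest cone containing \<open>J\<close>, and recursively for the remaining elements of \<open>J\<close>.\<close>

locale fan_rays = fan +
  fixes D :: "'a set" and ord :: "'a \<Rightarrow> nat"
  assumes finite_D: "finite D" and zero_notin_D: "0 \<notin> D" and D_sub: "D \<subseteq> V"
    and inj_ord: "inj_on ord D"
    and ray_in: "C \<in> \<Sigma> \<Longrightarrow> C \<noteq> {0} \<Longrightarrow> \<exists>d\<in>D. d \<in> C"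
begin

definition triang :: "'a set set" where
  "triang = {J. J \<subseteq> D \<and> (\<exists>C\<in>\<Sigma>. J \<subseteq> C) \<and>
     (\<forall>j\<in>J. \<forall>d\<in>D. ord d < ord j \<longrightarrow> d \<notin> hull_cone {i\<in>J. ord j \<le> ord i})}"

lemma finite_triang: "finite triang"
  by (rule finite_subset[of _ "Pow D"]) (auto simp: triang_def finite_D)

lemma triang_sub: "J \<in> triang \<Longrightarrow> J \<subseteq> D"
  by (auto simp: triang_def)

lemma triang_finite: "J \<in> triang \<Longrightarrow> finite J"
  by (rule finite_subset[OF triang_sub finite_D])

lemma triang_cone: "J \<in> triang \<Longrightarrow> \<exists>C\<in>\<Sigma>. J \<subseteq> C"
  by (auto simp: triang_def)

lemma triang_down: assumes "J \<in> triang" "I \<subseteq> J" shows "I \<in> triang"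
proof -
  have "hull_cone {i\<in>I. ord j \<le> ord i} \<subseteq> hull_cone {i\<in>J. ord j \<le> ord i}" for j
    using assms(2) by (intro hull_cone_mono) auto
  then show ?thesis using assms unfolding triang_def by blast
qed

text \<open>The least element of \<open>J - {e}\<close> comes after \<open>e\<close> and is the
  first generator in the smallest cone of \<open>J - {e}\<close>, so that cone cannot contain
  \<open>e\<close>. This exhibits a simplex as a pyramid with apex \<open>e\<close> over a simplex
  in a face missing \<open>e\<close>, the form used for independence and for disjointness.\<close>

lemma triang_min:
  assumes J: "J \<in> triang" "J \<noteq> {}"
  obtains e where "e \<in> J" "\<And>d. d \<in> D \<Longrightarrow> d \<in> hull_cone J \<Longrightarrow> ord e \<le> ord d"
    "e \<notin> hull_cone (J - {e})"
proof -
  have least: "\<exists>e\<in>I. \<forall>d\<in>D. d \<in> hull_cone I \<longrightarrow> ord e \<le> ord d" if I: "I \<in> triang" "I \<noteq> {}" for I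
  proof -
    obtain e where e: "e \<in> I" "\<And>i. i \<in> I \<Longrightarrow> ord e \<le> ord i"
      using ex_has_least_nat[of "\<lambda>e. e \<in> I" _ ord] I(2) by blast
    then have "{i\<in>I. ord e \<le> ord i} = I" by auto
    then have "\<forall>d\<in>D. d \<in> hull_cone I \<longrightarrow> ord e \<le> ord d"
      using I(1) e(1) unfolding triang_def by (auto simp: not_less[symmetric])
    then show ?thesis using e(1) by blast
  qed
  obtain e where e: "e \<in> J" "\<And>d. d \<in> D \<Longrightarrow> d \<in> hull_cone J \<Longrightarrow> ord e \<le> ord d"
    using least[OF J] by blast
  have "e \<notin> hull_cone (J - {e})"
  proof (cases "J - {e} = {}")
    case True
    then show ?thesis using e(1) triang_sub[OF J(1)] zero_notin_D
      unfolding True hull_cone_empty by auto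
  next
    case False
    obtain f where f: "f \<in> J - {e}" "\<forall>d\<in>D. d \<in> hull_cone (J - {e}) \<longrightarrow> ord f \<le> ord d"
      using least[OF triang_down[OF J(1)] False] by blast
    have fD: "f \<in> D" "e \<in> D" using f e triang_sub[OF J(1)] by auto
    have "ord e \<le> ord f" using e(2)[OF fD(1)] f(1) subset_hull_cone[of J] by auto
    moreover have "ord e \<noteq> ord f" using inj_ord fD f(1) by (auto dest: inj_onD)
    ultimately show ?thesis using f(2) fD(2) by auto
  qed
  with e that[of e] show ?thesis by blast
qed

lemma hull_cone_triang_in: "J \<in> triang \<Longrightarrow> hull_cone J \<in> \<Sigma>"
  using triang_cone[of J] hull_cone_in[of _ J] by blast

lemma open_cone_in:
  assumes "C \<in> \<Sigma>" "J \<subseteq> C" "x \<in> open_cone J" shows "x \<in> C"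
proof -
  obtain a where "x = (\<Sum>j\<in>J. a j *\<^sub>R j)" "\<And>j. j \<in> J \<Longrightarrow> 0 < a j"
    using open_coneD[OF assms(3)] by blast
  then show ?thesis
    using sum_in[OF assms(1), of J "\<lambda>j. a j *\<^sub>R j"] scale_in[OF assms(1)] assms(2)
    by (simp add: less_imp_le subset_iff)
qed

text \<open>A point of the open cone is a sum of positive multiples of all elements of
  \<open>J\<close>, and by \<open>face_split\<close> a cone containing the sum contains every
  summand.\<close>

lemma open_cone_subset_cone_iff:
  assumes J: "J \<in> triang" and x: "x \<in> open_cone J" and C: "C \<in> \<Sigma>"
  shows "x \<in> C \<longleftrightarrow> J \<subseteq> C"
proof
  assume xC: "x \<in> C"
  obtain D' where D': "D' \<in> \<Sigma>" "J \<subseteq> D'" using triang_cone[OF J] by blast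
  obtain a where a: "x = (\<Sum>j\<in>J. a j *\<^sub>R j)" "\<And>j. j \<in> J \<Longrightarrow> 0 < a j"
    using open_coneD[OF x] by blast
  show "J \<subseteq> C"
  proof
    fix j assume j: "j \<in> J"
    have mem: "a i *\<^sub>R i \<in> D'" if "i \<in> J" for i
      using that a(2)[OF that] D' by (intro scale_in) auto
    have "a j *\<^sub>R j + (\<Sum>i\<in>J - {j}. a i *\<^sub>R i) \<in> C"
      using xC a(1) j triang_finite[OF J] by (simp add: sum.remove)
    moreover have "(\<Sum>i\<in>J - {j}. a i *\<^sub>R i) \<in> D'" using mem by (intro sum_in[OF D'(1)]) auto
    ultimately have "a j *\<^sub>R j \<in> C" using face_split[OF D'(1) C mem[OF j]] by blast
    then have "(1 / a j) *\<^sub>R (a j *\<^sub>R j) \<in> C" using C a(2)[OF j] by (intro scale_in[of C "a j *\<^sub>R j"]) auto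
    then show "j \<in> C" using a(2)[OF j] by simp
  qed
qed (rule open_cone_in[OF C _ x])

lemma hull_cone_open_cone:
  assumes "J \<in> triang" "x \<in> open_cone J"
  shows "hull_cone {x} = hull_cone J"
proof -
  have "{C \<in> \<Sigma>. {x} \<subseteq> C} = {C \<in> \<Sigma>. J \<subseteq> C}"
    using open_cone_subset_cone_iff[OF assms] by auto
  then show ?thesis by (simp add: hull_cone_def)
qed

text \<open>If the apex \<open>e\<close> were a combination of the other elements, moving the
  negative coefficients to its side would show that \<open>e\<close> plus a point of the cone of
  \<open>J\<close> lies in the cone of the base. By \<open>face_split\<close> the latter would
  contain \<open>e\<close>.\<close>

lemma triang_independent: "J \<in> triang \<Longrightarrow> independent J"
proof (induction "card J" arbitrary: J)
  case 0
  then show ?case using triang_finite by (auto simp: independent_empty)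
next
  case (Suc n)
  have fin: "finite J" and ne: "J \<noteq> {}" using Suc.hyps(2) Suc.prems triang_finite by auto
  obtain e where e: "e \<in> J" "e \<notin> hull_cone (J - {e})" using triang_min[OF Suc.prems ne] by metis
  let ?I = "J - {e}"
  have I: "?I \<in> triang" by (rule triang_down[OF Suc.prems]) auto
  have ind: "independent ?I" using Suc.hyps(1)[OF _ I] Suc.hyps(2) e(1) fin by simp
  have "e \<notin> span ?I"
  proof
    assume "e \<in> span ?I"
    then obtain c where c: "e = (\<Sum>i\<in>?I. c i *\<^sub>R i)" using span_finite[of ?I] fin by auto
    let ?H = "hull_cone ?I" and ?G = "hull_cone J"
    have H: "?H \<in> \<Sigma>" and G: "?G \<in> \<Sigma>" using hull_cone_triang_in[OF I] hull_cone_triang_in[OF Suc.prems] .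
    have "(\<Sum>i\<in>?I. \<bar>c i\<bar> *\<^sub>R i) \<in> ?G"
      using subset_hull_cone[of J] by (intro sum_in[OF G] scale_in[OF G]) auto
    moreover have "(\<Sum>i\<in>?I. (c i + \<bar>c i\<bar>) *\<^sub>R i) \<in> ?H"
      using subset_hull_cone[of ?I] by (intro sum_in[OF H] scale_in[OF H]) auto
    then have "e + (\<Sum>i\<in>?I. \<bar>c i\<bar> *\<^sub>R i) \<in> ?H"
      by (simp add: scaleR_left_distrib sum.distrib flip: c)
    ultimately have "e \<in> ?H" using face_split[OF G H] e(1) subset_hull_cone[of J] by blast
    with e(2) show False ..
  qed
  then have "independent (insert e ?I)" using ind by (rule independent_insertI)
  moreover have "insert e ?I = J" using e(1) by blast
  ultimately show ?case by simp
qed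

text \<open>Simplices whose open cones share \<open>x\<close> have the same smallest cone, hence the
  same apex \<open>e\<close>. In \<open>x = s *\<^sub>R e + y = t *\<^sub>R e + z\<close>, unequal
  heights would write \<open>y\<close> or \<open>z\<close> as the other plus a positive multiple of
  \<open>e\<close>, and \<open>face_split\<close> would put \<open>e\<close> into the cone of a
  base. So \<open>y = z\<close>, and the induction continues with the bases.\<close>

lemma triang_unique:
  assumes "I \<in> triang" "J \<in> triang" "x \<in> open_cone I" "x \<in> open_cone J"
  shows "I = J"
  using assms
proof (induction "card I" arbitrary: I J x)
  case 0
  then have "I = {}" using triang_finite by auto
  then have "x = 0" using "0.prems"(3) by simp
  then have "hull_cone J = {0}" using hull_cone_open_cone[OF "0.prems"(2,4)] hull_cone_zero by simp
  then have "J \<subseteq> {0}" using subset_hull_cone[of J] by simp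
  then show ?case using \<open>I = {}\<close> triang_sub[OF "0.prems"(2)] zero_notin_D by auto
next
  case (Suc n)
  note I = Suc.prems(1) and J = Suc.prems(2)
  have eq: "hull_cone I = hull_cone J"
    using hull_cone_open_cone[OF I Suc.prems(3)] hull_cone_open_cone[OF J Suc.prems(4)] by simp
  have Ine: "I \<noteq> {}" using Suc.hyps(2) by auto
  have Jne: "J \<noteq> {}"
  proof
    assume "J = {}"
    then have "I \<subseteq> {0}" using eq hull_cone_empty subset_hull_cone[of I] by simp
    then show False using Ine triang_sub[OF I] zero_notin_D by auto
  qed
  obtain e where e: "e \<in> I" "\<And>d. d \<in> D \<Longrightarrow> d \<in> hull_cone I \<Longrightarrow> ord e \<le> ord d"
    "e \<notin> hull_cone (I - {e})" by (rule triang_min[OF I Ine]) blast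
  obtain f where f: "f \<in> J" "\<And>d. d \<in> D \<Longrightarrow> d \<in> hull_cone J \<Longrightarrow> ord f \<le> ord d"
    "f \<notin> hull_cone (J - {f})" by (rule triang_min[OF J Jne]) blast
  have eD: "e \<in> D" "f \<in> D" using e f triang_sub I J by auto
  have "ord e = ord f"
    using e(2)[OF eD(2)] f(2)[OF eD(1)] e(1) f(1) eq subset_hull_cone by (metis antisym subsetD)
  then have ef: "e = f" using inj_ord eD by (auto dest: inj_onD)
  have I': "I - {e} \<in> triang" and J': "J - {e} \<in> triang"
    using triang_down[OF I] triang_down[OF J] by auto
  have "x \<in> open_cone (insert e (I - {e}))" using Suc.prems(3) e(1) by (simp add: insert_absorb)
  then obtain s y where s: "s > 0" "y \<in> open_cone (I - {e})" "x = s *\<^sub>R e + y"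
    using open_cone_insert[of "I - {e}" e x] triang_finite[OF I] by auto
  have "x \<in> open_cone (insert e (J - {e}))" using Suc.prems(4) f(1) ef by (simp add: insert_absorb)
  then obtain t z where t: "t > 0" "z \<in> open_cone (J - {e})" "x = t *\<^sub>R e + z"
    using open_cone_insert[of "J - {e}" e x] triang_finite[OF J] by auto
  \<comment> \<open>The cases \<open>s > t\<close> and \<open>t > s\<close> are symmetric; the
    contradiction is derived once, for a generic simplex \<open>A\<close>.\<close>
  have key: False
    if "A \<in> triang" "e \<in> A" "e \<notin> hull_cone (A - {e})" "z' \<in> open_cone (A - {e})"
      "y' \<in> hull_cone A" "z' = (s' - t') *\<^sub>R e + y'" "s' > t'" for A s' t' :: "_" and z' y'
  proof -
    have A': "A - {e} \<in> triang" using triang_down[OF that(1)] by auto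
    let ?H = "hull_cone (A - {e})" and ?G = "hull_cone A"
    have H: "?H \<in> \<Sigma>" and G: "?G \<in> \<Sigma>" using hull_cone_triang_in that(1) A' by auto
    have "z' \<in> ?H" using open_cone_in[OF H subset_hull_cone that(4)] .
    moreover have "(s' - t') *\<^sub>R e \<in> ?G"
      using that subset_hull_cone[of A] by (intro scale_in[OF G]) auto
    ultimately have "(s' - t') *\<^sub>R e \<in> ?H" using face_split[OF G H] that(5,6) by blast
    then have "(1 / (s' - t')) *\<^sub>R ((s' - t') *\<^sub>R e) \<in> ?H"
      using that(7) by (intro scale_in[OF H, of "(s' - t') *\<^sub>R e"]) auto
    then show False using that by simp
  qed
  have yG: "y \<in> hull_cone I"
    using open_cone_in[OF hull_cone_triang_in[OF I'] subset_hull_cone s(2)]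
      hull_cone_mono[of "I - {e}" I] by auto
  have zG: "z \<in> hull_cone J"
    using open_cone_in[OF hull_cone_triang_in[OF J'] subset_hull_cone t(2)]
      hull_cone_mono[of "J - {e}" J] by auto
  have zy: "z = (s - t) *\<^sub>R e + y" "y = (t - s) *\<^sub>R e + z"
    using s(3) t(3) by (auto simp: algebra_simps)
  have "e \<in> J" "e \<notin> hull_cone (J - {e})" using f ef by auto
  then have "\<not> s > t" using key[OF J _ _ t(2) yG[unfolded eq] zy(1)] by blast
  moreover have "\<not> t > s" using key[OF I e(1,3) s(2) zG[folded eq] zy(2)] by blast
  ultimately have "s = t" by simp
  then have "y = z" using s(3) t(3) by simp
  then have "I - {e} = J - {e}"
    using Suc.hyps(1)[OF _ I' J' s(2)] t(2) Suc.hyps(2) e(1) triang_finite[OF I] by simp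
  then show ?case using e(1) f(1) ef by blast
qed

text \<open>Pull \<open>x\<close> back along the first generator \<open>e\<close> of its smallest
  cone as far as that cone allows. The smallest cone of the endpoint \<open>y\<close> misses
  \<open>e\<close>, so it contains fewer generators, and a simplex for \<open>y\<close> together
  with \<open>e\<close> is one for \<open>x\<close>.\<close>

lemma triang_cover:
  assumes "x \<in> V" shows "\<exists>J\<in>triang. x \<in> open_cone J"
  using assms
proof (induction "card (D \<inter> hull_cone {x})" arbitrary: x rule: less_induct)
  case less
  show ?case
  proof (cases "x = 0")
    case True
    then show ?thesis using zero_cone_in by (intro bexI[of _ "{}"]) (auto simp: triang_def)
  next
    case False
    let ?G = "hull_cone {x}"
    have G: "?G \<in> \<Sigma>" by (rule hull_cone_point_in[OF less.prems])
    have xG: "x \<in> ?G" by (rule in_hull_cone_point)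
    then have ne: "D \<inter> ?G \<noteq> {}" using ray_in[OF G] False by blast
    have fin: "finite (D \<inter> ?G)" using finite_D by simp
    obtain e where e: "e \<in> D" "e \<in> ?G" "\<And>d. d \<in> D \<Longrightarrow> d \<in> ?G \<Longrightarrow> ord e \<le> ord d"
      using ex_has_least_nat[of "\<lambda>e. e \<in> D \<and> e \<in> ?G" _ ord] ne by blast
    have e0: "e \<noteq> 0" using e(1) zero_notin_D by auto
    obtain s where s: "s \<ge> 0" "x - s *\<^sub>R e \<in> ?G" "\<And>t. t > s \<Longrightarrow> x - t *\<^sub>R e \<notin> ?G"
      using pull_back[OF G e(2) e0 xG] by blast
    obtain u where "u > 0" "x - u *\<^sub>R e \<in> ?G" using hull_cone_prolong[OF less.prems e(2)] by blast
    then have spos: "s > 0" using s(3)[of u] by (cases "u > s") auto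
    define y where "y = x - s *\<^sub>R e"
    have yG: "y \<in> ?G" using s(2) by (simp add: y_def)
    have yV: "y \<in> V" using yG cone_subset_V[OF G] by blast
    have sub: "hull_cone {y} \<subseteq> ?G" using yG by (intro hull_cone_subset[OF G]) auto
    have en: "e \<notin> hull_cone {y}"
    proof
      assume "e \<in> hull_cone {y}"
      then obtain c where "c > 0" "y - c *\<^sub>R e \<in> hull_cone {y}" using hull_cone_prolong[OF yV] by blast
      then show False using s(3)[of "s + c"] sub by (auto simp: y_def algebra_simps)
    qed
    have "D \<inter> hull_cone {y} \<subset> D \<inter> ?G" using sub en e by blast
    then obtain I where I: "I \<in> triang" "y \<in> open_cone I"
      using less.hyps[OF psubset_card_mono[OF fin] yV] by blast
    have IH: "I \<subseteq> hull_cone {y}" using hull_cone_open_cone[OF I] subset_hull_cone by simp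
    have eI: "e \<notin> I" using IH en by blast
    have "x = s *\<^sub>R e + y" by (simp add: y_def)
    then have "x \<in> open_cone (insert e I)"
      using open_cone_insert[OF triang_finite[OF I(1)] eI] spos I(2) by blast
    moreover have "insert e I \<in> triang"
    proof -
      have sub': "insert e I \<subseteq> ?G" using IH sub e by auto
      \<comment> \<open>For \<open>j = e\<close> this is the choice of \<open>e\<close>. Any other
        \<open>j\<close> comes after \<open>e\<close>, so the elements from \<open>j\<close> on do
        not include \<open>e\<close>, and the condition is the one for \<open>I\<close>.\<close>
      have "d \<notin> hull_cone {i \<in> insert e I. ord j \<le> ord i}"
        if j: "j \<in> insert e I" "d \<in> D" "ord d < ord j" for d j
      proof (cases "j = e")
        case True
        then have "d \<notin> ?G" using e(3)[OF j(2)] j(3) by auto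
        moreover have "hull_cone {i \<in> insert e I. ord j \<le> ord i} \<subseteq> ?G"
          using sub' by (intro hull_cone_subset[OF G]) auto
        ultimately show ?thesis by blast
      next
        case False
        have jD: "j \<in> D" "j \<in> ?G" using j False triang_sub[OF I(1)] sub' by auto
        have "ord e \<noteq> ord j" using inj_ord jD e(1) False by (auto dest: inj_onD)
        then have "ord e < ord j" using e(3)[OF jD] by simp
        then have "{i \<in> insert e I. ord j \<le> ord i} = {i \<in> I. ord j \<le> ord i}" by auto
        then show ?thesis using I(1) j False unfolding triang_def by auto
      qed
      then show ?thesis using triang_sub[OF I(1)] e(1) sub' G unfolding triang_def by blast
    qed
    ultimately show ?thesis by blast
  qed
qed

end

section \<open>Values of rational functions\<close>

lemma laurent_eval_superset:
  assumes "finite T" "Poly_Mapping.keys P \<subseteq> T"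
  shows "laurent_eval g P = (\<Sum>k\<in>T. Poly_Mapping.lookup P k * g k)"
  unfolding laurent_eval_def
  by (rule sum.mono_neutral_left) (use assms in \<open>auto simp: in_keys_iff\<close>)

lemma laurent_eval_single [simp]: "laurent_eval g (Poly_Mapping.single k a) = a * g k"
  by (subst laurent_eval_superset[of "{k}"]) (auto simp: lookup_single)

lemma laurent_eval_one [simp]: "laurent_eval g 1 = g 0"
  using laurent_eval_single[of g 0 1] by simp

lemma laurent_eval_add [simp]: "laurent_eval g (P + Q) = laurent_eval g P + laurent_eval g Q"
proof -
  let ?T = "Poly_Mapping.keys P \<union> Poly_Mapping.keys Q"
  have "laurent_eval g R = (\<Sum>k\<in>?T. Poly_Mapping.lookup R k * g k)" if "R \<in> {P, Q, P + Q}" for R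
    using that keys_add[of P Q] by (intro laurent_eval_superset) auto
  then show ?thesis by (simp add: lookup_add distrib_right sum.distrib)
qed

lemma poly_mapping_add_induct [case_names single sum]:
  fixes p :: "'a \<Rightarrow>\<^sub>0 'b::comm_monoid_add"
  assumes "\<And>k a. P (Poly_Mapping.single k a)" "\<And>p q. P p \<Longrightarrow> P q \<Longrightarrow> P (p + q)"
  shows "P p"
proof (induction p rule: update_induct)
  case const
  show ?case using assms(1)[of undefined 0] by simp
next
  case (update f a b)
  have "Poly_Mapping.update a b f = Poly_Mapping.single a b + f"
    using update(1)
    by (intro poly_mapping_eqI) (auto simp: lookup_update lookup_add lookup_single in_keys_iff when_def)
  then show ?case using assms(1)[of a b] assms(2) update by simp
qed

text \<open>Stated for arbitrary \<open>g\<close> to serve twice: for multiplicative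
  \<open>g\<close> it is evaluation of a product at a torus point, and for
  \<open>g = (\<lambda>k. S (n - k))\<close> it is associativity of the action of Laurent
  polynomials on series.\<close>

lemma laurent_eval_times:
  "laurent_eval g (P * Q) = laurent_eval (\<lambda>k. laurent_eval (\<lambda>l. g (k + l)) Q) P"
proof (induction P rule: poly_mapping_add_induct)
  case (single k a)
  show ?case
  proof (induction Q rule: poly_mapping_add_induct)
    case (single l b)
    then show ?case by (simp add: mult_single)
  next
    case (sum Q1 Q2)
    then show ?case by (simp add: distrib_left)
  qed
next
  case (sum P1 P2)
  then show ?case by (simp add: distrib_right)
qed

lemma laurent_eval_sum_arg: "laurent_eval (\<lambda>k. f k + g k) P = laurent_eval f P + laurent_eval g P"
  by (simp add: laurent_eval_def distrib_left sum.distrib)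

lemma laurent_eval_cmult_arg: "laurent_eval (\<lambda>k. c * g k) P = c * laurent_eval g P"
  by (simp add: laurent_eval_def sum_distrib_left mult_ac)

lemma laurent_eval_cong:
  "(\<And>k. k \<in> Poly_Mapping.keys P \<Longrightarrow> f k = g k) \<Longrightarrow> laurent_eval f P = laurent_eval g P"
  by (simp add: laurent_eval_def)

lemma laurent_mult_eq_eval: "laurent_mult Q S n = laurent_eval (\<lambda>k. S (n - k)) Q"
  by (simp add: laurent_mult_def laurent_eval_def)

lemma laurent_mult_times: "laurent_mult (P * Q) S = laurent_mult P (laurent_mult Q S)"
  by (simp add: fun_eq_iff laurent_mult_eq_eval laurent_eval_times diff_diff_eq)

lemma laurent_mult_add_arg:
  "laurent_mult Q (\<lambda>n. S n + S' n) = (\<lambda>n. laurent_mult Q S n + laurent_mult Q S' n)"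
  by (simp add: fun_eq_iff laurent_mult_eq_eval laurent_eval_sum_arg)

lemma laurent_mult_lookup:
  "laurent_mult Q (Poly_Mapping.lookup P) = Poly_Mapping.lookup (Q * P)"
proof (induction Q rule: poly_mapping_add_induct)
  case (single k a)
  have "(\<lambda>n. a * Poly_Mapping.lookup P (n - k)) = Poly_Mapping.lookup (Poly_Mapping.single k a * P)"
  proof (induction P rule: poly_mapping_add_induct)
    case (single l b)
    have "l = n - k \<longleftrightarrow> k + l = n" for n by (auto simp: algebra_simps)
    then show ?case by (simp add: mult_single lookup_single fun_eq_iff when_def)
  next
    case (sum P1 P2)
    then show ?case by (simp add: fun_eq_iff distrib_left lookup_add)
  qed
  then show ?case by (simp add: fun_eq_iff laurent_mult_eq_eval)
next
  case (sum Q1 Q2)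
  then show ?case by (simp add: fun_eq_iff laurent_mult_eq_eval distrib_right lookup_add)
qed

section \<open>Values of rational series at a torus point\<close>

locale torus_point =
  fixes N :: "'v::euclidean_space set" and \<xi> :: "'v \<Rightarrow> complex"
  assumes N_add: "x \<in> N \<Longrightarrow> y \<in> N \<Longrightarrow> x + y \<in> N" and N_zero: "0 \<in> N"
    and \<xi>_add: "x \<in> N \<Longrightarrow> y \<in> N \<Longrightarrow> \<xi> (x + y) = \<xi> x * \<xi> y" and \<xi>_zero: "\<xi> 0 = 1"
begin

lemma keys_times:
  "Poly_Mapping.keys P \<subseteq> N \<Longrightarrow> Poly_Mapping.keys Q \<subseteq> N \<Longrightarrow> Poly_Mapping.keys (P * Q) \<subseteq> N"
  using keys_mult[of P Q] N_add by blast

lemma keys_plus: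
  "Poly_Mapping.keys P \<subseteq> N \<Longrightarrow> Poly_Mapping.keys Q \<subseteq> N \<Longrightarrow> Poly_Mapping.keys (P + Q) \<subseteq> N"
  using keys_add[of P Q] by blast

lemma eval_times:
  assumes "Poly_Mapping.keys P \<subseteq> N" "Poly_Mapping.keys Q \<subseteq> N"
  shows "laurent_eval \<xi> (P * Q) = laurent_eval \<xi> P * laurent_eval \<xi> Q"
proof -
  have "laurent_eval (\<lambda>l. \<xi> (k + l)) Q = laurent_eval \<xi> Q * \<xi> k" if "k \<in> Poly_Mapping.keys P" for k
  proof -
    have "laurent_eval (\<lambda>l. \<xi> (k + l)) Q = laurent_eval (\<lambda>l. \<xi> k * \<xi> l) Q"
      using that assms \<xi>_add by (intro laurent_eval_cong) blast
    then show ?thesis by (simp add: laurent_eval_cmult_arg)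
  qed
  then have "laurent_eval \<xi> (P * Q) = laurent_eval (\<lambda>k. laurent_eval \<xi> Q * \<xi> k) P"
    unfolding laurent_eval_times by (intro laurent_eval_cong)
  then show ?thesis by (simp add: laurent_eval_cmult_arg)
qed

lemma rational_value_point:
  assumes "n \<in> N"
  shows "is_rational_value N (\<lambda>x. if x = n then a else 0) \<xi> (a * \<xi> n)"
  unfolding is_rational_value_def
proof (intro exI conjI)
  show "Poly_Mapping.keys (Poly_Mapping.single n a) \<subseteq> N" using assms by simp
  show "Poly_Mapping.keys (1 :: 'v \<Rightarrow>\<^sub>0 complex) \<subseteq> N" using N_zero by simp
  show "laurent_mult 1 (\<lambda>x. if x = n then a else 0) = Poly_Mapping.lookup (Poly_Mapping.single n a)"
    by (auto simp: fun_eq_iff laurent_mult_eq_eval lookup_single when_def)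
qed (simp_all add: \<xi>_zero)

lemma rational_value_add:
  assumes "is_rational_value N S \<xi> v" "is_rational_value N S' \<xi> v'"
  shows "is_rational_value N (\<lambda>n. S n + S' n) \<xi> (v + v')"
proof -
  obtain P Q where 1: "Poly_Mapping.keys P \<subseteq> N" "Poly_Mapping.keys Q \<subseteq> N"
    "laurent_mult Q S = Poly_Mapping.lookup P" "laurent_eval \<xi> Q \<noteq> 0"
    "v = laurent_eval \<xi> P / laurent_eval \<xi> Q"
    using assms(1) unfolding is_rational_value_def by blast
  obtain P' Q' where 2: "Poly_Mapping.keys P' \<subseteq> N" "Poly_Mapping.keys Q' \<subseteq> N"
    "laurent_mult Q' S' = Poly_Mapping.lookup P'" "laurent_eval \<xi> Q' \<noteq> 0"
    "v' = laurent_eval \<xi> P' / laurent_eval \<xi> Q'"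
    using assms(2) unfolding is_rational_value_def by blast
  have "laurent_mult (Q * Q') S = laurent_mult Q' (Poly_Mapping.lookup P)"
    using laurent_mult_times[of Q' Q S] 1(3) by (simp add: mult.commute)
  moreover have "laurent_mult (Q * Q') S' = laurent_mult Q (Poly_Mapping.lookup P')"
    using laurent_mult_times[of Q Q' S'] 2(3) by simp
  ultimately have "laurent_mult (Q * Q') (\<lambda>n. S n + S' n) = Poly_Mapping.lookup (Q' * P + Q * P')"
    by (simp add: laurent_mult_add_arg laurent_mult_lookup fun_eq_iff lookup_add)
  then show ?thesis unfolding is_rational_value_def using 1 2
    by (intro exI[of _ "Q' * P + Q * P'"] exI[of _ "Q * Q'"])
      (simp add: keys_times keys_plus eval_times add_frac_eq mult_ac)
qed

lemma rational_value_zero: "is_rational_value N (\<lambda>_. 0) \<xi> 0"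
  using rational_value_point[OF N_zero, of 0] by (simp cong: if_cong)

lemma rational_value_sum:
  assumes "\<And>i. i \<in> I \<Longrightarrow> is_rational_value N (S i) \<xi> (v i)"
  shows "is_rational_value N (\<lambda>n. \<Sum>i\<in>I. S i n) \<xi> (\<Sum>i\<in>I. v i)"
  using assms
  by (induction I rule: infinite_finite_induct) (auto intro: rational_value_add rational_value_zero)

text \<open>If \<open>Q\<close> is a denominator for the difference series, then \<open>Q\<close>
  times \<open>1 - c x^d\<close> is one for \<open>S\<close>: the summation of a geometric
  progression in the direction \<open>d\<close>.\<close>

lemma rational_value_geometric:
  assumes "is_rational_value N (\<lambda>n. S n - c * S (n - d)) \<xi> v" "d \<in> N" "1 - c * \<xi> d \<noteq> 0"
  shows "is_rational_value N S \<xi> (v / (1 - c * \<xi> d))"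
proof -
  obtain P Q where 1: "Poly_Mapping.keys P \<subseteq> N" "Poly_Mapping.keys Q \<subseteq> N"
    "laurent_mult Q (\<lambda>n. S n - c * S (n - d)) = Poly_Mapping.lookup P" "laurent_eval \<xi> Q \<noteq> 0"
    "v = laurent_eval \<xi> P / laurent_eval \<xi> Q"
    using assms(1) unfolding is_rational_value_def by blast
  define R where "R = 1 + Poly_Mapping.single d (- c)"
  have kR: "Poly_Mapping.keys R \<subseteq> N"
    unfolding R_def using assms(2) N_zero by (intro keys_plus) auto
  have eR: "laurent_eval \<xi> R = 1 - c * \<xi> d" by (simp add: R_def \<xi>_zero)
  have "laurent_mult R S = (\<lambda>n. S n - c * S (n - d))"
    by (simp add: fun_eq_iff laurent_mult_eq_eval R_def)
  then have "laurent_mult (Q * R) S = Poly_Mapping.lookup P"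
    using laurent_mult_times[of Q R S] 1(3) by simp
  then show ?thesis unfolding is_rational_value_def using 1 kR eR assms(3)
    by (intro exI[of _ P] exI[of _ "Q * R"]) (simp add: keys_times eval_times)
qed

end

section \<open>Series supported on translates of free monoids\<close>

definition nat_cone :: "'v::real_vector set \<Rightarrow> 'v set" where
  "nat_cone J = {(\<Sum>j\<in>J. of_nat (k j) *\<^sub>R j) | k. True}"

lemma nat_cone_empty [simp]: "nat_cone {} = {0}"
  by (simp add: nat_cone_def)

lemma nat_cone_span: "nat_cone J \<subseteq> span J"
  by (auto simp: nat_cone_def intro: span_sum span_scale span_base)

lemma nat_cone_insert:
  assumes "finite J" "d \<notin> J"
  shows "x \<in> nat_cone (insert d J) \<longleftrightarrow> (\<exists>k y. y \<in> nat_cone J \<and> x = of_nat k *\<^sub>R d + y)"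
proof
  assume "x \<in> nat_cone (insert d J)"
  then obtain k where "x = (\<Sum>j\<in>insert d J. of_nat (k j) *\<^sub>R j)" unfolding nat_cone_def by blast
  then have "x = of_nat (k d) *\<^sub>R d + (\<Sum>j\<in>J. of_nat (k j) *\<^sub>R j)" using assms by simp
  then show "\<exists>k y. y \<in> nat_cone J \<and> x = of_nat k *\<^sub>R d + y" unfolding nat_cone_def by blast
next
  assume "\<exists>k y. y \<in> nat_cone J \<and> x = of_nat k *\<^sub>R d + y"
  then obtain k l where x: "x = of_nat k *\<^sub>R d + (\<Sum>j\<in>J. of_nat (l j) *\<^sub>R j)"
    unfolding nat_cone_def by blast
  have "(\<Sum>j\<in>J. of_nat (l j) *\<^sub>R j) = (\<Sum>j\<in>J. of_nat ((l(d := k)) j) *\<^sub>R j)"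
    using assms by (intro sum.cong) auto
  then have "x = (\<Sum>j\<in>insert d J. of_nat ((l(d := k)) j) *\<^sub>R j)" using assms x by simp
  then show "x \<in> nat_cone (insert d J)" unfolding nat_cone_def by blast
qed

text \<open>Subtracting from the series \<open>c d\<close> times its shift by \<open>d\<close>
  leaves the terms with coefficient 0 at \<open>d\<close>, which is the series for the remaining
  generators. Multiplicativity of \<open>w\<close> is asked along the translated monoid only,
  because the character of \<open>deg\<close> is multiplicative on each cone separately and not on
  all of \<open>N\<close>.\<close>

lemma (in torus_point) rational_value_nat_cone:
  assumes "finite J" "independent J" "J \<subseteq> N" "v \<in> N"
    and "\<And>x j. x \<in> nat_cone J \<Longrightarrow> j \<in> J \<Longrightarrow> w (v + x + j) = w (v + x) * c j"
    and "\<And>j. j \<in> J \<Longrightarrow> 1 - c j * \<xi> j \<noteq> 0"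
  shows "is_rational_value N (\<lambda>n. if n - v \<in> nat_cone J then w n else 0) \<xi>
           (w v * \<xi> v / (\<Prod>j\<in>J. 1 - c j * \<xi> j))"
  using assms(1-3,5-)
proof (induction J rule: finite_induct)
  case empty
  show ?case using rational_value_point[OF assms(4), of "w v"]
    by (simp cong: if_cong)
next
  case (insert d J)
  define S where "S = (\<lambda>n. if n - v \<in> nat_cone (insert d J) then w n else 0)"
  have sub: "nat_cone J \<subseteq> nat_cone (insert d J)"
    using nat_cone_insert[OF insert.hyps(1,2)] by (metis of_nat_0 add_0 scaleR_zero_left subsetI)
  have IH: "is_rational_value N (\<lambda>n. if n - v \<in> nat_cone J then w n else 0) \<xi>
           (w v * \<xi> v / (\<Prod>j\<in>J. 1 - c j * \<xi> j))"
  proof (rule insert.IH)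
    show "independent J" using insert.prems(1) by (rule independent_mono) auto
  qed (use insert.prems sub in auto)
  have "d \<notin> span J" using insert.prems(1) insert.hyps(2) by (simp add: independent_insert)
  have "(\<lambda>n. if n - v \<in> nat_cone J then w n else 0) = (\<lambda>n. S n - c d * S (n - d))"
  proof
    fix n
    have shift: "w n = w (n - d) * c d" if "n - d - v \<in> nat_cone (insert d J)"
      using insert.prems(3)[OF that, of d] by (simp add: algebra_simps)
    have step: "n - v \<in> nat_cone (insert d J)" if nd: "n - d - v \<in> nat_cone (insert d J)"
    proof -
      obtain k y where "y \<in> nat_cone J" "n - d - v = of_nat k *\<^sub>R d + y"
        using nd nat_cone_insert[OF insert.hyps(1,2)] by blast
      then have "n - v = of_nat (Suc k) *\<^sub>R d + y" by (simp add: algebra_simps)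
      then show ?thesis using \<open>y \<in> nat_cone J\<close> nat_cone_insert[OF insert.hyps(1,2)] by blast
    qed
    \<comment> \<open>Independence makes the coefficient of \<open>d\<close> well defined: shifting
      back by \<open>d\<close> stays in the monoid exactly when this coefficient is positive, that
      is, when \<open>n - v\<close> is not in \<open>nat_cone J\<close>.\<close>
    have shift_back: "n - d - v \<in> nat_cone (insert d J) \<longleftrightarrow> n - v \<notin> nat_cone J"
      if nd: "n - v \<in> nat_cone (insert d J)"
    proof
      assume "n - d - v \<in> nat_cone (insert d J)"
      then obtain k y where ky: "y \<in> nat_cone J" "n - d - v = of_nat k *\<^sub>R d + y"
        using nat_cone_insert[OF insert.hyps(1,2)] by blast
      show "n - v \<notin> nat_cone J"
      proof
        assume "n - v \<in> nat_cone J"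
        then have "n - v - y \<in> span J" using ky(1) nat_cone_span[of J] by (blast intro: span_diff)
        moreover have "n - v - y = of_nat (Suc k) *\<^sub>R d" using ky(2) by (simp add: algebra_simps)
        ultimately have "of_nat (Suc k) *\<^sub>R d \<in> span J" by simp
        then have "(1 / of_nat (Suc k)) *\<^sub>R (of_nat (Suc k) *\<^sub>R d) \<in> span J" by (rule span_scale)
        then show False using \<open>d \<notin> span J\<close> by (simp del: of_nat_Suc)
      qed
    next
      assume n: "n - v \<notin> nat_cone J"
      obtain k y where ky: "y \<in> nat_cone J" "n - v = of_nat k *\<^sub>R d + y"
        using nd nat_cone_insert[OF insert.hyps(1,2)] by blast
      then obtain k' where "k = Suc k'" using n by (cases k) auto
      then have "n - d - v = of_nat k' *\<^sub>R d + y" using ky(2) by (simp add: algebra_simps)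
      then show "n - d - v \<in> nat_cone (insert d J)"
        using ky(1) nat_cone_insert[OF insert.hyps(1,2)] by blast
    qed
    show "(if n - v \<in> nat_cone J then w n else 0) = S n - c d * S (n - d)"
      unfolding S_def using shift step shift_back sub by (auto simp: mult.commute)
  qed
  then have "is_rational_value N S \<xi>
      (w v * \<xi> v / (\<Prod>j\<in>J. 1 - c j * \<xi> j) / (1 - c d * \<xi> d))"
    using IH insert.prems by (intro rational_value_geometric) auto
  then show ?case using insert.hyps by (simp add: S_def mult.commute)
qed

section \<open>Lattices\<close>

lemma summable_on_power_abs_int:
  fixes p :: real
  assumes "0 \<le> p" "p < 1"
  shows "(\<lambda>k::int. p ^ nat \<bar>k\<bar>) summable_on UNIV"
proof -
  have s: "(\<lambda>k. p ^ k) summable_on (UNIV :: nat set)"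
    using assms by (intro norm_summable_imp_summable_on) (simp add: summable_geometric)
  have "((\<lambda>k::int. p ^ nat \<bar>k\<bar>) \<circ> int) summable_on UNIV"
    using s by (simp add: o_def)
  then have 1: "(\<lambda>k::int. p ^ nat \<bar>k\<bar>) summable_on range int"
    by (subst summable_on_reindex) auto
  have "((\<lambda>k::int. p ^ nat \<bar>k\<bar>) \<circ> (\<lambda>n. - int n)) summable_on UNIV"
    using s by (simp add: o_def)
  then have 2: "(\<lambda>k::int. p ^ nat \<bar>k\<bar>) summable_on range (\<lambda>n. - int n)"
    by (subst summable_on_reindex) (auto simp: inj_on_def)
  have "(UNIV :: int set) = range int \<union> range (\<lambda>n. - int n)"
    using int_cases2 by blast
  then show ?thesis using summable_on_union[OF 1 2] by simp
qed

locale lattice =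
  fixes N :: "'v::euclidean_space set" and r :: nat and B :: "'v set"
  assumes fin_B: "finite B" and ind_B: "independent B" and card_B: "card B = r"
    and N_eq: "N = {(\<Sum>b\<in>B. of_int (c b) *\<^sub>R b) | c. True}"
begin

lemma N_I: "(\<Sum>b\<in>B. of_int (c b) *\<^sub>R b) \<in> N"
  unfolding N_eq by blast

lemma N_D: "x \<in> N \<Longrightarrow> \<exists>c. x = (\<Sum>b\<in>B. of_int (c b) *\<^sub>R b)"
  unfolding N_eq by blast

lemma zero_in_N: "0 \<in> N"
  using N_I[of "\<lambda>_. 0"] by simp

lemma add_in_N: assumes "x \<in> N" "y \<in> N" shows "x + y \<in> N"
proof -
  from assms obtain c d where "x = (\<Sum>b\<in>B. of_int (c b) *\<^sub>R b)" "y = (\<Sum>b\<in>B. of_int (d b) *\<^sub>R b)"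
    using N_D by metis
  then show ?thesis using N_I[of "\<lambda>b. c b + d b"] by (simp add: scaleR_left_distrib sum.distrib)
qed

lemma scale_in_N: assumes "x \<in> N" shows "of_int k *\<^sub>R x \<in> N"
proof -
  from assms obtain c where "x = (\<Sum>b\<in>B. of_int (c b) *\<^sub>R b)" using N_D by metis
  then show ?thesis using N_I[of "\<lambda>b. k * c b"] by (simp add: scaleR_sum_right)
qed

lemma diff_in_N: "x \<in> N \<Longrightarrow> y \<in> N \<Longrightarrow> x - y \<in> N"
  using add_in_N[of x "- y"] scale_in_N[of y "-1"] by simp

lemma sum_in_N: "(\<And>j. j \<in> J \<Longrightarrow> f j \<in> N) \<Longrightarrow> sum f J \<in> N"
  by (induction J rule: infinite_finite_induct) (auto intro: add_in_N zero_in_N)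

lemma B_sub: "B \<subseteq> N"
proof
  fix b assume b: "b \<in> B"
  have "(\<Sum>a\<in>B. of_int (if a = b then 1 else 0) *\<^sub>R a) = b"
    using b fin_B by (simp add: if_distrib[of of_int] if_distrib[of "\<lambda>x. x *\<^sub>R _"] cong: if_cong)
  then show "b \<in> N" using N_I[of "\<lambda>a. if a = b then 1 else 0"] by simp
qed

lemma span_N: "span N = span B"
proof
  have "N \<subseteq> span B" unfolding N_eq by (auto intro: span_sum span_scale span_base)
  then show "span N \<subseteq> span B" by (simp add: span_minimal)
  show "span B \<subseteq> span N" by (rule span_mono[OF B_sub])
qed

lemma dim_span_N: "dim (span N) = r"
  unfolding span_N using dim_span_eq_card_independent[OF ind_B] card_B by simp

lemma span_combination: "x \<in> span N \<Longrightarrow> \<exists>c. x = (\<Sum>b\<in>B. c b *\<^sub>R b)"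
  unfolding span_N span_finite[OF fin_B] by auto

text \<open>Each coordinate with respect to \<open>B\<close> extends to a linear functional, which
  is bounded. The summand 1 in the constant keeps it positive when \<open>B\<close> is
  empty.\<close>

lemma coordinate_bound: "\<exists>K>0. \<forall>c. \<forall>b\<in>B. \<bar>c b\<bar> \<le> K * norm (\<Sum>b\<in>B. c b *\<^sub>R b)"
proof -
  have "\<exists>K. \<forall>c. \<bar>c b\<bar> \<le> K * norm (\<Sum>b\<in>B. c b *\<^sub>R b)" if b: "b \<in> B" for b
  proof -
    obtain g :: "'v \<Rightarrow> real" where g: "linear g" "\<And>a. a \<in> B \<Longrightarrow> g a = (if a = b then 1 else 0)"
      using linear_independent_extend[OF ind_B, of "\<lambda>a. if a = b then 1 else 0"] by blast
    obtain K where K: "\<And>x. norm (g x) \<le> norm x * K"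
      using bounded_linear.bounded[OF linear_conv_bounded_linear[THEN iffD1, OF g(1)]] by blast
    have "g (\<Sum>b\<in>B. c b *\<^sub>R b) = c b" for c
    proof -
      have "g (\<Sum>b\<in>B. c b *\<^sub>R b) = (\<Sum>a\<in>B. c a * g a)"
        by (simp add: linear_sum[OF g(1)] linear_scale[OF g(1)])
      also have "\<dots> = (\<Sum>a\<in>B. if a = b then c a else 0)" by (intro sum.cong) (simp_all add: g(2))
      finally show ?thesis using b fin_B by simp
    qed
    then show ?thesis using K by (metis mult.commute real_norm_def)
  qed
  then obtain K where K: "\<And>b c. b \<in> B \<Longrightarrow> \<bar>c b\<bar> \<le> K b * norm (\<Sum>b\<in>B. c b *\<^sub>R b)" by metis
  have "\<bar>c b\<bar> \<le> (1 + (\<Sum>b\<in>B. \<bar>K b\<bar>)) * norm (\<Sum>b\<in>B. c b *\<^sub>R b)" if "b \<in> B" for b c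
  proof -
    have "K b \<le> \<bar>K b\<bar>" by simp
    also have "\<dots> \<le> (\<Sum>b\<in>B. \<bar>K b\<bar>)" by (rule member_le_sum) (use that fin_B in auto)
    finally show ?thesis by (intro order_trans[OF K[OF that]] mult_right_mono) auto
  qed
  then show ?thesis by (intro exI[of _ "1 + (\<Sum>b\<in>B. \<bar>K b\<bar>)"]) (simp add: add_pos_nonneg sum_nonneg)
qed

lemma finite_N_ball: "finite {n \<in> N. norm n \<le> R}"
proof -
  obtain K where K: "K > 0" "\<And>c b. b \<in> B \<Longrightarrow> \<bar>c b\<bar> \<le> K * norm (\<Sum>b\<in>B. c b *\<^sub>R b)"
    using coordinate_bound by blast
  let ?F = "PiE B (\<lambda>_. {- \<lceil>K * R\<rceil>..\<lceil>K * R\<rceil>})"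
  have "{n \<in> N. norm n \<le> R} \<subseteq> (\<lambda>c. \<Sum>b\<in>B. of_int (c b) *\<^sub>R b) ` ?F"
  proof
    fix n assume "n \<in> {n \<in> N. norm n \<le> R}"
    then obtain c where c: "n = (\<Sum>b\<in>B. of_int (c b) *\<^sub>R b)" "norm n \<le> R" using N_D by auto
    have "\<bar>c b\<bar> \<le> \<lceil>K * R\<rceil>" if "b \<in> B" for b
    proof -
      have "\<bar>real_of_int (c b)\<bar> \<le> K * norm n" using K(2)[of b "\<lambda>b. real_of_int (c b)"] that c(1) by simp
      also have "\<dots> \<le> K * R" using c(2) K(1) by simp
      finally show ?thesis by linarith
    qed
    then have "restrict c B \<in> ?F" by (auto simp: abs_le_iff minus_le_iff)
    moreover have "n = (\<Sum>b\<in>B. of_int (restrict c B b) *\<^sub>R b)" using c(1) by simp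
    ultimately show "n \<in> (\<lambda>c. \<Sum>b\<in>B. of_int (c b) *\<^sub>R b) ` ?F" by blast
  qed
  moreover have "finite ?F" using fin_B by (intro finite_PiE) auto
  ultimately show ?thesis using finite_subset by blast
qed

text \<open>Dirichlet's theorem brings all coordinates of a multiple of \<open>x\<close> within
  \<open>1 / M\<close> of integers at once, so the error in norm is at most \<open>s / M\<close>.
  The 1 in the choice of \<open>M\<close> makes \<open>M\<close> positive also for
  \<open>s = 0\<close>.\<close>

lemma approximate_by_N:
  assumes x: "x \<in> span N" and e: "\<epsilon> > 0"
  obtains k n where "k \<ge> (1::int)" "n \<in> N" "norm (of_int k *\<^sub>R x - n) < \<epsilon>"
proof -
  obtain c where c: "x = (\<Sum>b\<in>B. c b *\<^sub>R b)" using span_combination[OF x] by blast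
  obtain f where f: "bij_betw f {0..<card B} B" using ex_bij_betw_nat_finite[OF fin_B] by blast
  define s where "s = (\<Sum>b\<in>B. norm b)"
  have s: "s \<ge> 0" by (simp add: s_def sum_nonneg)
  obtain M :: nat where M: "(s + 1) / \<epsilon> < real M" using reals_Archimedean2 by blast
  have Mpos: "M > 0" using M s e by (cases M) (auto simp: divide_less_0_iff)
  obtain q p where qp: "0 < q" "\<And>i. i < card B \<Longrightarrow> \<bar>of_int q * c (f i) - of_int (p i)\<bar> < 1 / M"
    using Dirichlet_approx_simult[OF Mpos, of "card B" "\<lambda>i. c (f i)"] by metis
  define g where "g = (\<lambda>b. p (the_inv_into {0..<card B} f b))"
  have g: "\<bar>of_int q * c b - of_int (g b)\<bar> < 1 / M" if b: "b \<in> B" for b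
  proof -
    obtain i where i: "i < card B" "f i = b" using f b unfolding bij_betw_def by force
    then have "the_inv_into {0..<card B} f b = i"
      using f unfolding bij_betw_def by (auto intro: the_inv_into_f_eq)
    then show ?thesis using qp(2)[OF i(1)] i(2) by (simp add: g_def)
  qed
  have "norm (of_int q *\<^sub>R x - (\<Sum>b\<in>B. of_int (g b) *\<^sub>R b))
        = norm (\<Sum>b\<in>B. (of_int q * c b - of_int (g b)) *\<^sub>R b)"
    by (simp add: c scaleR_sum_right scaleR_diff_left sum_subtractf)
  also have "\<dots> \<le> (\<Sum>b\<in>B. (1 / M) * norm b)"
  proof (rule sum_norm_le)
    fix b assume "b \<in> B"
    then show "norm ((of_int q * c b - of_int (g b)) *\<^sub>R b) \<le> (1 / M) * norm b"
      unfolding norm_scaleR real_norm_def using g by (intro mult_right_mono less_imp_le norm_ge_zero)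
  qed
  also have "\<dots> = s / M" by (simp add: s_def flip: sum_distrib_left sum_divide_distrib)
  also have "\<dots> < \<epsilon>" using M Mpos e s by (simp add: field_simps)
  finally show ?thesis using that[of q "\<Sum>b\<in>B. of_int (g b) *\<^sub>R b"] N_I qp(1) by auto
qed

text \<open>Simultaneous Diophantine approximation makes a rational ray contain a lattice point: a
  lattice point very close to a multiple of a generator satisfies the same integral equations.\<close>

lemma ray_has_primitive:
  assumes C: "rational_polyhedral_cone N C" and dim: "dim C = 1"
  obtains d where "d \<in> C" "primitive_in N d"
proof -
  obtain S where S: "finite S" "S \<subseteq> dual_lattice N" "C = {x \<in> span N. \<forall>m\<in>S. 0 \<le> m \<bullet> x}"
    using C unfolding rational_polyhedral_cone_def by blast
  have "\<not> C \<subseteq> {0}" using dim by (metis dim_eq_0 zero_neq_one)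
  then obtain x where x: "x \<in> C" "x \<noteq> 0" by blast
  \<comment> \<open>As \<open>K\<close> exceeds every \<open>norm m\<close>, an approximation error
    below \<open>1 / K\<close> changes each pairing by less than 1, and an integer above -1 is
    nonnegative. The second bound on the error, \<open>norm x\<close>, excludes
    \<open>n = 0\<close>.\<close>
  define K where "K = 1 + (\<Sum>m\<in>S. norm m)"
  have K: "K \<ge> 1" "\<And>m. m \<in> S \<Longrightarrow> norm m < K"
  proof -
    show "K \<ge> 1" by (simp add: K_def sum_nonneg)
    show "norm m < K" if "m \<in> S" for m
      using member_le_sum[of m S norm] that S(1) by (simp add: K_def)
  qed
  obtain k n where kn: "k \<ge> (1::int)" "n \<in> N" "norm (of_int k *\<^sub>R x - n) < min (1 / K) (norm x)"
    using approximate_by_N[of x "min (1 / K) (norm x)"] x S(3) K(1) by auto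
  have "n \<noteq> 0"
  proof
    assume "n = 0"
    then have "real_of_int k * norm x < norm x" using kn by simp
    then show False using kn(1) x(2) by simp
  qed
  have "0 \<le> m \<bullet> n" if m: "m \<in> S" for m
  proof -
    have mi: "m \<bullet> n \<in> \<int>" using S(2) m kn(2) by (auto simp: dual_lattice_def)
    have "m \<bullet> (of_int k *\<^sub>R x - n) \<le> norm m * norm (of_int k *\<^sub>R x - n)" by (rule norm_cauchy_schwarz)
    also have "\<dots> \<le> norm m * (1 / K)" using kn(3) by (intro mult_left_mono) auto
    also have "\<dots> < 1" using K(1) K(2)[OF m] by simp
    finally have "of_int k * (m \<bullet> x) - m \<bullet> n < 1" by (simp add: inner_diff_right)
    moreover have "of_int k * (m \<bullet> x) \<ge> 0" using x S(3) m kn(1) by simp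
    ultimately have "m \<bullet> n > - 1" by linarith
    then show ?thesis using mi by (auto elim!: Ints_cases)
  qed
  then have nC: "n \<in> C" using S(3) kn(2) by (auto intro: span_base)
  let ?F = "{v \<in> N. norm v \<le> norm n} \<inter> C - {0}"
  have fin: "finite ?F" using finite_N_ball[of "norm n"] by simp
  have "n \<in> ?F" using kn(2) nC \<open>n \<noteq> 0\<close> by simp
  then have ne: "?F \<noteq> {}" by blast
  \<comment> \<open>A shortest nonzero lattice vector of the cone is primitive: if it were a
    multiple of \<open>v\<close> by some \<open>k > 1\<close>, then \<open>v\<close> would be
    shorter and still in the cone.\<close>
  define d where "d = arg_min_on norm ?F"
  have d: "d \<in> ?F" "\<And>v. v \<in> ?F \<Longrightarrow> norm d \<le> norm v"
    unfolding d_def by (rule arg_min_if_finite(1)[OF fin ne], rule arg_min_least[OF fin ne])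
  have "primitive_in N d"
    unfolding primitive_in_def
  proof (intro conjI ballI allI impI)
    fix v and k :: nat assume v: "v \<in> N" "d = of_nat k *\<^sub>R v"
    have k: "k > 0" "v \<noteq> 0" using v(2) d(1) by (auto intro!: gr0I)
    have "m \<bullet> v \<ge> 0" if "m \<in> S" for m
    proof -
      have "real k * (m \<bullet> v) \<ge> 0" using d(1) S(3) that v(2) by auto
      then show ?thesis using k by (simp add: zero_le_mult_iff)
    qed
    then have "v \<in> C" using S(3) v(1) by (auto intro: span_base)
    have nd: "norm d = real k * norm v" using v(2) by simp
    have "norm v \<le> norm d" unfolding nd using k by (simp add: mult_le_cancel_right1)
    then have "v \<in> ?F" using v(1) \<open>v \<in> C\<close> k d(1) by auto
    then have "real k * norm v \<le> norm v" using d(2) nd by metis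
    then show "k = 1" using k by (simp add: mult_le_cancel_right1)
  qed (use d in simp)
  then show ?thesis using that d(1) by blast
qed

lemma dual_integral: "m \<in> dual_lattice N \<Longrightarrow> n \<in> N \<Longrightarrow> m \<bullet> n \<in> \<int>"
  by (auto simp: dual_lattice_def)

lemma dual_eqI:
  assumes "m \<in> dual_lattice N" "m' \<in> dual_lattice N" "\<And>b. b \<in> B \<Longrightarrow> m \<bullet> b = m' \<bullet> b"
  shows "m = m'"
proof -
  have "m - m' \<in> span B" using assms(1,2) unfolding dual_lattice_def span_N by (auto intro: span_diff)
  moreover have "orthogonal (m - m') x" if "x \<in> span B" for x
    using orthogonal_to_span[OF that, of "m - m'"] assms(3) by (simp add: orthogonal_def inner_diff_left)
  ultimately have "orthogonal (m - m') (m - m')" by blast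
  then show ?thesis by (simp add: orthogonal_self)
qed

text \<open>The pairings with \<open>B\<close> embed the dual lattice into the integer vectors
  indexed by \<open>B\<close>, and their absolute values add up to at most
  \<open>s * norm m\<close>. With \<open>p = Q powr (\<delta> / s)\<close> the series is therefore
  dominated by a product of convergent geometric series, one for each basis vector. The 1 in
  \<open>s\<close> keeps it positive in rank 0.\<close>

lemma summable_dual:
  assumes Q: "0 < Q" "Q < 1" and \<delta>: "\<delta> > 0"
  shows "(\<lambda>m. Q powr (\<delta> * norm m)) summable_on dual_lattice N"
proof -
  define s where "s = 1 + (\<Sum>b\<in>B. norm b)"
  define p where "p = Q powr (\<delta> / s)"
  have s: "s > 0" by (simp add: s_def add_pos_nonneg sum_nonneg)
  have p: "0 \<le> p" "p < 1"
    using Q \<delta> s powr_less_mono'[of Q 0 "\<delta> / s"] by (auto simp: p_def)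
  define h where "h = (\<lambda>m. restrict (\<lambda>b. \<lfloor>m \<bullet> b\<rfloor>) B)"
  have hb: "real_of_int (h m b) = m \<bullet> b" if "m \<in> dual_lattice N" "b \<in> B" for m b
    using dual_integral[OF that(1), of b] B_sub that(2) by (auto simp: h_def floor_of_int elim!: Ints_cases)
  have inj: "inj_on h (dual_lattice N)"
    by (rule inj_onI) (metis dual_eqI hb)
  let ?P = "\<lambda>g. \<Prod>b\<in>B. p ^ nat \<bar>g b\<bar>"
  have one: "Infinite_Set_Sum.abs_summable_on (\<lambda>k::int. p ^ nat \<bar>k\<bar>) UNIV"
    using summable_on_power_abs_int[OF p] p by (simp flip: abs_summable_equivalent)
  have "Infinite_Sum.abs_summable_on ?P (PiE B (\<lambda>_. UNIV :: int set))"
    unfolding abs_summable_equivalent by (rule abs_summable_on_prod_PiE[OF fin_B]) (simp_all add: one)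
  then have "?P summable_on (PiE B (\<lambda>_. UNIV))" by (rule abs_summable_summable)
  then have "?P summable_on (h ` dual_lattice N)"
    by (rule summable_on_subset_banach) (auto simp: h_def)
  then have sm: "(\<lambda>m. ?P (h m)) summable_on dual_lattice N"
    using summable_on_reindex[OF inj, of ?P] by (simp add: o_def)
  show ?thesis
  proof (rule summable_on_comparison_test[OF sm])
    fix m assume m: "m \<in> dual_lattice N"
    have "(\<Sum>b\<in>B. \<bar>m \<bullet> b\<bar>) \<le> (\<Sum>b\<in>B. norm m * norm b)"
      by (intro sum_mono Cauchy_Schwarz_ineq2)
    also have "\<dots> = norm m * (\<Sum>b\<in>B. norm b)" by (rule sum_distrib_left[symmetric])
    also have "\<dots> \<le> norm m * s" by (intro mult_left_mono) (simp_all add: s_def)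
    finally have "\<delta> / s * (\<Sum>b\<in>B. \<bar>m \<bullet> b\<bar>) \<le> \<delta> / s * (norm m * s)"
      using \<delta> s by (intro mult_left_mono) auto
    also have "\<dots> = \<delta> * norm m" using s by simp
    finally have "Q powr (\<delta> * norm m) \<le> Q powr (\<delta> / s * (\<Sum>b\<in>B. \<bar>m \<bullet> b\<bar>))"
      using Q by (intro powr_mono') auto
    also have "\<dots> = p powr (\<Sum>b\<in>B. \<bar>m \<bullet> b\<bar>)" by (simp add: p_def powr_powr)
    also have "\<dots> = (\<Prod>b\<in>B. p powr \<bar>m \<bullet> b\<bar>)" using Q fin_B by (subst powr_sum) (auto simp: p_def)
    also have "\<dots> = ?P (h m)"
    proof (rule prod.cong)
      fix b assume "b \<in> B"
      then have "\<bar>m \<bullet> b\<bar> = real (nat \<bar>h m b\<bar>)" using hb[OF m] by (metis of_int_abs of_nat_nat abs_ge_zero of_int_of_nat_eq)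
      moreover have "p > 0" using Q by (simp add: p_def)
      ultimately show "p powr \<bar>m \<bullet> b\<bar> = p ^ nat \<bar>h m b\<bar>" by (simp only: powr_realpow)
    qed simp
    finally show "Q powr (\<delta> * norm m) \<le> ?P (h m)" .
  qed simp
qed

end

lemma lattice_of_rankE:
  assumes "lattice_of_rank N r"
  obtains B where "lattice N r B"
  using assms unfolding lattice_of_rank_def lattice_def by blast

section \<open>One complex variable\<close>

lemma norm_powi: "q \<noteq> 0 \<Longrightarrow> norm ((q :: complex) powi k) = norm q powr of_int k"
  by (simp add: norm_power_int powr_real_of_int')

text \<open>The two smallness conditions settle \<open>k = 1\<close> and \<open>k = -1\<close>, and
  for larger \<open>|k|\<close> the factor \<open>norm q < 1\<close> helps. The conditions do not
  involve \<open>k\<close>, which is why the later bounds are uniform in \<open>m\<close>.\<close>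

lemma geometric_ratio:
  fixes c q :: complex
  assumes q: "q \<noteq> 0" "norm q < 1" "norm q * norm c \<le> 1 / 2" "2 * norm q \<le> norm c"
  shows "k > 0 \<Longrightarrow> norm (c * q powi k) \<le> 1 / 2" and "k < 0 \<Longrightarrow> 2 \<le> norm (c * q powi k)"
proof -
  have nt: "norm (c * q powi k) = norm c * norm q powr of_int k" by (simp add: norm_mult norm_powi q)
  show "norm (c * q powi k) \<le> 1 / 2" if "k > 0"
  proof -
    have "norm q powr of_int k \<le> norm q powr 1" using that q by (intro powr_mono') auto
    then have "norm (c * q powi k) \<le> norm c * norm q" using nt q(1) by (simp add: mult_left_mono)
    then show ?thesis using q(3) by (simp add: mult.commute)
  qed
  show "2 \<le> norm (c * q powi k)" if "k < 0"
  proof -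
    have "norm q powr (- 1) \<le> norm q powr of_int k" using that q by (intro powr_mono') auto
    then have "inverse (norm q) \<le> norm q powr of_int k" using q(1) by (simp add: powr_minus)
    then have "norm c * inverse (norm q) \<le> norm (c * q powi k)" unfolding nt by (intro mult_left_mono) auto
    moreover have "2 \<le> norm c * inverse (norm q)" using q by (simp add: field_simps)
    ultimately show ?thesis by linarith
  qed
qed

text \<open>For \<open>k \<noteq> 0\<close> the absolute value of \<open>c * q powi k\<close> stays
  away from 1, so a zero could only occur at \<open>k = 0\<close>, where \<open>c \<noteq> 1\<close>
  excludes it.\<close>

lemma geometric_denominator_nonzero:
  fixes c q :: complex
  assumes "c \<noteq> 1" "q \<noteq> 0" "norm q < 1" "norm q * norm c \<le> 1 / 2" "2 * norm q \<le> norm c"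
  shows "1 - c * q powi k \<noteq> 0"
proof
  assume "1 - c * q powi k = 0"
  then have "norm (c * q powi k) = 1" by (simp add: right_minus_eq)
  then show False using geometric_ratio[OF assms(2-), of k] \<open>1 - c * q powi k = 0\<close> assms(1,2)
    by (cases k "0 :: int" rule: linorder_cases) auto
qed

text \<open>The exponent on the right is always nonnegative: a factor with a negative exponent is
  rewritten in terms of its reciprocal.\<close>

lemma geometric_factor_bound:
  fixes c q :: complex and a :: real
  assumes c: "c \<noteq> 0" and q: "q \<noteq> 0" "norm q < 1" "norm q * norm c \<le> 1 / 2" "2 * norm q \<le> norm c"
    and a: "0 \<le> a" "a \<le> 1"
  shows "norm q powr (a * of_int k) / norm (1 - c * q powi k) \<le>
    (2 + 2 / norm c + 1 / norm (1 - c)) *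
    norm q powr (if k \<ge> 0 then a * of_int k else (a - 1) * of_int k)"
proof -
  \<comment> \<open>One summand for each case: 2 for \<open>k > 0\<close>, \<open>2 / norm c\<close>
    for \<open>k < 0\<close> and \<open>1 / norm (1 - c)\<close> for \<open>k = 0\<close>.\<close>
  let ?K = "2 + 2 / norm c + 1 / norm (1 - c)" and ?t = "c * q powi k"
  have K: "2 \<le> ?K" "1 / norm (1 - c) \<le> ?K" "2 / norm c \<le> ?K" by simp_all
  have nt: "norm ?t = norm c * norm q powr of_int k" by (simp add: norm_mult norm_powi q)
  consider "k = 0" | "k > 0" | "k < 0" by linarith
  then show ?thesis
  proof cases
    case 1
    then show ?thesis using q(1) by simp
  next
    case 2
    then have "norm ?t \<le> 1 / 2" using geometric_ratio[OF q] by blast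
    then have "1 / 2 \<le> norm (1 - ?t)" using norm_triangle_ineq2[of 1 ?t] by simp
    then have "norm q powr (a * of_int k) / norm (1 - ?t) \<le> norm q powr (a * of_int k) / (1 / 2)"
      by (intro divide_left_mono mult_pos_pos) auto
    also have "\<dots> \<le> ?K * norm q powr (a * of_int k)"
      using mult_right_mono[OF K(1), of "norm q powr (a * of_int k)"] by simp
    finally show ?thesis using 2 by simp
  next
    case 3
    then have "norm ?t \<ge> 2" using geometric_ratio[OF q] by blast
    then have "norm ?t / 2 \<le> norm (1 - ?t)" using norm_triangle_ineq2[of ?t 1] by (simp add: norm_minus_commute)
    then have "norm q powr (a * of_int k) / norm (1 - ?t) \<le> norm q powr (a * of_int k) / (norm ?t / 2)"
    proof (intro divide_left_mono mult_pos_pos)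
      show "0 < norm (1 - ?t)" "0 < norm ?t / 2"
        using \<open>norm ?t \<ge> 2\<close> \<open>norm ?t / 2 \<le> norm (1 - ?t)\<close> by linarith+
    qed auto
    also have "\<dots> = 2 / norm c * norm q powr (a * of_int k - of_int k)"
      using nt c by (simp add: powr_diff)
    also have "\<dots> = 2 / norm c * norm q powr ((a - 1) * of_int k)" by (simp add: algebra_simps)
    also have "\<dots> \<le> ?K * norm q powr ((a - 1) * of_int k)"
      by (intro mult_right_mono K) auto
    finally show ?thesis using 3 by simp
  qed
qed

text \<open>Markov's inequality for sums: \<open>n\<close> values of size at least \<open>c\<close>
  force the total to be at least \<open>n * c\<close>.\<close>

lemma finite_summable_ge:
  fixes f :: "'a \<Rightarrow> real"
  assumes "f summable_on A" "\<And>x. x \<in> A \<Longrightarrow> 0 \<le> f x" "c > 0"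
  shows "finite {x \<in> A. c \<le> f x}"
proof (rule ccontr)
  assume inf: "infinite {x \<in> A. c \<le> f x}"
  obtain n :: nat where n: "infsum f A / c < real n" using reals_Archimedean2 by blast
  obtain F where F: "finite F" "card F = n" "F \<subseteq> {x \<in> A. c \<le> f x}"
    using infinite_arbitrarily_large[OF inf] by blast
  have "real n * c = (\<Sum>x\<in>F. c)" using F(2) by simp
  also have "\<dots> \<le> sum f F" using F(3) by (intro sum_mono) auto
  also have "\<dots> \<le> infsum f A"
    using F assms(2) by (intro finite_sum_le_infsum[OF assms(1)]) auto
  finally show False using n assms(3) by (simp add: field_simps)
qed

text \<open>Riemann's theorem on removable singularities, with the value of the extension written as
  \<open>Lim (at 0) f\<close>, the form in which \<open>cone_fun\<close> is defined at 0.\<close>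

lemma holomorphic_extend_Lim:
  assumes "f holomorphic_on ball 0 \<epsilon> - {0}" "\<epsilon> > 0" "\<And>q. q \<in> ball 0 \<epsilon> - {0} \<Longrightarrow> norm (f q) \<le> K"
  shows "(\<lambda>q. if q = 0 then Lim (at 0) f else f q) holomorphic_on ball 0 \<epsilon>"
proof -
  have "eventually (\<lambda>z. norm (f z) \<le> K) (at 0)"
    unfolding eventually_at using assms(2,3) by (intro exI[of _ \<epsilon>]) auto
  then obtain g where g: "g holomorphic_on ball 0 \<epsilon>" "\<And>z. z \<in> ball 0 \<epsilon> - {0} \<Longrightarrow> g z = f z"
    using holomorphic_on_extend_bounded[OF assms(1)] assms(2) by auto
  have "isCont g 0"
    using holomorphic_on_imp_continuous_on[OF g(1)] assms(2)
    by (simp add: continuous_on_eq_continuous_at)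
  then have "(g \<longlongrightarrow> g 0) (at 0)" by (simp add: isCont_def)
  moreover have "eventually (\<lambda>z. g z = f z) (at 0)"
    unfolding eventually_at using assms(2) g(2) by (intro exI[of _ \<epsilon>]) auto
  ultimately have "(f \<longlongrightarrow> g 0) (at 0)" by (rule Lim_transform_eventually)
  then have "Lim (at 0) f = g 0" by (intro tendsto_Lim) auto
  then show ?thesis
    using g by (intro holomorphic_transform[OF g(1)]) auto
qed

lemma bound_at_zero:
  fixes f :: "complex \<Rightarrow> complex"
  assumes "f holomorphic_on ball 0 \<epsilon>" "\<epsilon> > 0" "\<And>q. q \<in> ball 0 \<epsilon> - {0} \<Longrightarrow> norm (f q) \<le> K * norm q ^ e"
    and "q \<in> ball 0 \<epsilon>"
  shows "norm (f q) \<le> K * norm q ^ e"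
proof (cases "q = 0")
  case True
  have "isCont f 0"
    using holomorphic_on_imp_continuous_on[OF assms(1)] assms(2)
    by (simp add: continuous_on_eq_continuous_at)
  then have "((\<lambda>z. norm (f z)) \<longlongrightarrow> norm (f 0)) (at 0)" by (intro tendsto_norm) (simp add: isCont_def)
  moreover have "((\<lambda>z :: complex. K * norm z ^ e) \<longlongrightarrow> K * norm (0::complex) ^ e) (at 0)"
    by (intro tendsto_intros)
  moreover have "eventually (\<lambda>z. norm (f z) \<le> K * norm z ^ e) (at 0)"
    unfolding eventually_at using assms(2,3) by (intro exI[of _ \<epsilon>]) auto
  ultimately have "norm (f 0) \<le> K * norm (0::complex) ^ e"
    by (intro tendsto_le[OF _ _ _]) auto
  then show ?thesis using True by simp
qed (use assms in auto)

text \<open>Cauchy's inequality on the circle of radius \<open>r\<close> bounds the coefficient by a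
  constant times \<open>r ^ (e - n)\<close>, which tends to 0 with \<open>r\<close>.\<close>

lemma fps_expansion_nth_eq_0:
  assumes "f holomorphic_on ball 0 \<epsilon>" "\<epsilon> > 0" "\<And>q. q \<in> ball 0 \<epsilon> \<Longrightarrow> norm (f q) \<le> K * norm q ^ e"
    and "n < e"
  shows "fps_nth (fps_expansion f 0) n = 0"
proof -
  let ?c = "(deriv ^^ n) f 0"
  have bound: "norm ?c \<le> fact n * K * r ^ (e - n)" if r: "0 < r" "r < \<epsilon>" for r
  proof -
    have sub: "cball 0 r \<subseteq> ball 0 \<epsilon>" using r by auto
    have "norm ?c \<le> fact n * (K * r ^ e) / r ^ n"
    proof (rule Cauchy_inequality)
      show "f holomorphic_on ball 0 r"
        by (rule holomorphic_on_subset[OF assms(1)]) (use r in auto)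
      show "continuous_on (cball 0 r) f"
        using holomorphic_on_imp_continuous_on[OF assms(1)] continuous_on_subset sub by blast
      show "norm (f x) \<le> K * r ^ e" if "norm (0 - x) = r" for x
        using assms(3)[of x] that r by simp
    qed (use r in auto)
    also have "r ^ e = r ^ (e - n) * r ^ n" using assms(4) by (simp flip: power_add)
    finally show ?thesis using r by simp
  qed
  have "((\<lambda>r::real. fact n * K * r ^ (e - n)) \<longlongrightarrow> fact n * K * 0 ^ (e - n)) (at_right 0)"
    by (intro tendsto_intros)
  then have lim: "((\<lambda>r::real. fact n * K * r ^ (e - n)) \<longlongrightarrow> 0) (at_right 0)"
    using assms(4) by (simp add: power_0_left)
  have "eventually (\<lambda>r. norm ?c \<le> fact n * K * r ^ (e - n)) (at_right 0)"
    using eventually_at_right_less[of 0] eventually_at_right_real[OF assms(2)]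
    by eventually_elim (use bound in auto)
  then have "norm ?c \<le> 0"
    by (intro tendsto_lowerbound[OF lim]) auto
  then show ?thesis by (simp add: fps_expansion_def)
qed

section \<open>Euler relations for fans and their refinements\<close>

text \<open>Extending \<open>J\<close> to a basis of the whole space makes every coordinate an inner
  product with some \<open>w b\<close>. Open cones thereby become solution sets of linear equations
  and strict inequalities.\<close>

lemma independent_dual_basis:
  fixes J :: "'a::euclidean_space set"
  assumes "independent J"
  shows "\<exists>B w. J \<subseteq> B \<and> finite B \<and> (\<forall>a\<in>B. \<forall>b\<in>B. w b \<bullet> a = (if a = b then 1 else 0)) \<and>
    (\<forall>x. (\<Sum>b\<in>B. (w b \<bullet> x) *\<^sub>R b) = x)"
proof -
  obtain B where B: "J \<subseteq> B" "independent B" "UNIV \<subseteq> span B"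
    by (rule maximal_independent_subset_extend[OF subset_UNIV assms]) blast
  have fin: "finite B" using B(2) independent_imp_finite by blast
  have "\<exists>v. \<forall>a\<in>B. v \<bullet> a = (if a = b then 1 else 0)" for b
  proof -
    obtain g :: "'a \<Rightarrow> real" where g: "linear g" "\<And>a. a \<in> B \<Longrightarrow> g a = (if a = b then 1 else 0)"
      using linear_independent_extend[OF B(2), of "\<lambda>a. if a = b then 1 else 0"] by blast
    have "adjoint g 1 \<bullet> x = g x" for x
      using adjoint_works[OF g(1), of x 1] by (simp add: inner_commute)
    then show ?thesis using g(2) by metis
  qed
  then obtain w where w: "\<And>a b. a \<in> B \<Longrightarrow> w b \<bullet> a = (if a = b then 1 else 0)" by metis
  have rep: "(\<Sum>b\<in>B. (w b \<bullet> x) *\<^sub>R b) = x" for x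
  proof -
    have "x \<in> span B" using B(3) by blast
    then obtain c where c: "x = (\<Sum>b\<in>B. c b *\<^sub>R b)" unfolding span_finite[OF fin] by auto
    have "w b \<bullet> x = c b" if "b \<in> B" for b
    proof -
      have "w b \<bullet> x = (\<Sum>a\<in>B. c a * (w b \<bullet> a))" by (simp add: c inner_sum_right)
      also have "\<dots> = (\<Sum>a\<in>B. if a = b then c a else 0)" by (intro sum.cong) (simp_all add: w)
      finally show ?thesis using that fin by simp
    qed
    then show ?thesis using c by simp
  qed
  show ?thesis using B(1) fin w rep by (intro exI[of _ B] exI[of _ w]) simp
qed

lemma open_cone_eq_dual:
  fixes J :: "'a::euclidean_space set"
  assumes J: "J \<subseteq> B" and fin: "finite B"
    and w: "\<forall>a\<in>B. \<forall>b\<in>B. w b \<bullet> a = (if a = b then 1 else 0)"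
    and rep: "\<forall>x. (\<Sum>b\<in>B. (w b \<bullet> x) *\<^sub>R b) = x"
  shows "open_cone J = {x. (\<forall>b\<in>B - J. w b \<bullet> x = 0) \<and> (\<forall>b\<in>J. 0 < w b \<bullet> x)}" (is ?thesis1)
    and "span J = {x. \<forall>b\<in>B - J. w b \<bullet> x = 0}" (is ?thesis2)
proof -
  have val: "w b \<bullet> (\<Sum>j\<in>J. a j *\<^sub>R j) = (if b \<in> J then a b else 0)" if "b \<in> B" for b a
  proof -
    have "w b \<bullet> (\<Sum>j\<in>J. a j *\<^sub>R j) = (\<Sum>j\<in>J. if j = b then a j else 0)"
      unfolding inner_sum_right using J that w by (intro sum.cong) auto
    then show ?thesis using finite_subset[OF J fin] by simp
  qed
  have red: "x = (\<Sum>b\<in>J. (w b \<bullet> x) *\<^sub>R b)" if "\<forall>b\<in>B - J. w b \<bullet> x = 0" for x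
  proof -
    have "(\<Sum>b\<in>B. (w b \<bullet> x) *\<^sub>R b) = (\<Sum>b\<in>J. (w b \<bullet> x) *\<^sub>R b)"
      using that J fin by (intro sum.mono_neutral_right) auto
    then show ?thesis using rep by metis
  qed
  show ?thesis1
  proof (intro equalityI subsetI)
    fix x assume "x \<in> open_cone J"
    then obtain a where "x = (\<Sum>j\<in>J. a j *\<^sub>R j)" "\<forall>j\<in>J. 0 < a j" using open_coneD by blast
    then show "x \<in> {x. (\<forall>b\<in>B - J. w b \<bullet> x = 0) \<and> (\<forall>b\<in>J. 0 < w b \<bullet> x)}" using val J by auto
  next
    fix x assume x: "x \<in> {x. (\<forall>b\<in>B - J. w b \<bullet> x = 0) \<and> (\<forall>b\<in>J. 0 < w b \<bullet> x)}"
    then have "x = (\<Sum>b\<in>J. (w b \<bullet> x) *\<^sub>R b)" using red by simp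
    moreover have "(\<Sum>b\<in>J. (w b \<bullet> x) *\<^sub>R b) \<in> open_cone J" using x by (intro open_coneI) simp
    ultimately show "x \<in> open_cone J" by simp
  qed
  show ?thesis2
  proof (intro equalityI subsetI)
    fix x assume "x \<in> span J"
    then obtain a where "x = (\<Sum>j\<in>J. a j *\<^sub>R j)"
      unfolding span_finite[OF finite_subset[OF J fin]] by auto
    then show "x \<in> {x. \<forall>b\<in>B - J. w b \<bullet> x = 0}" using val by auto
  next
    fix x assume "x \<in> {x. \<forall>b\<in>B - J. w b \<bullet> x = 0}"
    then have "x = (\<Sum>b\<in>J. (w b \<bullet> x) *\<^sub>R b)" using red by simp
    moreover have "(\<Sum>b\<in>J. (w b \<bullet> x) *\<^sub>R b) \<in> span J" by (intro span_sum span_scale span_base)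
    ultimately show "x \<in> span J" by simp
  qed
qed

lemma open_cone_nonempty: "(\<Sum>j\<in>J. j) \<in> open_cone J"
  using open_coneI[of J "\<lambda>_. 1"] by simp

text \<open>In dual coordinates the open cone is a sign condition on finitely many functionals: zero
  off \<open>J\<close>, positive on \<open>J\<close>. All four facts are read off from this; for a
  point of the closure the coordinates are nonnegative, and the positive ones select the face
  \<open>I\<close>.\<close>

lemma
  fixes J :: "'a::euclidean_space set"
  assumes "independent J"
  shows rel_open_convex_open_cone: "rel_open_convex (open_cone J)"
    and aff_dim_open_cone: "aff_dim (open_cone J) = int (card J)"
    and open_cone_sign_invariant: "\<exists>S. finite S \<and>
          (\<forall>x y. x \<in> open_cone J \<longrightarrow> (\<forall>s\<in>S. sgn (s \<bullet> x) = sgn (s \<bullet> y)) \<longrightarrow> y \<in> open_cone J)"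
    and closure_open_cone: "x \<in> closure (open_cone J) \<Longrightarrow> \<exists>I\<subseteq>J. x \<in> open_cone I"
proof -
  obtain B w where J: "J \<subseteq> B" and fin: "finite B"
    and w: "\<forall>a\<in>B. \<forall>b\<in>B. w b \<bullet> a = (if a = b then 1 else 0)"
    and rep: "\<forall>x. (\<Sum>b\<in>B. (w b \<bullet> x) *\<^sub>R b) = x"
    using independent_dual_basis[OF assms] by blast
  note eq = open_cone_eq_dual(1)[OF _ fin w rep]
  have finJ: "finite J" by (rule finite_subset[OF J fin])
  have "open_cone J = span J \<inter> (\<Inter>b\<in>J. {x. 0 < w b \<bullet> x})"
    unfolding eq[OF J] open_cone_eq_dual(2)[OF J fin w rep] by auto
  moreover have "open (\<Inter>b\<in>J. {x. 0 < w b \<bullet> x})"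
    using finJ by (intro open_INT) (auto simp: open_halfspace_gt)
  ultimately have o: "openin (top_of_set (span J)) (open_cone J)"
    by (simp add: openin_open_Int)
  have aff: "affine (span J)" by (simp add: subspace_imp_affine)
  have "convex (\<Inter>b\<in>J. {x. 0 < w b \<bullet> x})"
    by (intro convex_INT) (auto simp: convex_halfspace_gt)
  then have "convex (open_cone J)"
    using \<open>open_cone J = _\<close> by (simp add: convex_Int subspace_imp_convex)
  then show "rel_open_convex (open_cone J)" using rel_open_convexI[OF _ aff o] by blast
  have "open_cone J \<noteq> {}" using open_cone_nonempty by blast
  then have "aff_dim (open_cone J) = aff_dim (span J)" using aff_dim_openin[OF o aff] by simp
  then show "aff_dim (open_cone J) = int (card J)"
    by (simp add: aff_dim_subspace dim_span dim_eq_card_independent[OF assms])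
  show "\<exists>S. finite S \<and>
          (\<forall>x y. x \<in> open_cone J \<longrightarrow> (\<forall>s\<in>S. sgn (s \<bullet> x) = sgn (s \<bullet> y)) \<longrightarrow> y \<in> open_cone J)"
  proof (intro exI[of _ "w ` B"] conjI allI impI)
    fix x y assume x: "x \<in> open_cone J" and s: "\<forall>s\<in>w ` B. sgn (s \<bullet> x) = sgn (s \<bullet> y)"
    have "(w b \<bullet> x = 0 \<longleftrightarrow> w b \<bullet> y = 0) \<and> (0 < w b \<bullet> x \<longleftrightarrow> 0 < w b \<bullet> y)" if "b \<in> B" for b
      using s that by (metis imageI sgn_0_0 sgn_greater)
    then show "y \<in> open_cone J" using x J unfolding eq[OF J] by blast
  qed (use fin in simp)
  show "\<exists>I\<subseteq>J. x \<in> open_cone I" if x: "x \<in> closure (open_cone J)"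
  proof -
    let ?F = "{x. (\<forall>b\<in>B - J. w b \<bullet> x = 0) \<and> (\<forall>b\<in>J. 0 \<le> w b \<bullet> x)}"
    have "?F = (\<Inter>b\<in>B - J. {x. w b \<bullet> x = 0}) \<inter> (\<Inter>b\<in>J. {x. 0 \<le> w b \<bullet> x})" by auto
    moreover have "closed \<dots>"
      by (intro closed_Int closed_INT ballI closed_hyperplane closed_halfspace_ge)
    ultimately have "closed ?F" by simp
    moreover have "open_cone J \<subseteq> ?F" unfolding eq[OF J] by (auto intro: less_imp_le)
    ultimately have xF: "x \<in> ?F" using x closure_minimal by blast
    let ?I = "{b \<in> J. 0 < w b \<bullet> x}"
    have IB: "?I \<subseteq> B" using J by auto
    have "x \<in> open_cone ?I" unfolding eq[OF IB] using xF by force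
    then show ?thesis by (intro exI[of _ ?I] conjI) auto
  qed
qed

lemma finite_closed_separate:
  fixes a :: "'a::metric_space"
  assumes "finite F" "\<And>X. X \<in> F \<Longrightarrow> closed X"
  obtains \<eta> where "\<eta> > 0" "\<And>X. X \<in> F \<Longrightarrow> a \<notin> X \<Longrightarrow> X \<inter> ball a \<eta> = {}"
proof -
  have "open (- \<Union>{X \<in> F. a \<notin> X})" using assms by (intro open_Compl closed_Union) auto
  moreover have "a \<in> - \<Union>{X \<in> F. a \<notin> X}" by auto
  ultimately obtain \<eta> where "\<eta> > 0" "ball a \<eta> \<subseteq> - \<Union>{X \<in> F. a \<notin> X}"
    by (meson open_contains_ball)
  then show ?thesis by (intro that[of \<eta>]) auto
qed

section \<open>Local Euler relations around a point of a simplex\<close>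

context fan_rays begin

lemma open_cone_subset_V: "J \<in> triang \<Longrightarrow> open_cone J \<subseteq> V"
  using triang_cone[of J] open_cone_in[of _ J] cone_subset_V by blast

lemma triang_partition: "x \<in> V \<Longrightarrow> \<exists>!J. J \<in> triang \<and> x \<in> open_cone J"
  using triang_cover triang_unique by blast

text \<open>The point \<open>a\<close> lies in the open cone of some face of \<open>J\<close>, and
  by uniqueness that face is \<open>A\<close>.\<close>

lemma closure_open_cone_triang:
  assumes A: "A \<in> triang" and a: "a \<in> open_cone A" and J: "J \<in> triang"
    and cl: "a \<in> closure (open_cone J)"
  shows "A \<subseteq> J"
proof -
  obtain I where I: "I \<subseteq> J" "a \<in> open_cone I"
    using closure_open_cone[OF triang_independent[OF J] cl] by blast
  have "I = A" using triang_unique[OF triang_down[OF J I(1)] A I(2) a] .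
  with I show ?thesis by simp
qed

lemma triang_euler_open:
  assumes K: "open K" "convex K" "V \<inter> K \<noteq> {}"
  shows "(\<Sum>J | J \<in> triang \<and> open_cone J \<inter> K \<noteq> {}. (- 1) ^ card J) = (- 1 :: int) ^ dim V"
proof -
  have "\<forall>J\<in>triang. \<exists>S. finite S \<and>
          (\<forall>x y. x \<in> open_cone J \<longrightarrow> (\<forall>s\<in>S. sgn (s \<bullet> x) = sgn (s \<bullet> y)) \<longrightarrow> y \<in> open_cone J)"
    using open_cone_sign_invariant triang_independent by blast
  then obtain S where S: "\<And>J. J \<in> triang \<Longrightarrow> finite (S J)"
    "\<And>J x y. J \<in> triang \<Longrightarrow> x \<in> open_cone J \<Longrightarrow> (\<And>s. s \<in> S J \<Longrightarrow> sgn (s \<bullet> x) = sgn (s \<bullet> y)) \<Longrightarrow>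
      y \<in> open_cone J" by metis
  have "(\<Sum>J | J \<in> triang \<and> open_cone J \<inter> K \<noteq> {}. (- 1) ^ nat (aff_dim (open_cone J))) = (- 1 :: int) ^ dim V"
  proof (rule euler_sum_open[OF subspace_V _ finite_triang _ _ triang_partition _ K])
    show "finite (\<Union>J\<in>triang. S J)" using finite_triang S(1) by blast
    show "rel_open_convex (open_cone J)" "open_cone J \<subseteq> V" if "J \<in> triang" for J
      using that rel_open_convex_open_cone triang_independent open_cone_subset_V by blast+
    show "y \<in> open_cone J" if "J \<in> triang" "x \<in> open_cone J"
      "\<And>s. s \<in> (\<Union>J\<in>triang. S J) \<Longrightarrow> sgn (s \<bullet> x) = sgn (s \<bullet> y)" for J x y
      using S(2)[OF that(1,2)] that(1,3) by blast
  qed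
  moreover have "nat (aff_dim (open_cone J)) = card J" if "J \<in> triang" for J
    using aff_dim_open_cone[OF triang_independent[OF that]] by simp
  then have "(\<Sum>J | J \<in> triang \<and> open_cone J \<inter> K \<noteq> {}. (- 1) ^ nat (aff_dim (open_cone J))) =
      (\<Sum>J | J \<in> triang \<and> open_cone J \<inter> K \<noteq> {}. (- 1 :: int) ^ card J)"
    by (intro sum.cong) auto
  ultimately show ?thesis by simp
qed

text \<open>A small ball around a point \<open>a\<close> of the open cone of \<open>A\<close> meets
  exactly the open cones with \<open>A \<subseteq> J\<close>, since the closures of the others miss
  \<open>a\<close>. For the second relation the window is the half of this ball on which
  \<open>u\<close> is positive. As \<open>u\<close> vanishes at \<open>a\<close>, this half meets
  the open cone of \<open>J\<close> iff moreover \<open>u\<close> is positive on some ray of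
  \<open>J\<close>.\<close>

lemma triang_euler_star:
  assumes A: "A \<in> triang"
  shows "(\<Sum>J | J \<in> triang \<and> A \<subseteq> J. (- 1) ^ card J) = (- 1 :: int) ^ dim V"
    and "u \<in> V \<Longrightarrow> u \<noteq> 0 \<Longrightarrow> (\<And>j. j \<in> A \<Longrightarrow> u \<bullet> j = 0) \<Longrightarrow>
      (\<Sum>J | J \<in> triang \<and> A \<subseteq> J \<and> (\<exists>j\<in>J. u \<bullet> j > 0). (- 1) ^ card J) = (- 1 :: int) ^ dim V"
proof -
  define a where "a = (\<Sum>j\<in>A. j)"
  have a: "a \<in> open_cone A" using open_cone_nonempty by (simp add: a_def)
  have aV: "a \<in> V" using open_cone_subset_V[OF A] a by blast
  obtain \<eta> where \<eta>: "\<eta> > 0"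
    "\<And>X. X \<in> (\<lambda>J. closure (open_cone J)) ` triang \<Longrightarrow> a \<notin> X \<Longrightarrow> X \<inter> ball a \<eta> = {}"
    using finite_closed_separate[of "(\<lambda>J. closure (open_cone J)) ` triang" a] finite_triang by auto
  have fwd: "A \<subseteq> J" if "J \<in> triang" "x \<in> open_cone J" "x \<in> ball a \<eta>" for J x
  proof -
    have "x \<in> closure (open_cone J) \<inter> ball a \<eta>" using that(2,3) closure_subset by blast
    then have "a \<in> closure (open_cone J)" using \<eta>(2) that(1) by blast
    then show ?thesis using closure_open_cone_triang[OF A a that(1)] by blast
  qed
  have near: "\<exists>t>0. a + t *\<^sub>R z \<in> ball a \<eta>" for z
  proof (intro exI conjI)
    show "0 < \<eta> / (1 + norm z) / 2" using \<eta>(1) by (simp add: add_pos_nonneg)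
    have "\<eta> * norm z < \<eta> * (2 * (1 + norm z))" using \<eta>(1) by (intro mult_strict_left_mono) (auto simp: add_pos_nonneg intro: le_less_trans[of _ "0 + norm z"])
    then show "a + (\<eta> / (1 + norm z) / 2) *\<^sub>R z \<in> ball a \<eta>"
      using \<eta>(1) by (simp add: dist_norm field_simps add_pos_nonneg)
  qed
  have bwd: "a + t *\<^sub>R (\<Sum>j\<in>J. c j *\<^sub>R j) \<in> open_cone J"
    if "J \<in> triang" "A \<subseteq> J" "t > 0" "\<And>j. j \<in> J \<Longrightarrow> c j > 0" for J t c
  proof -
    have "a = (\<Sum>j\<in>J. (if j \<in> A then 1 else 0) *\<^sub>R j)"
      using that(2) triang_finite[OF that(1)]
      by (simp add: a_def if_distrib[of "\<lambda>x. x *\<^sub>R _"] sum.If_cases Int_absorb1 cong: if_cong)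
    then have "a + t *\<^sub>R (\<Sum>j\<in>J. c j *\<^sub>R j) = (\<Sum>j\<in>J. ((if j \<in> A then 1 else 0) + t * c j) *\<^sub>R j)"
      by (simp add: scaleR_left_distrib sum.distrib scaleR_sum_right)
    then show ?thesis using that by (simp add: open_coneI add_nonneg_pos)
  qed
  have "open_cone J \<inter> ball a \<eta> \<noteq> {} \<longleftrightarrow> A \<subseteq> J" if J: "J \<in> triang" for J
  proof
    assume AJ: "A \<subseteq> J"
    obtain t where "t > 0" "a + t *\<^sub>R (\<Sum>j\<in>J. 1 *\<^sub>R j) \<in> ball a \<eta>" using near by blast
    then show "open_cone J \<inter> ball a \<eta> \<noteq> {}" using bwd[OF J AJ, of t "\<lambda>_. 1"] by auto
  next
    assume "open_cone J \<inter> ball a \<eta> \<noteq> {}"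
    then show "A \<subseteq> J" using fwd[OF J] by blast
  qed
  then have "{J. J \<in> triang \<and> open_cone J \<inter> ball a \<eta> \<noteq> {}} = {J. J \<in> triang \<and> A \<subseteq> J}" by blast
  then show "(\<Sum>J | J \<in> triang \<and> A \<subseteq> J. (- 1) ^ card J) = (- 1 :: int) ^ dim V"
    using triang_euler_open[of "ball a \<eta>"] aV \<eta>(1) centre_in_ball[of a \<eta>] by fastforce
  assume u: "u \<in> V" "u \<noteq> 0" "\<And>j. j \<in> A \<Longrightarrow> u \<bullet> j = 0"
  have ua: "u \<bullet> a = 0" using u(3) by (simp add: a_def inner_sum_right)
  let ?K = "ball a \<eta> \<inter> {x. u \<bullet> x > 0}"
  have "open_cone J \<inter> ?K \<noteq> {} \<longleftrightarrow> A \<subseteq> J \<and> (\<exists>j\<in>J. u \<bullet> j > 0)" if J: "J \<in> triang" for J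
  proof
    assume "open_cone J \<inter> ?K \<noteq> {}"
    then obtain x where x: "x \<in> open_cone J" "x \<in> ball a \<eta>" "u \<bullet> x > 0" by auto
    obtain c where c: "x = (\<Sum>j\<in>J. c j *\<^sub>R j)" "\<forall>j\<in>J. 0 < c j" using open_coneD[OF x(1)] by blast
    have "\<exists>j\<in>J. u \<bullet> j > 0"
    proof (rule ccontr)
      assume "\<not> ?thesis"
      then have "(\<Sum>j\<in>J. c j * (u \<bullet> j)) \<le> 0"
        using c(2) by (intro sum_nonpos mult_nonneg_nonpos) (auto simp: not_less less_imp_le)
      then have "u \<bullet> x \<le> 0" by (simp add: c(1) inner_sum_right)
      then show False using x(3) by simp
    qed
    then show "A \<subseteq> J \<and> (\<exists>j\<in>J. u \<bullet> j > 0)" using fwd[OF J x(1,2)] by blast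
  next
    assume r: "A \<subseteq> J \<and> (\<exists>j\<in>J. u \<bullet> j > 0)"
    then obtain i where i: "i \<in> J" "u \<bullet> i > 0" by blast
    \<comment> \<open>The weight \<open>s\<close> at the ray \<open>i\<close> outweighs the pairings
      of \<open>u\<close> with all other rays of \<open>J\<close>.\<close>
    define s where "s = 1 + \<bar>\<Sum>j\<in>J - {i}. u \<bullet> j\<bar> / (u \<bullet> i)"
    define c where "c = (\<lambda>j. if j = i then s else 1)"
    have s: "s > 0" using i(2) by (simp add: s_def add_pos_nonneg)
    have "(\<Sum>j\<in>J. c j * (u \<bullet> j)) = s * (u \<bullet> i) + (\<Sum>j\<in>J - {i}. u \<bullet> j)"
      using triang_finite[OF J] i(1) by (simp add: sum.remove c_def)
    also have "\<dots> > 0"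
      using i(2) by (simp add: s_def distrib_right)
    finally have pos: "u \<bullet> (\<Sum>j\<in>J. c j *\<^sub>R j) > 0" by (simp add: inner_sum_right)
    obtain t where t: "t > 0" "a + t *\<^sub>R (\<Sum>j\<in>J. c j *\<^sub>R j) \<in> ball a \<eta>" using near by blast
    have "a + t *\<^sub>R (\<Sum>j\<in>J. c j *\<^sub>R j) \<in> open_cone J"
      using r by (intro bwd[OF J _ t(1)]) (auto simp: c_def s)
    moreover have "u \<bullet> (a + t *\<^sub>R (\<Sum>j\<in>J. c j *\<^sub>R j)) > 0"
      using pos t(1) ua by (simp add: inner_add_right)
    ultimately show "open_cone J \<inter> ?K \<noteq> {}" using t(2) by blast
  qed
  then have "{J. J \<in> triang \<and> open_cone J \<inter> ?K \<noteq> {}} = {J. J \<in> triang \<and> A \<subseteq> J \<and> (\<exists>j\<in>J. u \<bullet> j > 0)}"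
    by blast
  moreover have "V \<inter> ?K \<noteq> {}"
  proof -
    obtain t where t: "t > 0" "a + t *\<^sub>R u \<in> ball a \<eta>" using near by blast
    moreover have "a + t *\<^sub>R u \<in> V" using aV u(1) subspace_V by (simp add: subspace_add subspace_scale)
    moreover have "u \<bullet> (a + t *\<^sub>R u) > 0" using ua t(1) u(2) by (simp add: inner_add_right)
    ultimately show ?thesis by blast
  qed
  moreover have "open ?K" "convex ?K"
    by (auto intro!: open_Int convex_Int simp: open_halfspace_gt convex_halfspace_gt)
  ultimately show "(\<Sum>J | J \<in> triang \<and> A \<subseteq> J \<and> (\<exists>j\<in>J. u \<bullet> j > 0). (- 1) ^ card J) = (- 1 :: int) ^ dim V"
    using triang_euler_open[of ?K] by simp
qed

text \<open>The difference of the two star relations says that the signed sum over all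
  \<open>J \<supseteq> A\<close> with \<open>u \<le> 0\<close> on \<open>J\<close> is 0. Sort these
  simplices by their zero set, which contains \<open>A\<close>: by downward induction on
  \<open>card A\<close> every larger zero set contributes 0, and the class of \<open>A\<close>
  remains.\<close>

lemma triang_euler_halfspace:
  assumes u: "u \<in> V" "u \<noteq> 0" and A: "A \<in> triang" "\<And>j. j \<in> A \<Longrightarrow> u \<bullet> j = 0"
  shows "(\<Sum>J | J \<in> triang \<and> (\<forall>j\<in>J. u \<bullet> j \<le> 0) \<and> {j \<in> J. u \<bullet> j = 0} = A. (- 1) ^ card J) = (0 :: int)"
  using A
proof (induction "card D - card A" arbitrary: A rule: less_induct)
  case less
  let ?N = "\<lambda>J. \<forall>j\<in>J. u \<bullet> j \<le> 0" and ?Z = "\<lambda>J. {j \<in> J. u \<bullet> j = 0}"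
  let ?T = "{J. J \<in> triang \<and> A \<subseteq> J \<and> ?N J}"
  have fin: "finite {J. J \<in> triang \<and> Q J}" for Q using finite_triang by simp
  have "(\<Sum>J | J \<in> triang \<and> A \<subseteq> J. (- 1) ^ card J) =
      (\<Sum>J\<in>?T. (- 1) ^ card J) + (\<Sum>J | J \<in> triang \<and> A \<subseteq> J \<and> (\<exists>j\<in>J. u \<bullet> j > 0). (- 1 :: int) ^ card J)"
    by (subst sum.union_disjoint[symmetric]) (auto simp: fin not_le intro!: sum.cong)
  then have zero: "(\<Sum>J\<in>?T. (- 1 :: int) ^ card J) = 0"
    using triang_euler_star[OF less.prems(1)] u less.prems(2) by simp
  have "(\<Sum>J\<in>?T. (- 1 :: int) ^ card J) =
      (\<Sum>A'\<in>?Z ` ?T. \<Sum>J | J \<in> ?T \<and> ?Z J = A'. (- 1) ^ card J)"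
    by (rule sum.image_gen) (rule fin)
  also have "\<dots> = (\<Sum>A'\<in>?Z ` ?T. if A' = A then (\<Sum>J | J \<in> triang \<and> ?N J \<and> ?Z J = A. (- 1) ^ card J) else 0)"
  proof (rule sum.cong)
    fix A' assume A': "A' \<in> ?Z ` ?T"
    then obtain J0 where J0: "J0 \<in> triang" "A \<subseteq> J0" "A' = ?Z J0" by auto
    have sub: "A \<subseteq> A'" using J0 less.prems(2) by auto
    have eq: "{J. J \<in> ?T \<and> ?Z J = A'} = {J. J \<in> triang \<and> ?N J \<and> ?Z J = A'}" using sub by auto
    show "(\<Sum>J | J \<in> ?T \<and> ?Z J = A'. (- 1) ^ card J) =
        (if A' = A then (\<Sum>J | J \<in> triang \<and> ?N J \<and> ?Z J = A. (- 1 :: int) ^ card J) else 0)"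
    proof (cases "A' = A")
      case False
      have t: "A' \<in> triang" using triang_down[OF J0(1)] J0(3) by auto
      have "card A < card A'" using sub False triang_finite[OF t] by (simp add: psubset_card_mono psubset_eq)
      moreover have "card A' \<le> card D" using triang_sub[OF t] finite_D by (simp add: card_mono)
      ultimately have lt: "card D - card A' < card D - card A" by linarith
      have tz: "u \<bullet> j = 0" if "j \<in> A'" for j using that J0(3) by blast
      have "(\<Sum>J | J \<in> triang \<and> ?N J \<and> ?Z J = A'. (- 1 :: int) ^ card J) = 0"
        by (rule less.hyps[OF lt t tz])
      then show ?thesis unfolding eq using False by simp
    next
      case True
      then show ?thesis unfolding eq by simp
    qed
  qed simp
  also have "\<dots> = (\<Sum>J | J \<in> triang \<and> ?N J \<and> ?Z J = A. (- 1) ^ card J)"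
  proof -
    have "A \<in> ?Z ` ?T" using less.prems by (intro image_eqI[of _ _ A]) auto
    moreover have "finite (?Z ` ?T)" by (intro finite_imageI fin)
    ultimately show ?thesis by (simp only: sum.delta if_True)
  qed
  finally show ?case using zero by simp
qed

text \<open>The window is again a small ball around a point of the open cone of \<open>J\<close>,
  but the cells are the relative interiors of the cones of \<open>\<Sigma>\<close>. The ball meets
  that of \<open>C\<close> iff the point lies in \<open>C\<close>, that is, iff
  \<open>J \<subseteq> C\<close>. The set \<open>S\<close> stands for the functionals that define
  the cones.\<close>

lemma fan_euler_star:
  assumes J: "J \<in> triang" and S: "finite S"
    "\<And>C x y. C \<in> \<Sigma> \<Longrightarrow> x \<in> C \<Longrightarrow> y \<in> V \<Longrightarrow> (\<And>s. s \<in> S \<Longrightarrow> sgn (s \<bullet> x) = sgn (s \<bullet> y)) \<Longrightarrow> y \<in> C"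
  shows "(\<Sum>C | C \<in> \<Sigma> \<and> J \<subseteq> C. (- 1) ^ dim C) = (- 1 :: int) ^ dim V"
proof -
  define a where "a = (\<Sum>j\<in>J. j)"
  have a: "a \<in> open_cone J" using open_cone_nonempty by (simp add: a_def)
  have aV: "a \<in> V" using open_cone_subset_V[OF J] a by blast
  obtain \<eta> where \<eta>: "\<eta> > 0" "\<And>C. C \<in> \<Sigma> \<Longrightarrow> a \<notin> C \<Longrightarrow> C \<inter> ball a \<eta> = {}"
    using finite_closed_separate[OF finite_fan closed_cone] by metis
  have ri_V: "rel_interior C \<subseteq> V" if "C \<in> \<Sigma>" for C
    using rel_interior_subset cone_subset_V[OF that] by blast
  have sum: "(\<Sum>C | C \<in> \<Sigma> \<and> rel_interior C \<inter> ball a \<eta> \<noteq> {}. (- 1) ^ nat (aff_dim (rel_interior C))) = (- 1 :: int) ^ dim V"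
  proof (rule euler_sum_open[OF subspace_V S(1) finite_fan])
    show "rel_open_convex (rel_interior C)" if "C \<in> \<Sigma>" for C
      using convex_cone[OF that] openin_rel_interior[of C]
      by (intro rel_open_convexI[of _ "affine hull C"]) (auto simp: convex_rel_interior)
    show "rel_interior C \<subseteq> V" if "C \<in> \<Sigma>" for C by (rule ri_V[OF that])
    show "\<exists>!C. C \<in> \<Sigma> \<and> x \<in> rel_interior C" if "x \<in> V" for x
      using rel_interior_iff_hull_cone[OF _ that] hull_cone_point_in[OF that] by metis
    show "y \<in> rel_interior C" if C: "C \<in> \<Sigma>" "x \<in> rel_interior C" "y \<in> V"
      and sg: "\<And>s. s \<in> S \<Longrightarrow> sgn (s \<bullet> x) = sgn (s \<bullet> y)" for C x y
    proof -
      have xV: "x \<in> V" using C ri_V by blast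
      have "{D \<in> \<Sigma>. {x} \<subseteq> D} = {D \<in> \<Sigma>. {y} \<subseteq> D}"
        using S(2)[of _ x y] S(2)[of _ y x] sg xV C(3) by auto
      then have "hull_cone {x} = hull_cone {y}" by (simp add: hull_cone_def)
      then show ?thesis using rel_interior_iff_hull_cone[OF C(1)] xV C(2,3) by simp
    qed
  qed (use aV \<eta>(1) in auto)
  have "rel_interior C \<inter> ball a \<eta> \<noteq> {} \<longleftrightarrow> J \<subseteq> C" if C: "C \<in> \<Sigma>" for C
  proof -
    have "a \<in> C \<longleftrightarrow> rel_interior C \<inter> ball a \<eta> \<noteq> {}"
    proof
      assume "a \<in> C"
      then have "a \<in> closure (rel_interior C)"
        using convex_closure_rel_interior[OF convex_cone[OF C]] closure_subset by blast
      then show "rel_interior C \<inter> ball a \<eta> \<noteq> {}"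
        using \<eta>(1) by (metis Int_commute closure_iff_nhds_not_empty open_ball centre_in_ball subset_refl)
    next
      assume "rel_interior C \<inter> ball a \<eta> \<noteq> {}"
      then show "a \<in> C" using \<eta>(2)[OF C] rel_interior_subset by blast
    qed
    then show ?thesis using open_cone_subset_cone_iff[OF J a C] by simp
  qed
  then have "{C \<in> \<Sigma>. rel_interior C \<inter> ball a \<eta> \<noteq> {}} = {C \<in> \<Sigma>. J \<subseteq> C}" by blast
  moreover have "nat (aff_dim (rel_interior C)) = dim C" if C: "C \<in> \<Sigma>" for C
    using convex_cone[OF C] zero_in[OF C] aff_dim_zero[of C] hull_subset[of C affine]
    by (auto simp: rel_interior_aff_dim)
  then have "(\<Sum>C | C \<in> \<Sigma> \<and> J \<subseteq> C. (- 1) ^ nat (aff_dim (rel_interior C))) =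
      (\<Sum>C | C \<in> \<Sigma> \<and> J \<subseteq> C. (- 1 :: int) ^ dim C)"
    by (intro sum.cong) auto
  ultimately show ?thesis using sum by simp
qed

end

section \<open>Cone functions as sums over simplices\<close>

text \<open>The half-open parallelepiped, with coefficients in (0, 1] rather than [0, 1): its
  translates by \<open>nat_cone J\<close> have to tile the open cone, not the closed one.\<close>

definition box :: "'v::euclidean_space set \<Rightarrow> 'v set \<Rightarrow> 'v set" where
  "box N J = {v \<in> N. \<exists>a. v = (\<Sum>j\<in>J. a j *\<^sub>R j) \<and> (\<forall>j\<in>J. 0 < a j \<and> a j \<le> 1)}"

lemma boxI:
  "v \<in> N \<Longrightarrow> v = (\<Sum>j\<in>J. a j *\<^sub>R j) \<Longrightarrow> (\<And>j. j \<in> J \<Longrightarrow> 0 < a j \<and> a j \<le> 1) \<Longrightarrow> v \<in> box N J"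
  unfolding box_def by blast

lemma zero_in_nat_cone: "0 \<in> nat_cone J"
  unfolding nat_cone_def by (intro CollectI exI[of _ "\<lambda>_. 0"]) simp

lemma box_add_nat_cone_in_open_cone:
  assumes "v \<in> box N J" "x \<in> nat_cone J"
  shows "v + x \<in> open_cone J"
proof -
  obtain a where a: "v = (\<Sum>j\<in>J. a j *\<^sub>R j)" "\<forall>j\<in>J. 0 < a j \<and> a j \<le> 1"
    using assms(1) by (auto simp: box_def)
  obtain k :: "'a \<Rightarrow> nat" where k: "x = (\<Sum>j\<in>J. of_nat (k j) *\<^sub>R j)"
    using assms(2) by (auto simp: nat_cone_def)
  have "v + x = (\<Sum>j\<in>J. (a j + of_nat (k j)) *\<^sub>R j)"
    by (simp add: a(1) k scaleR_left_distrib sum.distrib)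
  then show ?thesis using a(2) by (simp add: open_coneI add_pos_nonneg)
qed

context lattice begin

lemma nat_cone_in_N: "J \<subseteq> N \<Longrightarrow> nat_cone J \<subseteq> N"
proof
  fix x assume J: "J \<subseteq> N" and "x \<in> nat_cone J"
  then obtain k :: "'v \<Rightarrow> nat" where "x = (\<Sum>j\<in>J. of_nat (k j) *\<^sub>R j)" by (auto simp: nat_cone_def)
  moreover have "of_nat (k j) *\<^sub>R j \<in> N" if "j \<in> J" for j
    using scale_in_N[of j "int (k j)"] J that by auto
  ultimately show "x \<in> N" by (simp add: sum_in_N)
qed

lemma finite_box: "finite (box N J)"
proof -
  have "norm v \<le> (\<Sum>j\<in>J. norm j)" if v: "v \<in> box N J" for v
  proof -
    obtain a where a: "v = (\<Sum>j\<in>J. a j *\<^sub>R j)" "\<forall>j\<in>J. 0 < a j \<and> a j \<le> 1"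
      using v by (auto simp: box_def)
    show ?thesis unfolding a(1)
    proof (rule sum_norm_le)
      fix j assume "j \<in> J"
      then show "norm (a j *\<^sub>R j) \<le> norm j"
        using a(2) mult_right_mono[of "\<bar>a j\<bar>" 1 "norm j"] by fastforce
    qed
  qed
  then have "box N J \<subseteq> {n \<in> N. norm n \<le> (\<Sum>j\<in>J. norm j)}" by (auto simp: box_def)
  then show ?thesis using finite_N_ball finite_subset by blast
qed

lemma box_decomposition:
  assumes J: "finite J" "independent J" "J \<subseteq> N" and n: "n \<in> N" "n \<in> open_cone J"
  shows "\<exists>!v. v \<in> box N J \<and> n - v \<in> nat_cone J"
proof -
  obtain b where b: "n = (\<Sum>j\<in>J. b j *\<^sub>R j)" "\<forall>j\<in>J. 0 < b j" using open_coneD[OF n(2)] by blast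
  \<comment> \<open>Rounding up and subtracting 1 leaves a remainder in (0, 1], also when
    \<open>b j\<close> is an integer.\<close>
  define k where "k = (\<lambda>j. nat (\<lceil>b j\<rceil> - 1))"
  have k: "0 < b j - of_nat (k j) \<and> b j - of_nat (k j) \<le> 1" if "j \<in> J" for j
  proof -
    have "0 < b j" using b(2) that by blast
    then have "\<lceil>b j\<rceil> \<ge> 1" by (simp add: one_le_ceiling)
    then have "real (k j) = of_int \<lceil>b j\<rceil> - 1" by (simp add: k_def)
    then show ?thesis using ceiling_correct[of "b j"] by linarith
  qed
  define x where "x = (\<Sum>j\<in>J. of_nat (k j) *\<^sub>R j)"
  have x: "x \<in> nat_cone J" by (auto simp: x_def nat_cone_def)
  have nx: "n - x = (\<Sum>j\<in>J. (b j - of_nat (k j)) *\<^sub>R j)"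
    by (simp add: b(1) x_def scaleR_diff_left sum_subtractf)
  have nN: "n - x \<in> N" using diff_in_N n(1) x nat_cone_in_N[OF J(3)] by blast
  have v: "n - x \<in> box N J" by (rule boxI[OF nN nx k])
  show ?thesis
  proof (rule ex1I[of _ "n - x"])
    show "n - x \<in> box N J \<and> n - (n - x) \<in> nat_cone J" using v x by simp
    fix v assume v: "v \<in> box N J \<and> n - v \<in> nat_cone J"
    obtain a where a: "v = (\<Sum>j\<in>J. a j *\<^sub>R j)" "\<forall>j\<in>J. 0 < a j \<and> a j \<le> 1"
      using v by (auto simp: box_def)
    obtain l :: "'v \<Rightarrow> nat" where l: "n - v = (\<Sum>j\<in>J. of_nat (l j) *\<^sub>R j)"
      using v by (auto simp: nat_cone_def)
    have "(\<Sum>j\<in>J. (a j + of_nat (l j) - b j) *\<^sub>R j) =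
        (\<Sum>j\<in>J. a j *\<^sub>R j) + (\<Sum>j\<in>J. of_nat (l j) *\<^sub>R j) - (\<Sum>j\<in>J. b j *\<^sub>R j)"
      by (simp add: scaleR_left_distrib scaleR_diff_left sum.distrib sum_subtractf)
    also have "\<dots> = v + (n - v) - n" by (simp only: a(1)[symmetric] l[symmetric] b(1)[symmetric])
    finally have z: "(\<Sum>j\<in>J. (a j + of_nat (l j) - b j) *\<^sub>R j) = 0" by simp
    have "a j = b j - of_nat (k j)" if j: "j \<in> J" for j
    proof -
      have "a j + of_nat (l j) - b j = 0"
        using independentD[OF J(2) J(1) subset_refl z j] .
      moreover have "0 < a j" "a j \<le> 1" using a(2) j by auto
      then have "\<bar>a j - (b j - of_nat (k j))\<bar> < 1" using k[OF j] by linarith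
      ultimately have "\<bar>real (k j) - real (l j)\<bar> < 1" by linarith
      then have "k j = l j" by linarith
      then show ?thesis using \<open>a j + of_nat (l j) - b j = 0\<close> by simp
    qed
    then show "v = n - x" unfolding a(1) nx by (intro sum.cong) simp_all
  qed
qed

end

section \<open>Characters, simplex functions and values of cone series\<close>

locale toric = lattice N r B + fan_rays "span N" \<Sigma> D ord
  for N :: "'v::euclidean_space set" and r :: nat and B :: "'v set" and \<Sigma> :: "'v set set"
    and D :: "'v set" and ord :: "'v \<Rightarrow> nat" +
  fixes deg :: "'v \<Rightarrow> complex"
  assumes D_N: "D \<subseteq> N"
    and rational: "C \<in> \<Sigma> \<Longrightarrow> rational_polyhedral_cone N C"
    and deg_linear: "C \<in> \<Sigma> \<Longrightarrow> linear_on_cone N deg C"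
    and deg_ray: "d \<in> D \<Longrightarrow> deg d \<notin> \<int>"
begin

definition character :: "'v \<Rightarrow> complex" where
  "character n = exp (2 * complex_of_real pi * \<i> * deg n)"

lemma character_nonzero [simp]: "character n \<noteq> 0"
  by (simp add: character_def)

lemma character_ray: assumes "d \<in> D" shows "character d \<noteq> 1"
proof
  assume "character d = 1"
  then obtain n :: int where "Im (deg d) = 0" "2 * pi * Re (deg d) = of_int (2 * n) * pi"
    by (auto simp: character_def exp_eq_1)
  then have "deg d = of_int n" by (simp add: complex_eq_iff)
  then show False using deg_ray[OF assms] by simp
qed

lemma deg_add:
  assumes "C \<in> \<Sigma>" "x \<in> C \<inter> N" "y \<in> C \<inter> N" shows "deg (x + y) = deg x + deg y"
proof -
  obtain L where L: "additive_on N L" "\<forall>n\<in>C \<inter> N. deg n = L n"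
    using deg_linear[OF assms(1)] unfolding linear_on_cone_def by blast
  have "x + y \<in> C \<inter> N" using assms add_in add_in_N by blast
  then show ?thesis using L assms unfolding additive_on_def by simp
qed

lemma character_add:
  "C \<in> \<Sigma> \<Longrightarrow> x \<in> C \<inter> N \<Longrightarrow> y \<in> C \<inter> N \<Longrightarrow> character (x + y) = character x * character y"
  by (simp add: character_def deg_add distrib_left exp_add)

lemma character_zero: "character 0 = 1"
  using character_add[OF zero_cone_in, of 0 0] zero_in_N by simp

lemma character_sum:
  assumes "C \<in> \<Sigma>" "J \<subseteq> C \<inter> N"
  shows "character (\<Sum>j\<in>J. j) = (\<Prod>j\<in>J. character j)"
  using assms(2)
proof (induction J rule: infinite_finite_induct)
  case (insert j J)
  have "(\<Sum>j\<in>J. j) \<in> C \<inter> N" using insert.prems by (auto intro!: sum_in[OF assms(1)] sum_in_N)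
  then show ?case using insert by (simp add: character_add[OF assms(1)])
qed (simp_all add: character_zero)

text \<open>Small enough for the conditions of \<open>geometric_ratio\<close> at every ray. The
  entry \<open>1 / 2\<close> keeps the radius below 1 and the set nonempty.\<close>

definition radius :: real where
  "radius = Min (insert (1 / 2) ((\<lambda>d. min (1 / (2 * norm (character d))) (norm (character d) / 2)) ` D))"

lemma radius: "0 < radius" "radius < 1"
  "d \<in> D \<Longrightarrow> norm q < radius \<Longrightarrow> norm (q :: complex) * norm (character d) \<le> 1 / 2"
  "d \<in> D \<Longrightarrow> norm q < radius \<Longrightarrow> 2 * norm q \<le> norm (character d)"
proof -
  let ?S = "insert (1 / 2) ((\<lambda>d. min (1 / (2 * norm (character d))) (norm (character d) / 2)) ` D)"
  have fin: "finite ?S" using finite_D by simp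
  show "0 < radius" unfolding radius_def using fin by (subst Min_gr_iff) auto
  have "radius \<le> 1 / 2" unfolding radius_def using fin by (intro Min_le) auto
  then show "radius < 1" by simp
  assume d: "d \<in> D" and q: "norm q < radius"
  have "radius \<le> min (1 / (2 * norm (character d))) (norm (character d) / 2)"
    unfolding radius_def using fin d by (intro Min_le) auto
  then have "norm q < 1 / (2 * norm (character d))" "norm q < norm (character d) / 2" using q by auto
  then show "norm q * norm (character d) \<le> 1 / 2" "2 * norm q \<le> norm (character d)"
    by (simp_all add: field_simps)
qed

text \<open>The value at the torus point of \<open>q\<close> and \<open>m\<close> of the series of
  \<open>character\<close> over the translate \<open>v + nat_cone J\<close>. Summation over the box
  gives the value for the open cone of \<open>J\<close>.\<close>

definition simplex_term :: "'v set \<Rightarrow> 'v \<Rightarrow> 'v \<Rightarrow> complex \<Rightarrow> complex" where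
  "simplex_term J v m q = character v * q powi \<lfloor>m \<bullet> v\<rfloor> /
     (\<Prod>j\<in>J. 1 - character j * q powi \<lfloor>m \<bullet> j\<rfloor>)"

definition simplex_fun :: "'v set \<Rightarrow> 'v \<Rightarrow> complex \<Rightarrow> complex" where
  "simplex_fun J m q = (\<Sum>v\<in>box N J. simplex_term J v m q)"

lemma denominator_nonzero:
  "d \<in> D \<Longrightarrow> q \<noteq> 0 \<Longrightarrow> norm q < radius \<Longrightarrow> 1 - character d * q powi k \<noteq> 0"
  using radius by (intro geometric_denominator_nonzero character_ray) auto

lemma floor_pairing_add:
  "m \<in> dual_lattice N \<Longrightarrow> x \<in> N \<Longrightarrow> y \<in> N \<Longrightarrow> \<lfloor>m \<bullet> (x + y)\<rfloor> = \<lfloor>m \<bullet> x\<rfloor> + \<lfloor>m \<bullet> y\<rfloor>"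
  using dual_integral[of m x] by (auto simp: inner_add_right elim!: Ints_cases)

lemma torus_point_monomial:
  assumes "m \<in> dual_lattice N" "q \<noteq> 0"
  shows "torus_point N (monomial_at q m)"
  using assms zero_in_N
  by unfold_locales (auto simp: monomial_at_def floor_pairing_add power_int_add intro: add_in_N)

lemma triang_N: "J \<in> triang \<Longrightarrow> J \<subseteq> N"
  using triang_sub D_N by blast

lemma box_in_cone:
  assumes "J \<in> triang" "C \<in> \<Sigma>" "J \<subseteq> C" "v \<in> box N J"
  shows "v \<in> C \<inter> N"
proof -
  have "v \<in> open_cone J"
    using box_add_nat_cone_in_open_cone[OF assms(4) zero_in_nat_cone] by simp
  then show ?thesis using open_cone_in[OF assms(2,3)] assms(4) by (simp add: box_def)
qed

lemma nat_cone_in_cone: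
  assumes "J \<in> triang" "C \<in> \<Sigma>" "J \<subseteq> C" "x \<in> nat_cone J"
  shows "x \<in> C \<inter> N"
proof -
  obtain k :: "'v \<Rightarrow> nat" where "x = (\<Sum>j\<in>J. of_nat (k j) *\<^sub>R j)"
    using assms(4) by (auto simp: nat_cone_def)
  then have "x \<in> C" using assms(3) by (auto intro!: sum_in[OF assms(2)] scale_in[OF assms(2)])
  then show ?thesis using nat_cone_in_N[OF triang_N[OF assms(1)]] assms(4) by blast
qed

text \<open>The open cones of the simplices inside \<open>C\<close> partition \<open>C\<close>, and
  the lattice points of each are tiled by translates of \<open>nat_cone J\<close>. So at a lattice
  point of \<open>C\<close> exactly one pair of \<open>J\<close> and \<open>v\<close> contributes,
  and at other points none does.\<close>

lemma cone_series_eq: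
  assumes C: "C \<in> \<Sigma>"
  shows "cone_series N deg C n =
    (\<Sum>J | J \<in> triang \<and> J \<subseteq> C. \<Sum>v\<in>box N J. if n - v \<in> nat_cone J then character n else 0)"
proof -
  have mem: "n \<in> C \<inter> N \<and> n \<in> open_cone J"
    if J: "J \<in> triang" "J \<subseteq> C" "v \<in> box N J" "n - v \<in> nat_cone J" for J v
  proof -
    have "n \<in> open_cone J" using box_add_nat_cone_in_open_cone[OF J(3,4)] by simp
    moreover have "v + (n - v) \<in> N"
      using box_in_cone[OF J(1) C J(2,3)] nat_cone_in_cone[OF J(1) C J(2,4)] add_in_N by blast
    ultimately show ?thesis using open_cone_in[OF C J(2)] by simp
  qed
  show ?thesis
  proof (cases "n \<in> C \<inter> N")
    case False
    then have "(\<Sum>v\<in>box N J. if n - v \<in> nat_cone J then character n else 0) = 0"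
      if "J \<in> {J. J \<in> triang \<and> J \<subseteq> C}" for J
      using mem[of J] that by (intro sum.neutral) auto
    then show ?thesis using False by (simp add: cone_series_def)
  next
    case True
    then have nV: "n \<in> span N" by (simp add: span_base)
    then obtain I where I: "I \<in> triang" "n \<in> open_cone I" "\<And>J. J \<in> triang \<Longrightarrow> n \<in> open_cone J \<Longrightarrow> J = I"
      using triang_partition[OF nV] by blast
    have IC: "I \<subseteq> C" using open_cone_subset_cone_iff[OF I(1,2) C] True by blast
    obtain w where w: "w \<in> box N I" "n - w \<in> nat_cone I"
      "\<And>v. v \<in> box N I \<Longrightarrow> n - v \<in> nat_cone I \<Longrightarrow> v = w"
      using box_decomposition[OF triang_finite triang_independent triang_N _ I(2), OF I(1) I(1) I(1)] True
      by blast
    have "(\<Sum>v\<in>box N J. if n - v \<in> nat_cone J then character n else 0) =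
        (if J = I then character n else 0)" if J: "J \<in> {J. J \<in> triang \<and> J \<subseteq> C}" for J
    proof (cases "J = I")
      case True
      have "n - v \<in> nat_cone I \<longleftrightarrow> v = w" if "v \<in> box N I" for v using w that by blast
      then have "(\<Sum>v\<in>box N I. if n - v \<in> nat_cone I then character n else 0) =
          (\<Sum>v\<in>box N I. if v = w then character n else 0)"
        by (intro sum.cong) auto
      then show ?thesis using True w(1) finite_box by simp
    next
      case False
      then have "n - v \<notin> nat_cone J" if "v \<in> box N J" for v
        using mem[of J v] that J I(3) by auto
      then show ?thesis using False by (simp add: sum.neutral)
    qed
    then have "(\<Sum>J | J \<in> triang \<and> J \<subseteq> C. \<Sum>v\<in>box N J. if n - v \<in> nat_cone J then character n else 0)
        = (\<Sum>J | J \<in> triang \<and> J \<subseteq> C. if J = I then character n else 0)"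
      by (rule sum.cong[OF refl])
    also have "\<dots> = character n" using I(1) IC finite_triang by simp
    finally show ?thesis using True by (simp add: cone_series_def character_def)
  qed
qed

lemma rational_value_cone_series:
  assumes C: "C \<in> \<Sigma>" and m: "m \<in> dual_lattice N" and q: "q \<noteq> 0" "norm q < radius"
  shows "is_rational_value N (cone_series N deg C) (monomial_at q m)
           (\<Sum>J | J \<in> triang \<and> J \<subseteq> C. simplex_fun J m q)"
proof -
  interpret torus_point N "monomial_at q m" by (rule torus_point_monomial[OF m q(1)])
  have "is_rational_value N (\<lambda>n. if n - v \<in> nat_cone J then character n else 0)
      (monomial_at q m) (simplex_term J v m q)"
    if J: "J \<in> triang" "J \<subseteq> C" and v: "v \<in> box N J" for J v
  proof -
    have "character (v + x + j) = character (v + x) * character j" if "x \<in> nat_cone J" "j \<in> J" for x j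
    proof -
      have "v + x \<in> C \<inter> N"
        using box_in_cone[OF J(1) C J(2) v] nat_cone_in_cone[OF J(1) C J(2) that(1)]
          add_in[OF C] add_in_N by blast
      moreover have "j \<in> C \<inter> N" using that(2) J triang_N by blast
      ultimately show ?thesis by (rule character_add[OF C])
    qed
    moreover have "1 - character j * monomial_at q m j \<noteq> 0" if "j \<in> J" for j
      using denominator_nonzero[of j] that triang_sub[OF J(1)] q by (auto simp: monomial_at_def)
    moreover have "v \<in> N" using v by (simp add: box_def)
    ultimately show ?thesis
      using rational_value_nat_cone[OF triang_finite triang_independent triang_N, OF J(1) J(1) J(1)]
      by (simp add: simplex_term_def monomial_at_def)
  qed
  then have "is_rational_value N (\<lambda>n. \<Sum>J | J \<in> triang \<and> J \<subseteq> C. \<Sum>v\<in>box N J.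
      if n - v \<in> nat_cone J then character n else 0) (monomial_at q m)
      (\<Sum>J | J \<in> triang \<and> J \<subseteq> C. simplex_fun J m q)"
    unfolding simplex_fun_def by (intro rational_value_sum) auto
  then show ?thesis by (simp add: cone_series_eq[OF C, abs_def])
qed

definition cone_value :: "'v set \<Rightarrow> 'v \<Rightarrow> complex \<Rightarrow> complex" where
  "cone_value C m q = (\<Sum>J | J \<in> triang \<and> J \<subseteq> C. simplex_fun J m q)"

lemma The_rational_value:
  assumes C: "C \<in> \<Sigma>" and m: "m \<in> dual_lattice N" and q: "q \<noteq> 0" "norm q < radius"
  shows "(THE v. is_rational_value N (cone_series N deg C) (monomial_at q m) v) = cone_value C m q"
proof -
  interpret torus_point N "monomial_at q m" by (rule torus_point_monomial[OF m q(1)])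
  show ?thesis
    using rational_value_cone_series[OF assms] is_rational_value_unique[of N "monomial_at q m", OF \<xi>_add]
    unfolding cone_value_def by (intro the_equality) blast+
qed

text \<open>The function inside \<open>cone_fun\<close> agrees with \<open>cone_value\<close> on a
  punctured neighbourhood of 0. Hence both have the same limits at 0, and so the same
  \<open>Lim\<close>, even before a limit is known to exist.\<close>

lemma cone_fun_eq:
  assumes C: "C \<in> \<Sigma>" and m: "m \<in> dual_lattice N" and q: "norm q < radius"
  shows "cone_fun N deg C q m = (if q = 0 then Lim (at 0) (cone_value C m) else cone_value C m q)"
proof -
  let ?f = "\<lambda>t. THE v. is_rational_value N (cone_series N deg C) (monomial_at t m) v"
  have "eventually (\<lambda>t. ?f t = cone_value C m t) (at 0)"
    unfolding eventually_at using The_rational_value[OF C m] radius(1)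
    by (intro exI[of _ radius]) auto
  then have "(?f \<longlongrightarrow> l) (at 0) \<longleftrightarrow> (cone_value C m \<longlongrightarrow> l) (at 0)" for l
    by (rule tendsto_cong)
  then have "Lim (at 0) ?f = Lim (at 0) (cone_value C m)"
    by (simp add: Topological_Spaces.Lim_def)
  then show ?thesis using The_rational_value[OF C m] q by (simp add: cone_fun_def Let_def)
qed

text \<open>After exchanging the sums, \<open>simplex_fun J\<close> has as coefficient the sum of
  the signs of codimension over all cones containing \<open>J\<close>, which
  \<open>fan_euler_star\<close> evaluates to 1.\<close>

lemma sum_cone_value:
  "(\<Sum>C\<in>\<Sigma>. (- 1) ^ (r - dim C) * cone_value C m q) = (\<Sum>J\<in>triang. simplex_fun J m q)"
proof -
  have dimC: "dim C \<le> r" if "C \<in> \<Sigma>" for C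
    using dim_subset[OF cone_subset_V[OF that]] dim_span_N by simp
  have "\<exists>S. finite S \<and> (\<forall>x. x \<in> C \<longleftrightarrow> x \<in> span N \<and> (\<forall>m\<in>S. 0 \<le> m \<bullet> x))" if C: "C \<in> \<Sigma>" for C
  proof -
    obtain S where S: "finite S" "S \<subseteq> dual_lattice N" "C = {x \<in> span N. \<forall>m\<in>S. 0 \<le> m \<bullet> x}"
      using conjunct1[OF rational[OF C, unfolded rational_polyhedral_cone_def]]
      by (elim exE conjE) (rule that)
    have "\<forall>x. x \<in> C \<longleftrightarrow> x \<in> span N \<and> (\<forall>m\<in>S. 0 \<le> m \<bullet> x)"
      by (subst S(3)) simp
    with S(1) show ?thesis by blast
  qed
  then obtain S where S: "\<And>C. C \<in> \<Sigma> \<Longrightarrow> finite (S C)"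
    "\<And>C x. C \<in> \<Sigma> \<Longrightarrow> x \<in> C \<longleftrightarrow> x \<in> span N \<and> (\<forall>m\<in>S C. 0 \<le> m \<bullet> x)"
    by metis
  have coeff: "(\<Sum>C | C \<in> \<Sigma> \<and> J \<subseteq> C. (- 1) ^ (r - dim C)) = (1 :: complex)" if J: "J \<in> triang" for J
  proof -
    have "(\<Sum>C | C \<in> \<Sigma> \<and> J \<subseteq> C. (- 1) ^ dim C) = (- 1 :: int) ^ dim (span N)"
    proof (rule fan_euler_star[OF J])
      show "finite (\<Union>C\<in>\<Sigma>. S C)" using finite_fan S(1) by blast
      show "y \<in> C" if C: "C \<in> \<Sigma>" "x \<in> C" "y \<in> span N"
        and sg: "\<And>s. s \<in> (\<Union>C\<in>\<Sigma>. S C) \<Longrightarrow> sgn (s \<bullet> x) = sgn (s \<bullet> y)" for C x y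
      proof -
        have "0 \<le> s \<bullet> y" if "s \<in> S C" for s
        proof -
          have "0 \<le> s \<bullet> x" using C(2) S(2)[OF C(1)] that by blast
          moreover have "sgn (s \<bullet> x) = sgn (s \<bullet> y)" using sg C(1) that by blast
          ultimately show ?thesis by (metis not_le sgn_less)
        qed
        then show ?thesis using S(2)[OF C(1)] C(3) by blast
      qed
    qed
    then have e: "(\<Sum>C | C \<in> \<Sigma> \<and> J \<subseteq> C. (- 1) ^ dim C) = (- 1 :: int) ^ r" by (simp only: dim_span_N)
    \<comment> \<open>Subtraction of naturals is exact here because
      \<open>dim C \<le> r\<close>.\<close>
    have "(- 1 :: int) ^ (r - dim C) = (- 1) ^ r * (- 1) ^ dim C" if "C \<in> \<Sigma>" for C
      using dimC[OF that] by (auto simp flip: power_add simp: minus_one_power_iff)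
    then have "(\<Sum>C | C \<in> \<Sigma> \<and> J \<subseteq> C. (- 1 :: int) ^ (r - dim C)) =
        (\<Sum>C | C \<in> \<Sigma> \<and> J \<subseteq> C. (- 1) ^ r * (- 1) ^ dim C)"
      by (intro sum.cong) auto
    also have "\<dots> = (- 1) ^ r * (- 1) ^ r" by (simp only: sum_distrib_left[symmetric] e)
    also have "\<dots> = 1" by (simp flip: power_add)
    finally have "complex_of_int (\<Sum>C | C \<in> \<Sigma> \<and> J \<subseteq> C. (- 1) ^ (r - dim C)) = 1" by simp
    then show ?thesis by simp
  qed
  have "(\<Sum>C\<in>\<Sigma>. (- 1) ^ (r - dim C) * cone_value C m q) =
      (\<Sum>C\<in>\<Sigma>. \<Sum>J | J \<in> triang \<and> J \<subseteq> C. (- 1) ^ (r - dim C) * simplex_fun J m q)"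
    by (simp add: cone_value_def sum_distrib_left)
  also have "\<dots> = (\<Sum>J\<in>triang. \<Sum>C | C \<in> \<Sigma> \<and> J \<subseteq> C. (- 1) ^ (r - dim C) * simplex_fun J m q)"
    by (rule sum.swap_restrict[OF finite_fan finite_triang])
  also have "\<dots> = (\<Sum>J\<in>triang. simplex_fun J m q)"
    by (intro sum.cong) (simp_all add: coeff flip: sum_distrib_right)
  finally show ?thesis .
qed

end

section \<open>Decay in the direction of \<open>m\<close>\<close>

text \<open>By Cauchy-Schwarz a direction close enough to \<open>u\<close> keeps at least half of
  the pairing of \<open>u\<close> with \<open>j\<close>; multiplication by \<open>norm m\<close>
  turns this into linear growth.\<close>

lemma direction_bound:
  fixes j u :: "'v::euclidean_space"
  assumes "0 < u \<bullet> j"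
  shows "\<exists>\<eta>>0. \<exists>\<delta>>0. \<forall>m. m \<noteq> 0 \<longrightarrow> norm (m /\<^sub>R norm m - u) < \<eta> \<longrightarrow> \<delta> * norm m \<le> m \<bullet> j"
proof (intro exI conjI allI impI)
  let ?\<eta> = "(u \<bullet> j) / (2 * (norm j + 1))"
  show pos: "0 < ?\<eta>" and "0 < (u \<bullet> j) / 2" using assms by (auto intro!: divide_pos_pos add_nonneg_pos)
  fix m :: 'v assume m: "m \<noteq> 0" "norm (m /\<^sub>R norm m - u) < ?\<eta>"
  have "\<bar>(m /\<^sub>R norm m - u) \<bullet> j\<bar> \<le> norm (m /\<^sub>R norm m - u) * norm j" by (rule Cauchy_Schwarz_ineq2)
  also have "\<dots> \<le> ?\<eta> * (norm j + 1)" using m(2) less_imp_le[OF pos] by (intro mult_mono) auto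
  also have "\<dots> = (u \<bullet> j) / 2"
    using norm_ge_zero[of j] by (simp add: field_simps add_nonneg_eq_0_iff)
  finally have "\<bar>(m /\<^sub>R norm m - u) \<bullet> j\<bar> \<le> (u \<bullet> j) / 2" .
  then have "(u \<bullet> j) / 2 \<le> (m /\<^sub>R norm m) \<bullet> j" unfolding inner_diff_left by linarith
  then have "(u \<bullet> j) / 2 * norm m \<le> (m /\<^sub>R norm m) \<bullet> j * norm m" by (intro mult_right_mono) auto
  also have "\<dots> = m \<bullet> j" using m(1) by simp
  finally show "(u \<bullet> j) / 2 * norm m \<le> m \<bullet> j" .
qed

context toric begin

text \<open>Exponential decay in \<open>norm m\<close> for all nonzero \<open>m\<close> whose
  direction is near \<open>u\<close>, with constants uniform in \<open>q\<close>. The point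
  \<open>q = 0\<close> is left out, because the terms have a value there only by
  continuation.\<close>

definition small :: "'v \<Rightarrow> ('v \<Rightarrow> complex \<Rightarrow> complex) \<Rightarrow> bool" where
  "small u f \<longleftrightarrow> (\<exists>\<eta>>0. \<exists>\<delta>>0. \<exists>K. \<forall>m\<in>dual_lattice N. m \<noteq> 0 \<longrightarrow> norm (m /\<^sub>R norm m - u) < \<eta> \<longrightarrow>
     (\<forall>q. q \<noteq> 0 \<longrightarrow> norm q < radius \<longrightarrow> norm (f m q) \<le> K * norm q powr (\<delta> * norm m)))"

definition bounded_fun :: "('v \<Rightarrow> complex \<Rightarrow> complex) \<Rightarrow> bool" where
  "bounded_fun f \<longleftrightarrow> (\<exists>K. \<forall>m\<in>dual_lattice N. \<forall>q. q \<noteq> 0 \<longrightarrow> norm q < radius \<longrightarrow> norm (f m q) \<le> K)"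

lemma smallI:
  assumes "\<eta> > 0" "\<delta> > 0"
    "\<And>m q. m \<in> dual_lattice N \<Longrightarrow> m \<noteq> 0 \<Longrightarrow> norm (m /\<^sub>R norm m - u) < \<eta> \<Longrightarrow> q \<noteq> 0 \<Longrightarrow>
      norm q < radius \<Longrightarrow> norm (f m q) \<le> K * norm q powr (\<delta> * norm m)"
  shows "small u f"
  unfolding small_def using assms by blast

lemma smallE:
  assumes "small u f"
  obtains \<eta> \<delta> K where "\<eta> > 0" "\<delta> > 0" "K \<ge> 0"
    "\<And>m q. m \<in> dual_lattice N \<Longrightarrow> m \<noteq> 0 \<Longrightarrow> norm (m /\<^sub>R norm m - u) < \<eta> \<Longrightarrow> q \<noteq> 0 \<Longrightarrow>
      norm q < radius \<Longrightarrow> norm (f m q) \<le> K * norm q powr (\<delta> * norm m)"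
proof -
  obtain \<eta> \<delta> K where *: "\<eta> > 0" "\<delta> > 0"
    "\<forall>m\<in>dual_lattice N. m \<noteq> 0 \<longrightarrow> norm (m /\<^sub>R norm m - u) < \<eta> \<longrightarrow>
     (\<forall>q. q \<noteq> 0 \<longrightarrow> norm q < radius \<longrightarrow> norm (f m q) \<le> K * norm q powr (\<delta> * norm m))"
    using assms unfolding small_def by blast
  show ?thesis
  proof (rule that[OF *(1,2), of "\<bar>K\<bar>"])
    fix m and q :: complex assume "m \<in> dual_lattice N" "m \<noteq> 0" "norm (m /\<^sub>R norm m - u) < \<eta>" "q \<noteq> 0" "norm q < radius"
    then have "norm (f m q) \<le> K * norm q powr (\<delta> * norm m)" using *(3) by blast
    also have "\<dots> \<le> \<bar>K\<bar> * norm q powr (\<delta> * norm m)" by (intro mult_right_mono) auto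
    finally show "norm (f m q) \<le> \<bar>K\<bar> * norm q powr (\<delta> * norm m)" .
  qed simp
qed

lemma small_zero: "small u (\<lambda>m q. 0)"
  by (rule smallI[of 1 1 _ _ 0]) auto

lemma small_add:
  assumes "small u f" "small u g"
  shows "small u (\<lambda>m q. f m q + g m q)"
proof -
  obtain \<eta> \<delta> K where f: "\<eta> > 0" "\<delta> > 0" "K \<ge> 0"
    "\<And>m q. m \<in> dual_lattice N \<Longrightarrow> m \<noteq> 0 \<Longrightarrow> norm (m /\<^sub>R norm m - u) < \<eta> \<Longrightarrow> q \<noteq> 0 \<Longrightarrow>
      norm q < radius \<Longrightarrow> norm (f m q) \<le> K * norm q powr (\<delta> * norm m)"
    by (rule smallE[OF assms(1)]) blast
  obtain \<eta>' \<delta>' K' where g: "\<eta>' > 0" "\<delta>' > 0" "K' \<ge> 0"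
    "\<And>m q. m \<in> dual_lattice N \<Longrightarrow> m \<noteq> 0 \<Longrightarrow> norm (m /\<^sub>R norm m - u) < \<eta>' \<Longrightarrow> q \<noteq> 0 \<Longrightarrow>
      norm q < radius \<Longrightarrow> norm (g m q) \<le> K' * norm q powr (\<delta>' * norm m)"
    by (rule smallE[OF assms(2)]) blast
  show ?thesis
  proof (rule smallI[of "min \<eta> \<eta>'" "min \<delta> \<delta>'" _ _ "K + K'"])
    fix m and q :: complex assume m: "m \<in> dual_lattice N" "m \<noteq> 0" "norm (m /\<^sub>R norm m - u) < min \<eta> \<eta>'"
      and q: "q \<noteq> 0" "norm q < radius"
    have q1: "norm q \<le> 1" using q radius(2) by simp
    have "norm q powr (\<delta> * norm m) \<le> norm q powr (min \<delta> \<delta>' * norm m)"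
      "norm q powr (\<delta>' * norm m) \<le> norm q powr (min \<delta> \<delta>' * norm m)"
      using q1 by (auto intro!: powr_mono' mult_right_mono)
    then have "K * norm q powr (\<delta> * norm m) \<le> K * norm q powr (min \<delta> \<delta>' * norm m)"
      "K' * norm q powr (\<delta>' * norm m) \<le> K' * norm q powr (min \<delta> \<delta>' * norm m)"
      using f(3) g(3) by (auto intro!: mult_left_mono)
    then have "norm (f m q) \<le> K * norm q powr (min \<delta> \<delta>' * norm m)"
      "norm (g m q) \<le> K' * norm q powr (min \<delta> \<delta>' * norm m)"
      using f(4)[OF m(1,2) _ q] g(4)[OF m(1,2) _ q] m(3) by (auto intro: order_trans)
    then show "norm (f m q + g m q) \<le> (K + K') * norm q powr (min \<delta> \<delta>' * norm m)"
      using norm_triangle_ineq[of "f m q" "g m q"] by (simp add: distrib_right)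
  qed (use f g in auto)
qed

lemma small_sum: "(\<And>i. i \<in> I \<Longrightarrow> small u (f i)) \<Longrightarrow> small u (\<lambda>m q. \<Sum>i\<in>I. f i m q)"
  by (induction I rule: infinite_finite_induct) (auto intro: small_zero small_add)

lemma small_mult:
  assumes "bounded_fun g" "small u f"
  shows "small u (\<lambda>m q. g m q * f m q)"
proof -
  obtain \<eta> \<delta> K where f: "\<eta> > 0" "\<delta> > 0" "K \<ge> 0"
    "\<And>m q. m \<in> dual_lattice N \<Longrightarrow> m \<noteq> 0 \<Longrightarrow> norm (m /\<^sub>R norm m - u) < \<eta> \<Longrightarrow> q \<noteq> 0 \<Longrightarrow>
      norm q < radius \<Longrightarrow> norm (f m q) \<le> K * norm q powr (\<delta> * norm m)"
    by (rule smallE[OF assms(2)]) blast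
  obtain G where g: "\<And>m q. m \<in> dual_lattice N \<Longrightarrow> q \<noteq> 0 \<Longrightarrow> norm q < radius \<Longrightarrow> norm (g m q) \<le> G"
    using assms(1) unfolding bounded_fun_def by blast
  show ?thesis
  proof (rule smallI[OF f(1,2), of _ _ "\<bar>G\<bar> * K"])
    fix m and q :: complex assume m: "m \<in> dual_lattice N" "m \<noteq> 0" "norm (m /\<^sub>R norm m - u) < \<eta>"
      and q: "q \<noteq> 0" "norm q < radius"
    have "norm (g m q) \<le> \<bar>G\<bar>" using g[OF m(1) q] by simp
    then have "norm (g m q) * norm (f m q) \<le> \<bar>G\<bar> * (K * norm q powr (\<delta> * norm m))"
      using f(4)[OF m q] by (intro mult_mono) auto
    then show "norm (g m q * f m q) \<le> \<bar>G\<bar> * K * norm q powr (\<delta> * norm m)"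
      by (simp add: norm_mult mult.assoc)
  qed
qed

lemma bounded_fun_const: "bounded_fun (\<lambda>_ _. c)"
  unfolding bounded_fun_def by blast

lemma bounded_fun_add:
  assumes "bounded_fun f" "bounded_fun g"
  shows "bounded_fun (\<lambda>m q. f m q + g m q)"
proof -
  obtain F where f: "\<And>m q. m \<in> dual_lattice N \<Longrightarrow> q \<noteq> 0 \<Longrightarrow> norm q < radius \<Longrightarrow> norm (f m q) \<le> F"
    using assms(1) unfolding bounded_fun_def by blast
  obtain G where g: "\<And>m q. m \<in> dual_lattice N \<Longrightarrow> q \<noteq> 0 \<Longrightarrow> norm q < radius \<Longrightarrow> norm (g m q) \<le> G"
    using assms(2) unfolding bounded_fun_def by blast
  have "norm (f m q + g m q) \<le> F + G" if "m \<in> dual_lattice N" "q \<noteq> 0" "norm q < radius" for m q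
    using f[OF that] g[OF that] norm_triangle_ineq[of "f m q" "g m q"] by linarith
  then show ?thesis unfolding bounded_fun_def by blast
qed

lemma bounded_fun_sum: "(\<And>i. i \<in> I \<Longrightarrow> bounded_fun (f i)) \<Longrightarrow> bounded_fun (\<lambda>m q. \<Sum>i\<in>I. f i m q)"
  by (induction I rule: infinite_finite_induct) (auto intro: bounded_fun_const bounded_fun_add)

section \<open>Estimates for the terms of a simplex\<close>

lemma pairing_int: "m \<in> dual_lattice N \<Longrightarrow> n \<in> N \<Longrightarrow> \<exists>k. m \<bullet> n = of_int k"
  using dual_integral by (metis Ints_cases)

definition ray_const :: "'v \<Rightarrow> real" where
  "ray_const d = 2 + 2 / norm (character d) + 1 / norm (1 - character d)"

lemma ray_const_nonneg: "0 \<le> ray_const d"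
  by (simp add: ray_const_def)

lemma ray_factor_bound:
  assumes "d \<in> D" "m \<in> dual_lattice N" "q \<noteq> 0" "norm q < radius" "0 \<le> a" "a \<le> 1"
  shows "norm q powr (a * (m \<bullet> d)) / norm (1 - character d * q powi \<lfloor>m \<bullet> d\<rfloor>) \<le>
    ray_const d * norm q powr (if m \<bullet> d \<ge> 0 then a * (m \<bullet> d) else (a - 1) * (m \<bullet> d))"
proof -
  obtain k where k: "m \<bullet> d = of_int k" using pairing_int[OF assms(2)] assms(1) D_N by blast
  show ?thesis
    using geometric_factor_bound[of "character d" q a k] radius(2) radius(3,4)[of d q] assms
    unfolding ray_const_def k by simp
qed

text \<open>Expanding \<open>v\<close> in the rays of \<open>J\<close> distributes the power of
  \<open>q\<close> in the numerator over the factors of the denominator. Each quotient is bounded by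
  \<open>ray_factor_bound\<close>, and the exponents add up.\<close>

lemma simplex_term_bound:
  assumes J: "J \<in> triang" and v: "v \<in> N" "v = (\<Sum>j\<in>J. a j *\<^sub>R j)" "\<And>j. j \<in> J \<Longrightarrow> 0 \<le> a j \<and> a j \<le> 1"
    and m: "m \<in> dual_lattice N" and q: "q \<noteq> 0" "norm q < radius"
  shows "norm (simplex_term J v m q) \<le> norm (character v) * (\<Prod>j\<in>J. ray_const j) *
    norm q powr (\<Sum>j\<in>J. if m \<bullet> j \<ge> 0 then a j * (m \<bullet> j) else (a j - 1) * (m \<bullet> j))"
proof -
  obtain k where k: "m \<bullet> v = of_int k" using pairing_int[OF m v(1)] by blast
  have "norm (q powi \<lfloor>m \<bullet> v\<rfloor>) = norm q powr (m \<bullet> v)"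
    unfolding k using norm_powi[OF q(1)] by simp
  also have "norm q powr (m \<bullet> v) = norm q powr (\<Sum>j\<in>J. a j * (m \<bullet> j))"
    by (simp add: v(2) inner_sum_right)
  also have "\<dots> = (\<Prod>j\<in>J. norm q powr (a j * (m \<bullet> j)))" using q(1) by (simp add: powr_sum)
  finally have "norm (simplex_term J v m q) = norm (character v) *
      (\<Prod>j\<in>J. norm q powr (a j * (m \<bullet> j)) / norm (1 - character j * q powi \<lfloor>m \<bullet> j\<rfloor>))"
    by (simp add: simplex_term_def norm_mult norm_divide prod_dividef flip: prod_norm)
  also have "\<dots> \<le> norm (character v) * (\<Prod>j\<in>J. ray_const j *
      norm q powr (if m \<bullet> j \<ge> 0 then a j * (m \<bullet> j) else (a j - 1) * (m \<bullet> j)))"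
  proof (intro mult_left_mono prod_mono conjI)
    fix j assume j: "j \<in> J"
    show "norm q powr (a j * (m \<bullet> j)) / norm (1 - character j * q powi \<lfloor>m \<bullet> j\<rfloor>) \<le>
        ray_const j * norm q powr (if m \<bullet> j \<ge> 0 then a j * (m \<bullet> j) else (a j - 1) * (m \<bullet> j))"
      using j triang_sub[OF J] v(3)[OF j] by (intro ray_factor_bound m q) auto
  qed auto
  also have "\<dots> = norm (character v) * (\<Prod>j\<in>J. ray_const j) *
    norm q powr (\<Sum>j\<in>J. if m \<bullet> j \<ge> 0 then a j * (m \<bullet> j) else (a j - 1) * (m \<bullet> j))"
    using q(1) by (simp add: powr_sum prod.distrib)
  finally show ?thesis .
qed

lemma excess_nonneg:
  "0 \<le> a \<Longrightarrow> a \<le> (1::real) \<Longrightarrow> 0 \<le> (if x \<ge> 0 then a * x else (a - 1) * x)"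
  by (auto intro: mult_nonpos_nonpos)

lemma bounded_fun_simplex_term:
  assumes J: "J \<in> triang" and v: "v \<in> box N J"
  shows "bounded_fun (simplex_term J v)"
proof -
  obtain a where a: "v = (\<Sum>j\<in>J. a j *\<^sub>R j)" "\<And>j. j \<in> J \<Longrightarrow> 0 < a j \<and> a j \<le> 1" and vN: "v \<in> N"
    using v unfolding box_def by blast
  have "norm (simplex_term J v m q) \<le> norm (character v) * (\<Prod>j\<in>J. ray_const j)"
    if m: "m \<in> dual_lattice N" and q: "q \<noteq> 0" "norm q < radius" for m q
  proof -
    let ?e = "\<Sum>j\<in>J. if m \<bullet> j \<ge> 0 then a j * (m \<bullet> j) else (a j - 1) * (m \<bullet> j)"
    have "0 \<le> ?e" using a(2) by (intro sum_nonneg excess_nonneg) (auto simp: less_imp_le)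
    then have "norm q powr ?e \<le> norm q powr 0" using q radius(2) by (intro powr_mono') auto
    then have "norm q powr ?e \<le> 1" using q(1) by simp
    then have le: "norm (character v) * (\<Prod>j\<in>J. ray_const j) * norm q powr ?e \<le>
        norm (character v) * (\<Prod>j\<in>J. ray_const j) * 1"
      by (intro mult_left_mono mult_nonneg_nonneg prod_nonneg ray_const_nonneg) auto
    have "norm (simplex_term J v m q) \<le> norm (character v) * (\<Prod>j\<in>J. ray_const j) * norm q powr ?e"
      using a(2) by (intro simplex_term_bound[OF J vN a(1) _ m q]) (auto simp: less_imp_le)
    also note le
    finally show ?thesis by (simp only: mult_1_right)
  qed
  then show ?thesis unfolding bounded_fun_def by blast
qed

lemma bounded_fun_simplex_fun: "J \<in> triang \<Longrightarrow> bounded_fun (simplex_fun J)"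
  using bounded_fun_sum[of "box N J" "simplex_term J"] bounded_fun_simplex_term
  by (simp add: simplex_fun_def[abs_def])

text \<open>All summands of the exponent are nonnegative, so a single ray \<open>i\<close> whose
  summand grows linearly in \<open>norm m\<close> suffices. By \<open>direction_bound\<close>,
  applied to \<open>i\<close> or to \<open>- i\<close>, this happens in the two stated
  cases.\<close>

lemma small_simplex_term:
  assumes J: "J \<in> triang" and v: "v \<in> N" "v = (\<Sum>j\<in>J. a j *\<^sub>R j)" "\<And>j. j \<in> J \<Longrightarrow> 0 \<le> a j \<and> a j \<le> 1"
    and i: "i \<in> J" "0 < u \<bullet> i \<and> 0 < a i \<or> u \<bullet> i < 0 \<and> a i < 1"
  shows "small u (simplex_term J v)"
proof -
  have "\<exists>\<eta>>0. \<exists>\<delta>>0. \<forall>m. m \<noteq> 0 \<longrightarrow> norm (m /\<^sub>R norm m - u) < \<eta> \<longrightarrow>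
      \<delta> * norm m \<le> (if m \<bullet> i \<ge> 0 then a i * (m \<bullet> i) else (a i - 1) * (m \<bullet> i))"
  proof (cases "0 < u \<bullet> i")
    case True
    then have ai: "a i > 0" using i(2) by simp
    obtain \<eta> \<delta> where e: "\<eta> > 0" "\<delta> > 0"
      "\<And>m. m \<noteq> 0 \<Longrightarrow> norm (m /\<^sub>R norm m - u) < \<eta> \<Longrightarrow> \<delta> * norm m \<le> m \<bullet> i"
      using direction_bound[OF True] by blast
    have "a i * \<delta> * norm m \<le> (if m \<bullet> i \<ge> 0 then a i * (m \<bullet> i) else (a i - 1) * (m \<bullet> i))"
      if m: "m \<noteq> 0" "norm (m /\<^sub>R norm m - u) < \<eta>" for m
    proof -
      have "0 \<le> \<delta> * norm m" using e(2) by simp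
      then have "0 \<le> m \<bullet> i" using e(3)[OF m] by linarith
      then show ?thesis using e(3)[OF m] ai by simp
    qed
    then show ?thesis using e(1,2) ai by (intro exI[of _ \<eta>] conjI exI[of _ "a i * \<delta>"]) auto
  next
    case False
    then have ai: "a i < 1" "0 < u \<bullet> (- i)" using i(2) by auto
    obtain \<eta> \<delta> where e: "\<eta> > 0" "\<delta> > 0"
      "\<And>m. m \<noteq> 0 \<Longrightarrow> norm (m /\<^sub>R norm m - u) < \<eta> \<Longrightarrow> \<delta> * norm m \<le> m \<bullet> (- i)"
      using direction_bound[OF ai(2)] by blast
    have "(1 - a i) * \<delta> * norm m \<le> (if m \<bullet> i \<ge> 0 then a i * (m \<bullet> i) else (a i - 1) * (m \<bullet> i))"
      if m: "m \<noteq> 0" "norm (m /\<^sub>R norm m - u) < \<eta>" for m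
    proof -
      have "0 < \<delta> * norm m" using e(2) m(1) by simp
      then have "m \<bullet> i < 0" using e(3)[OF m] by simp
      moreover have "(1 - a i) * (\<delta> * norm m) \<le> (1 - a i) * (m \<bullet> (- i))"
        using e(3)[OF m] ai(1) by (intro mult_left_mono) auto
      ultimately show ?thesis by (simp add: algebra_simps)
    qed
    then show ?thesis using e(1,2) ai(1) by (intro exI[of _ \<eta>] conjI exI[of _ "(1 - a i) * \<delta>"]) auto
  qed
  then obtain \<eta> \<delta> where e: "\<eta> > 0" "\<delta> > 0" "\<And>m. m \<noteq> 0 \<Longrightarrow> norm (m /\<^sub>R norm m - u) < \<eta> \<Longrightarrow>
      \<delta> * norm m \<le> (if m \<bullet> i \<ge> 0 then a i * (m \<bullet> i) else (a i - 1) * (m \<bullet> i))"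
    by blast
  show ?thesis
  proof (rule smallI[OF e(1,2), of _ _ "norm (character v) * (\<Prod>j\<in>J. ray_const j)"])
    fix m and q :: complex assume m: "m \<in> dual_lattice N" "m \<noteq> 0" "norm (m /\<^sub>R norm m - u) < \<eta>"
      and q: "q \<noteq> 0" "norm q < radius"
    let ?e = "\<lambda>j. if m \<bullet> j \<ge> 0 then a j * (m \<bullet> j) else (a j - 1) * (m \<bullet> j)"
    have "\<delta> * norm m \<le> ?e i" by (rule e(3)[OF m(2,3)])
    also have "\<dots> \<le> (\<Sum>j\<in>J. ?e j)"
    proof (rule member_le_sum[OF i(1) _ triang_finite[OF J]])
      show "0 \<le> ?e j" if "j \<in> J - {i}" for j using v(3)[of j] that by (intro excess_nonneg) auto
    qed
    finally have "norm q powr (\<Sum>j\<in>J. ?e j) \<le> norm q powr (\<delta> * norm m)"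
      using q radius(2) by (intro powr_mono') auto
    then have "norm (character v) * (\<Prod>j\<in>J. ray_const j) * norm q powr (\<Sum>j\<in>J. ?e j) \<le>
        norm (character v) * (\<Prod>j\<in>J. ray_const j) * norm q powr (\<delta> * norm m)"
      by (intro mult_left_mono mult_nonneg_nonneg prod_nonneg ray_const_nonneg) auto
    with simplex_term_bound[OF J v m(1) q]
    show "norm (simplex_term J v m q) \<le> norm (character v) * (\<Prod>j\<in>J. ray_const j) * norm q powr (\<delta> * norm m)"
      by linarith
  qed
qed

text \<open>With \<open>t = character j * q powi \<lfloor>m \<bullet> j\<rfloor>\<close> this is
  \<open>t / (1 - t)\<close>, the factor that a ray with box coefficient 1 contributes. It tends to
  -1 when \<open>m \<bullet> j\<close> tends to minus infinity, which is the origin of the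
  signs.\<close>

definition flip_factor :: "'v \<Rightarrow> 'v \<Rightarrow> complex \<Rightarrow> complex" where
  "flip_factor j m q = character j * q powi \<lfloor>m \<bullet> j\<rfloor> / (1 - character j * q powi \<lfloor>m \<bullet> j\<rfloor>)"

lemma bounded_fun_flip_factor:
  assumes "j \<in> D" shows "bounded_fun (flip_factor j)"
proof -
  have "norm (flip_factor j m q) \<le> norm (character j) * ray_const j"
    if m: "m \<in> dual_lattice N" and q: "q \<noteq> 0" "norm q < radius" for m q
  proof -
    let ?e = "if m \<bullet> j \<ge> 0 then 1 * (m \<bullet> j) else (1 - 1) * (m \<bullet> j)"
    have "norm q powr ?e \<le> norm q powr 0" using q radius(2) by (intro powr_mono') auto
    then have "norm q powr ?e \<le> 1" using q(1) by simp
    then have "ray_const j * norm q powr ?e \<le> ray_const j * 1"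
      by (intro mult_left_mono ray_const_nonneg)
    then have "norm q powr (m \<bullet> j) / norm (1 - character j * q powi \<lfloor>m \<bullet> j\<rfloor>) \<le> ray_const j"
      using ray_factor_bound[OF assms m q, of 1] by simp
    then have "norm (character j) * (norm q powr (m \<bullet> j) / norm (1 - character j * q powi \<lfloor>m \<bullet> j\<rfloor>)) \<le>
        norm (character j) * ray_const j" by (intro mult_left_mono) auto
    moreover obtain k where k: "m \<bullet> j = of_int k" using pairing_int[OF m] assms D_N by blast
    have "norm (q powi \<lfloor>m \<bullet> j\<rfloor>) = norm q powr (m \<bullet> j)"
      unfolding k using norm_powi[OF q(1)] by simp
    ultimately show ?thesis by (simp add: flip_factor_def norm_mult norm_divide)
  qed
  then show ?thesis unfolding bounded_fun_def by blast
qed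

text \<open>\<open>t / (1 - t) + 1 = 1 / (1 - t)\<close> is the quotient of
  \<open>ray_factor_bound\<close> for \<open>a = 0\<close>, whose exponent is
  \<open>- (m \<bullet> j)\<close> when \<open>m \<bullet> j\<close> is negative.\<close>

lemma small_flip_factor:
  assumes j: "j \<in> D" "u \<bullet> j < 0"
  shows "small u (\<lambda>m q. flip_factor j m q + 1)"
proof -
  have "0 < u \<bullet> (- j)" using j(2) by simp
  then obtain \<eta> \<delta> where e: "\<eta> > 0" "\<delta> > 0"
    "\<And>m. m \<noteq> 0 \<Longrightarrow> norm (m /\<^sub>R norm m - u) < \<eta> \<Longrightarrow> \<delta> * norm m \<le> m \<bullet> (- j)"
    using direction_bound by blast
  show ?thesis
  proof (rule smallI[OF e(1,2), of _ _ "ray_const j"])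
    fix m and q :: complex assume m: "m \<in> dual_lattice N" "m \<noteq> 0" "norm (m /\<^sub>R norm m - u) < \<eta>"
      and q: "q \<noteq> 0" "norm q < radius"
    have "0 < \<delta> * norm m" using e(2) m(2) by simp
    then have neg: "m \<bullet> j < 0" using e(3)[OF m(2,3)] by simp
    have "flip_factor j m q + 1 = 1 / (1 - character j * q powi \<lfloor>m \<bullet> j\<rfloor>)"
      using denominator_nonzero[OF j(1) q] by (simp add: flip_factor_def divide_simps)
    then have "norm (flip_factor j m q + 1) = 1 / norm (1 - character j * q powi \<lfloor>m \<bullet> j\<rfloor>)"
      by (simp add: norm_divide)
    also have "\<dots> \<le> ray_const j * norm q powr (- (m \<bullet> j))"
      using ray_factor_bound[OF j(1) m(1) q, of 0] neg q(1) by simp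
    also have "\<dots> \<le> ray_const j * norm q powr (\<delta> * norm m)"
      using e(3)[OF m(2,3)] q radius(2) by (intro mult_left_mono powr_mono' ray_const_nonneg) auto
    finally show "norm (flip_factor j m q + 1) \<le> ray_const j * norm q powr (\<delta> * norm m)" .
  qed
qed

text \<open>The factors are exchanged for -1 one at a time; each exchange costs a decaying family
  times a bounded one.\<close>

lemma small_prod_flip_factor:
  assumes "finite S" "S \<subseteq> D" "\<And>j. j \<in> S \<Longrightarrow> u \<bullet> j < 0"
  shows "small u (\<lambda>m q. (\<Prod>j\<in>S. flip_factor j m q) - (- 1) ^ card S)"
  using assms
proof (induction S rule: finite_induct)
  case empty
  show ?case using small_zero by simp
next
  case (insert j S)
  have "(\<lambda>m q. (\<Prod>j\<in>insert j S. flip_factor j m q) - (- 1) ^ card (insert j S)) =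
      (\<lambda>m q. flip_factor j m q * ((\<Prod>j\<in>S. flip_factor j m q) - (- 1) ^ card S)
        + (- 1) ^ card S * (flip_factor j m q + 1))"
    using insert.hyps by (simp add: fun_eq_iff algebra_simps)
  moreover have "small u (\<lambda>m q. flip_factor j m q * ((\<Prod>j\<in>S. flip_factor j m q) - (- 1) ^ card S))"
    using insert by (intro small_mult bounded_fun_flip_factor insert.IH) auto
  moreover have "small u (\<lambda>m q. (- 1) ^ card S * (flip_factor j m q + 1))"
    using insert by (intro small_mult bounded_fun_const small_flip_factor) auto
  ultimately show ?case using small_add by simp
qed

text \<open>Only box points with coefficient 1 at every ray that is negative on \<open>u\<close> have a term that
  survives in the limit, up to sign as a term of the face orthogonal to \<open>u\<close>.\<close>

lemma small_simplex_fun: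
  assumes J: "J \<in> triang"
  shows "small u (\<lambda>m q. simplex_fun J m q - (if \<forall>j\<in>J. u \<bullet> j \<le> 0
    then (- 1) ^ card {j \<in> J. u \<bullet> j < 0} * simplex_fun {j \<in> J. u \<bullet> j = 0} m q else 0))"
proof (cases "\<forall>j\<in>J. u \<bullet> j \<le> 0")
  case False
  then obtain i where i: "i \<in> J" "0 < u \<bullet> i" by (auto simp: not_le)
  \<comment> \<open>Box coefficients are positive, so at a ray \<open>i\<close> with
    \<open>0 < u \<bullet> i\<close> every box point has a growing exponent.\<close>
  have "small u (simplex_term J v)" if v: "v \<in> box N J" for v
  proof -
    obtain a where a: "v = (\<Sum>j\<in>J. a j *\<^sub>R j)" "\<And>j. j \<in> J \<Longrightarrow> 0 < a j \<and> a j \<le> 1" and vN: "v \<in> N"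
      using v unfolding box_def by blast
    show ?thesis
      using a(2) i by (intro small_simplex_term[OF J vN a(1) _ i(1)]) (auto simp: less_imp_le)
  qed
  then have "small u (simplex_fun J)"
    using small_sum[of "box N J" u "simplex_term J"] by (simp add: simplex_fun_def[abs_def])
  then show ?thesis by (simp only: if_not_P[OF False] diff_zero)
next
  case True
  define A where "A = {j \<in> J. u \<bullet> j = 0}"
  define S where "S = {j \<in> J. u \<bullet> j < 0}"
  \<comment> \<open>Adding \<open>w\<close> gives coefficient 1 to every ray negative on
    \<open>u\<close>. It maps the box of \<open>A\<close> onto those points of the box of
    \<open>J\<close> that have coefficient 1 on all of \<open>S\<close>; any other box point has a
    coefficient below 1 at some ray of \<open>S\<close>, and its term decays.\<close>
  define w where "w = (\<Sum>j\<in>S. j)"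
  have fin: "finite J" "finite A" "finite S" using triang_finite[OF J] by (auto simp: A_def S_def)
  have JAS: "J = A \<union> S" "A \<inter> S = {}" using True by (force simp: A_def S_def)+
  have A: "A \<in> triang" by (rule triang_down[OF J]) (auto simp: A_def)
  obtain C where C: "C \<in> \<Sigma>" "J \<subseteq> C" using triang_cone[OF J] by blast
  have SC: "S \<subseteq> C \<inter> N" using C(2) triang_N[OF J] by (auto simp: S_def)
  have wC: "w \<in> C \<inter> N" using SC by (auto simp: w_def intro!: sum_in[OF C(1)] sum_in_N)
  have img: "(\<lambda>v. v + w) ` box N A \<subseteq> box N J"
  proof
    fix x assume "x \<in> (\<lambda>v. v + w) ` box N A"
    then obtain v a where v: "x = v + w" "v \<in> N" "v = (\<Sum>j\<in>A. a j *\<^sub>R j)" "\<And>j. j \<in> A \<Longrightarrow> 0 < a j \<and> a j \<le> 1"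
      unfolding box_def by blast
    define b where "b = (\<lambda>j. if j \<in> A then a j else 1)"
    have "(\<Sum>j\<in>J. b j *\<^sub>R j) = (\<Sum>j\<in>A. b j *\<^sub>R j) + (\<Sum>j\<in>S. b j *\<^sub>R j)"
      unfolding JAS(1) by (rule sum.union_disjoint[OF fin(2,3) JAS(2)])
    also have "(\<Sum>j\<in>A. b j *\<^sub>R j) = v" by (simp add: b_def v(3))
    also have "(\<Sum>j\<in>S. b j *\<^sub>R j) = w"
      unfolding w_def using JAS(2) by (intro sum.cong) (auto simp: b_def)
    finally have "x = (\<Sum>j\<in>J. b j *\<^sub>R j)" using v(1) by simp
    moreover have "x \<in> N" using v(1,2) wC add_in_N by blast
    ultimately show "x \<in> box N J" using v(4) by (intro boxI[of _ _ b]) (auto simp: b_def)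
  qed
  have rest: "small u (simplex_term J v)" if v: "v \<in> box N J - (\<lambda>v. v + w) ` box N A" for v
  proof -
    obtain a where a: "v = (\<Sum>j\<in>J. a j *\<^sub>R j)" "\<And>j. j \<in> J \<Longrightarrow> 0 < a j \<and> a j \<le> 1" and vN: "v \<in> N"
      using v unfolding box_def by blast
    have "\<exists>i\<in>S. a i < 1"
    proof (rule ccontr)
      assume "\<not> ?thesis"
      then have one: "a j = 1" if "j \<in> S" for j using a(2)[of j] that JAS(1) by force
      have "v = (\<Sum>j\<in>A. a j *\<^sub>R j) + (\<Sum>j\<in>S. a j *\<^sub>R j)"
        unfolding a(1) JAS(1) by (rule sum.union_disjoint[OF fin(2,3) JAS(2)])
      also have "(\<Sum>j\<in>S. a j *\<^sub>R j) = w" unfolding w_def using one by (intro sum.cong) auto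
      finally have "v - w = (\<Sum>j\<in>A. a j *\<^sub>R j)" by simp
      moreover have "v - w \<in> N" using vN wC diff_in_N by blast
      ultimately have "v - w \<in> box N A" using a(2) JAS(1) by (intro boxI[of _ _ a]) auto
      then have "v - w + w \<in> (\<lambda>v. v + w) ` box N A" by (rule imageI)
      then show False using v by simp
    qed
    then obtain i where i: "i \<in> S" "a i < 1" by blast
    then have "i \<in> J" "u \<bullet> i < 0" by (auto simp: S_def)
    then show ?thesis
      using a(2) i(2) by (intro small_simplex_term[OF J vN a(1)]) (auto simp: less_imp_le)
  qed
  have main: "small u (\<lambda>m q. simplex_term J (v + w) m q - (- 1) ^ card S * simplex_term A v m q)"
    if v: "v \<in> box N A" for v
  proof -
    have vC: "v \<in> C \<inter> N" using box_in_cone[OF A C(1) _ v] C(2) JAS(1) by blast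
    \<comment> \<open>The numerator gains one factor for each ray of \<open>S\<close>, which
      combines with the denominator at that ray to a flip factor. The character may be split because
      \<open>v\<close> and \<open>w\<close> lie in the common cone \<open>C\<close>.\<close>
    have split: "simplex_term J (v + w) m q = simplex_term A v m q * (\<Prod>j\<in>S. flip_factor j m q)"
      if m: "m \<in> dual_lattice N" and q: "q \<noteq> 0" for m q
    proof -
      have "q powi \<lfloor>m \<bullet> (\<Sum>j\<in>I. j)\<rfloor> = (\<Prod>j\<in>I. q powi \<lfloor>m \<bullet> j\<rfloor>)" if "I \<subseteq> N" for I
        using that
      proof (induction I rule: infinite_finite_induct)
        case (insert j I)
        then have "j \<in> N" "(\<Sum>j\<in>I. j) \<in> N" by (auto intro!: sum_in_N)
        then show ?case using insert q by (simp add: floor_pairing_add[OF m] power_int_add)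
      qed simp_all
      then have qw: "q powi \<lfloor>m \<bullet> w\<rfloor> = (\<Prod>j\<in>S. q powi \<lfloor>m \<bullet> j\<rfloor>)" using SC by (auto simp: w_def)
      have "character (v + w) = character v * (\<Prod>j\<in>S. character j)"
        using character_add[OF C(1) vC wC] character_sum[OF C(1) SC] by (simp add: w_def)
      moreover have "q powi \<lfloor>m \<bullet> (v + w)\<rfloor> = q powi \<lfloor>m \<bullet> v\<rfloor> * (\<Prod>j\<in>S. q powi \<lfloor>m \<bullet> j\<rfloor>)"
        using vC wC q by (simp add: floor_pairing_add[OF m] power_int_add qw)
      moreover have "(\<Prod>j\<in>J. 1 - character j * q powi \<lfloor>m \<bullet> j\<rfloor>) =
          (\<Prod>j\<in>A. 1 - character j * q powi \<lfloor>m \<bullet> j\<rfloor>) * (\<Prod>j\<in>S. 1 - character j * q powi \<lfloor>m \<bullet> j\<rfloor>)"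
        unfolding JAS(1) by (rule prod.union_disjoint[OF fin(2,3) JAS(2)])
      ultimately show ?thesis
        by (simp add: simplex_term_def flip_factor_def prod_dividef prod.distrib mult_ac)
    qed
    have "small u (\<lambda>m q. simplex_term A v m q * ((\<Prod>j\<in>S. flip_factor j m q) - (- 1) ^ card S))"
      using triang_sub[OF J] by (intro small_mult bounded_fun_simplex_term[OF A v] small_prod_flip_factor fin)
        (auto simp: S_def)
    then show ?thesis unfolding small_def using split by (simp add: algebra_simps)
  qed
  have "simplex_fun J m q - (- 1) ^ card S * simplex_fun A m q =
      (\<Sum>v\<in>box N J - (\<lambda>v. v + w) ` box N A. simplex_term J v m q) +
      (\<Sum>v\<in>box N A. simplex_term J (v + w) m q - (- 1) ^ card S * simplex_term A v m q)" for m q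
  proof -
    have "simplex_fun J m q = (\<Sum>v\<in>box N J - (\<lambda>v. v + w) ` box N A. simplex_term J v m q) +
        (\<Sum>v\<in>(\<lambda>v. v + w) ` box N A. simplex_term J v m q)"
      unfolding simplex_fun_def by (rule sum.subset_diff[OF img finite_box])
    also have "(\<Sum>v\<in>(\<lambda>v. v + w) ` box N A. simplex_term J v m q) = (\<Sum>v\<in>box N A. simplex_term J (v + w) m q)"
      by (subst sum.reindex) (auto simp: inj_on_def)
    finally show ?thesis by (simp add: simplex_fun_def sum_subtractf sum_distrib_left)
  qed
  moreover have "small u (\<lambda>m q. (\<Sum>v\<in>box N J - (\<lambda>v. v + w) ` box N A. simplex_term J v m q) +
      (\<Sum>v\<in>box N A. simplex_term J (v + w) m q - (- 1) ^ card S * simplex_term A v m q))"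
    by (intro small_add small_sum rest main) auto
  ultimately have "small u (\<lambda>m q. simplex_fun J m q - (- 1) ^ card S * simplex_fun A m q)" by simp
  then show ?thesis using True by (simp add: A_def S_def)
qed

text \<open>Each simplex function minus its limit \<open>?g\<close> decays, so the limits have to
  cancel. Grouped by the zero face \<open>A\<close> they are multiples of
  \<open>simplex_fun A\<close>, and since \<open>card (?S J)\<close> is \<open>card J\<close> minus
  \<open>card A\<close>, the signs sum to the quantity that vanishes by
  \<open>triang_euler_halfspace\<close>.\<close>

lemma small_total:
  assumes u: "u \<in> span N" "u \<noteq> 0"
  shows "small u (\<lambda>m q. \<Sum>J\<in>triang. simplex_fun J m q)"
proof -
  let ?P = "\<lambda>J. \<forall>j\<in>J. u \<bullet> j \<le> 0" and ?Z = "\<lambda>J. {j \<in> J. u \<bullet> j = 0}" and ?S = "\<lambda>J. {j \<in> J. u \<bullet> j < 0}"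
  let ?g = "\<lambda>J m q. if ?P J then (- 1) ^ card (?S J) * simplex_fun (?Z J) m q else 0"
  have zero: "(\<Sum>J\<in>triang. ?g J m q) = 0" for m q
  proof -
    let ?T = "{J. J \<in> triang \<and> ?P J}"
    have fin: "finite ?T" using finite_triang by simp
    have sign: "(- 1) ^ card (?S J) = (- 1) ^ card (?Z J) * (- 1 :: complex) ^ card J" if "J \<in> ?T" for J
    proof -
      have "J = ?Z J \<union> ?S J" using that by force
      then have "card J = card (?Z J \<union> ?S J)" by (rule arg_cong)
      also have "\<dots> = card (?Z J) + card (?S J)"
        using triang_finite[of J] that by (intro card_Un_disjoint) auto
      finally have "card J = card (?Z J) + card (?S J)" .
      then show ?thesis by (simp add: power_add flip: mult.assoc power_mult_distrib)
    qed
    have "(\<Sum>J\<in>triang. ?g J m q) = (\<Sum>J\<in>?T. (- 1) ^ card (?S J) * simplex_fun (?Z J) m q)"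
      using finite_triang by (simp add: sum.inter_filter)
    also have "\<dots> = (\<Sum>A\<in>?Z ` ?T. \<Sum>J | J \<in> ?T \<and> ?Z J = A. (- 1) ^ card (?S J) * simplex_fun (?Z J) m q)"
      by (rule sum.image_gen[OF fin])
    also have "\<dots> = (\<Sum>A\<in>?Z ` ?T. (- 1) ^ card A * simplex_fun A m q * (\<Sum>J | J \<in> ?T \<and> ?Z J = A. (- 1) ^ card J))"
    proof (rule sum.cong[OF refl])
      fix A
      show "(\<Sum>J | J \<in> ?T \<and> ?Z J = A. (- 1) ^ card (?S J) * simplex_fun (?Z J) m q) =
          (- 1) ^ card A * simplex_fun A m q * (\<Sum>J | J \<in> ?T \<and> ?Z J = A. (- 1) ^ card J)"
        unfolding sum_distrib_left
      proof (rule sum.cong[OF refl])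
        fix J assume J: "J \<in> {J. J \<in> ?T \<and> ?Z J = A}"
        then have "J \<in> ?T" "?Z J = A" by auto
        then show "(- 1) ^ card (?S J) * simplex_fun (?Z J) m q =
            (- 1) ^ card A * simplex_fun A m q * (- 1) ^ card J"
          using sign[of J] by (simp only: mult_ac)
      qed
    qed
    also have "\<dots> = 0"
    proof (intro sum.neutral ballI)
      fix A assume A: "A \<in> ?Z ` ?T"
      then obtain J0 where J0: "J0 \<in> triang" "A = ?Z J0" by blast
      have t: "A \<in> triang" by (rule triang_down[OF J0(1)]) (use J0(2) in auto)
      have z: "u \<bullet> j = 0" if "j \<in> A" for j using J0(2) that by blast
      have "(\<Sum>J | J \<in> triang \<and> ?P J \<and> ?Z J = A. (- 1) ^ card J) = (0 :: int)"
        by (rule triang_euler_halfspace[OF u t z])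
      then have "of_int (\<Sum>J | J \<in> triang \<and> ?P J \<and> ?Z J = A. (- 1) ^ card J) = (0 :: complex)" by simp
      then have "(\<Sum>J | J \<in> ?T \<and> ?Z J = A. (- 1) ^ card J) = (0 :: complex)" by simp
      then show "(- 1) ^ card A * simplex_fun A m q * (\<Sum>J | J \<in> ?T \<and> ?Z J = A. (- 1) ^ card J) = 0" by simp
    qed
    finally show ?thesis .
  qed
  have "small u (\<lambda>m q. \<Sum>J\<in>triang. simplex_fun J m q - ?g J m q)"
    by (intro small_sum small_simplex_fun)
  then show ?thesis by (simp add: sum_subtractf zero)
qed

text \<open>The vector \<open>m = 0\<close> has no direction; its exponent is 0, and the plain bound
  \<open>K0\<close> covers it. The entry 1 in the minimum \<open>d\<close> is for the empty cover,
  which occurs in rank 0.\<close>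

lemma total_bound:
  obtains \<delta> K where "\<delta> > 0" "K \<ge> 0" "\<And>m q. m \<in> dual_lattice N \<Longrightarrow> q \<noteq> 0 \<Longrightarrow> norm q < radius \<Longrightarrow>
    norm (\<Sum>J\<in>triang. simplex_fun J m q) \<le> K * norm q powr (\<delta> * norm m)"
proof -
  let ?f = "\<lambda>m q. \<Sum>J\<in>triang. simplex_fun J m q"
  let ?U = "{u \<in> span N. norm u = 1}"
  define Q where "Q = (\<lambda>u \<eta> \<delta> K. 0 < \<eta> \<and> 0 < \<delta> \<and> 0 \<le> K \<and> (\<forall>m\<in>dual_lattice N. m \<noteq> 0 \<longrightarrow>
      norm (m /\<^sub>R norm m - u) < \<eta> \<longrightarrow> (\<forall>q. q \<noteq> 0 \<longrightarrow> norm q < radius \<longrightarrow>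
      norm (?f m q) \<le> K * norm q powr (\<delta> * norm m))))"
  have "\<exists>\<eta> \<delta> K. Q u \<eta> \<delta> K" if u: "u \<in> ?U" for u
  proof -
    have "u \<noteq> 0" using u by auto
    then have "small u ?f" using u by (intro small_total) auto
    then show ?thesis unfolding Q_def by (rule smallE) blast
  qed
  then obtain \<eta> \<delta> K where Q: "\<And>u. u \<in> ?U \<Longrightarrow> Q u (\<eta> u) (\<delta> u) (K u)" by metis
  have e: "\<eta> u > 0" "\<delta> u > 0" "K u \<ge> 0" if "u \<in> ?U" for u
    using Q[OF that] unfolding Q_def by auto
  have e4: "norm (?f m q) \<le> K u * norm q powr (\<delta> u * norm m)"
    if "u \<in> ?U" "m \<in> dual_lattice N" "m \<noteq> 0" "norm (m /\<^sub>R norm m - u) < \<eta> u" "q \<noteq> 0" "norm q < radius"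
    for u m q
    using Q[OF that(1)] that(2-) unfolding Q_def by blast
  have "?U = span N \<inter> sphere 0 1" by auto
  then have "compact ?U" using closed_subspace[of "span N"] by (simp add: closed_Int_compact)
  moreover have "?U \<subseteq> (\<Union>u\<in>?U. ball u (\<eta> u))" using e(1) by (auto intro!: centre_in_ball[THEN iffD2])
  ultimately obtain W where W: "W \<subseteq> ?U" "finite W" "?U \<subseteq> (\<Union>u\<in>W. ball u (\<eta> u))"
    by (rule compactE_image[of ?U ?U "\<lambda>u. ball u (\<eta> u)", OF _ open_ball]) blast
  obtain K0 where K0: "\<And>m q. m \<in> dual_lattice N \<Longrightarrow> q \<noteq> 0 \<Longrightarrow> norm q < radius \<Longrightarrow> norm (?f m q) \<le> K0"
    using bounded_fun_sum[of triang simplex_fun, OF bounded_fun_simplex_fun] unfolding bounded_fun_def by blast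
  define d where "d = Min (insert 1 (\<delta> ` W))"
  define L where "L = \<bar>K0\<bar> + (\<Sum>u\<in>W. K u)"
  have d: "d > 0" "\<And>u. u \<in> W \<Longrightarrow> d \<le> \<delta> u"
    using W(1,2) e(2) by (auto simp: d_def Min_gr_iff)
  have KW: "K u \<ge> 0" if "u \<in> W" for u using e(3) W(1) that by blast
  have L: "L \<ge> 0" "\<bar>K0\<bar> \<le> L" "\<And>u. u \<in> W \<Longrightarrow> K u \<le> L"
  proof -
    have "0 \<le> (\<Sum>u\<in>W. K u)" using KW by (rule sum_nonneg)
    then show "L \<ge> 0" "\<bar>K0\<bar> \<le> L" by (simp_all add: L_def)
    show "K u \<le> L" if "u \<in> W" for u
      using member_le_sum[OF that _ W(2), of K] KW by (simp add: L_def)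
  qed
  show ?thesis
  proof (rule that[OF d(1) L(1)])
    fix m and q :: complex assume m: "m \<in> dual_lattice N" and q: "q \<noteq> 0" "norm q < radius"
    show "norm (?f m q) \<le> L * norm q powr (d * norm m)"
    proof (cases "m = 0")
      case True
      then show ?thesis using K0[OF m q] L(2) q(1) by simp
    next
      case False
      have "m /\<^sub>R norm m \<in> ?U" using False m by (simp add: dual_lattice_def span_scale)
      then obtain u where u: "u \<in> W" "norm (m /\<^sub>R norm m - u) < \<eta> u"
        using W(3) by (auto simp: dist_norm norm_minus_commute)
      have "norm (?f m q) \<le> K u * norm q powr (\<delta> u * norm m)"
        using e4[OF _ m False u(2) q] u(1) W(1) by blast
      also have "\<dots> \<le> L * norm q powr (d * norm m)"
        using L(1) L(3)[OF u(1)] d(2)[OF u(1)] q radius(2)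
        by (intro mult_mono powr_mono' mult_right_mono) auto
      finally show ?thesis .
    qed
  qed
qed

section \<open>Holomorphy at the origin and order of vanishing\<close>

lemma holomorphic_simplex_fun:
  assumes J: "J \<in> triang"
  shows "simplex_fun J m holomorphic_on ball 0 radius - {0}"
proof -
  have "1 - character j * q powi k \<noteq> 0" if "j \<in> J" "q \<in> ball 0 radius - {0}" for j q k
    using denominator_nonzero[of j q k] that triang_sub[OF J] by auto
  then show ?thesis unfolding simplex_fun_def[abs_def] simplex_term_def
    using triang_finite[OF J] by (intro holomorphic_intros) auto
qed

text \<open>Every single cone function is bounded on the punctured disc, so its singularity at 0 is
  removable before any cancellation between cones.\<close>

lemma holomorphic_toric_rho:
  assumes m: "m \<in> dual_lattice N"
  shows "(\<lambda>q. toric_rho N r deg \<Sigma> q m) holomorphic_on ball 0 radius"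
proof -
  have "(\<lambda>q. cone_fun N deg C q m) holomorphic_on ball 0 radius" if C: "C \<in> \<Sigma>" for C
  proof -
    have "bounded_fun (cone_value C)"
      unfolding cone_value_def[abs_def] by (intro bounded_fun_sum bounded_fun_simplex_fun) auto
    then obtain K where K: "\<And>q. q \<noteq> 0 \<Longrightarrow> norm q < radius \<Longrightarrow> norm (cone_value C m q) \<le> K"
      using m unfolding bounded_fun_def by blast
    have "cone_value C m holomorphic_on ball 0 radius - {0}"
      unfolding cone_value_def[abs_def] by (intro holomorphic_on_sum holomorphic_simplex_fun) auto
    then have "(\<lambda>q. if q = 0 then Lim (at 0) (cone_value C m) else cone_value C m q) holomorphic_on ball 0 radius"
      using K by (intro holomorphic_extend_Lim[OF _ radius(1), of _ K]) auto
    then show ?thesis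
      by (rule holomorphic_transform) (simp add: cone_fun_eq[OF C m])
  qed
  then show ?thesis unfolding toric_rho_def by (intro holomorphic_intros)
qed

lemma toric_rho_eq:
  assumes m: "m \<in> dual_lattice N" and q: "q \<noteq> 0" "norm q < radius"
  shows "toric_rho N r deg \<Sigma> q m = (\<Sum>J\<in>triang. simplex_fun J m q)"
  unfolding toric_rho_def sum_cone_value[symmetric]
  using q by (intro sum.cong) (simp_all add: cone_fun_eq[OF _ m])

text \<open>Rounding the exponent down to a natural number lets the estimate pass to
  \<open>q = 0\<close> by continuity and makes it a statement about the order of vanishing
  there.\<close>

theorem toric_rho_bound:
  obtains \<delta> K where "\<delta> > 0" "K \<ge> 0" "\<And>m q. m \<in> dual_lattice N \<Longrightarrow> norm q < radius \<Longrightarrow>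
    norm (toric_rho N r deg \<Sigma> q m) \<le> K * norm q ^ nat \<lfloor>\<delta> * norm m\<rfloor>"
proof -
  obtain \<delta> K where b: "\<delta> > 0" "K \<ge> 0" "\<And>m q. m \<in> dual_lattice N \<Longrightarrow> q \<noteq> 0 \<Longrightarrow> norm q < radius \<Longrightarrow>
    norm (\<Sum>J\<in>triang. simplex_fun J m q) \<le> K * norm q powr (\<delta> * norm m)"
    by (rule total_bound) blast
  show ?thesis
  proof (rule that[OF b(1,2)])
    fix m and q :: complex assume m: "m \<in> dual_lattice N" and q: "norm q < radius"
    let ?e = "nat \<lfloor>\<delta> * norm m\<rfloor>"
    show "norm (toric_rho N r deg \<Sigma> q m) \<le> K * norm q ^ ?e"
    proof (rule bound_at_zero[OF holomorphic_toric_rho[OF m] radius(1)])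
      fix z :: complex assume z: "z \<in> ball 0 radius - {0}"
      then have z': "z \<noteq> 0" "norm z < radius" by auto
      have "real ?e = of_int \<lfloor>\<delta> * norm m\<rfloor>" using b(1) by simp
      then have "real ?e \<le> \<delta> * norm m" by linarith
      then have "norm z powr (\<delta> * norm m) \<le> norm z powr real ?e"
        using z' radius(2) by (intro powr_mono') auto
      also have "\<dots> = norm z ^ ?e" using z'(1) by (simp add: powr_realpow)
      finally have "K * norm z powr (\<delta> * norm m) \<le> K * norm z ^ ?e" by (intro mult_left_mono b(2))
      then show "norm (toric_rho N r deg \<Sigma> z m) \<le> K * norm z ^ ?e"
        using b(3)[OF m z'] toric_rho_eq[OF m z'] by simp
    qed (use q in simp)
  qed
qed

end

section \<open>Convergence of toric forms\<close>

lemma fan_of_complete_fan: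
  fixes N :: "'v::euclidean_space set"
  assumes "complete_fan N \<Sigma>"
  shows "fan (span N) \<Sigma>"
proof -
  have rat: "rational_polyhedral_cone N C" if "C \<in> \<Sigma>" for C
    using assms that by (simp add: complete_fan_def rational_fan_def)
  have form: "\<exists>S. finite S \<and> C = span N \<inter> (\<Inter>m\<in>S. {x. 0 \<le> m \<bullet> x})" if C: "C \<in> \<Sigma>" for C
  proof -
    obtain S where S: "finite S" "S \<subseteq> dual_lattice N" "C = {x \<in> span N. \<forall>m\<in>S. 0 \<le> m \<bullet> x}"
      using conjunct1[OF rat[OF C, unfolded rational_polyhedral_cone_def]]
      by (elim exE conjE) (rule that)
    have "{x \<in> span N. \<forall>m\<in>S. 0 \<le> m \<bullet> x} = span N \<inter> (\<Inter>m\<in>S. {x. 0 \<le> m \<bullet> x})" by blast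
    with S(1,3) show ?thesis by (intro exI[of _ S] conjI) simp_all
  qed
  have "closed C" "convex C" "cone C" "0 \<in> C" if C: "C \<in> \<Sigma>" for C
  proof -
    obtain S where S: "C = span N \<inter> (\<Inter>m\<in>S. {x. 0 \<le> m \<bullet> x})" using form[OF C] by blast
    show "closed C" unfolding S
      by (intro closed_Int closed_INT ballI closed_subspace closed_halfspace_ge) simp
    show "convex C" unfolding S
      by (intro convex_Int convex_INT convex_halfspace_ge subspace_imp_convex) simp
    show "cone C" unfolding S cone_def by (auto intro: span_scale)
    show "0 \<in> C" unfolding S by (simp add: span_zero)
  qed
  moreover have "v = 0" if C: "C \<in> \<Sigma>" and v: "v \<in> C" "- v \<in> C" for C v
  proof -
    have "cone C" using calculation(3)[OF C] .
    \<comment> \<open>A cone containing \<open>v\<close> and \<open>- v\<close> contains the line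
      through 0 in the direction \<open>v\<close>, which rational polyhedral cones exclude.\<close>
    then have "0 + t *\<^sub>R v \<in> C" for t
      using v mem_cone[of C v t] mem_cone[of C "- v" "- t"] by (cases "t \<ge> 0") auto
    then show ?thesis
      using conjunct2[OF rat[OF C, unfolded rational_polyhedral_cone_def]] by blast
  qed
  ultimately show ?thesis
    using assms unfolding complete_fan_def rational_fan_def
    by unfold_locales (auto simp: subspace_span)
qed

text \<open>One primitive generator is chosen in each one-dimensional cone. Every nonzero cone
  contains a one-dimensional one, which gives \<open>ray_in\<close>, and any injection into the
  naturals can serve as pulling order.\<close>

lemma toric_of_fan:
  assumes N: "lattice N r B" and \<Sigma>: "complete_fan N \<Sigma>"
    and lin: "\<And>C. C \<in> \<Sigma> \<Longrightarrow> linear_on_cone N deg C"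
    and ray: "\<And>C d. C \<in> \<Sigma> \<Longrightarrow> dim C = 1 \<Longrightarrow> d \<in> C \<Longrightarrow> primitive_in N d \<Longrightarrow> deg d \<notin> \<int>"
  shows "\<exists>D ord. toric N r B \<Sigma> D ord deg"
proof -
  interpret lattice N r B by (rule N)
  interpret fan "span N" \<Sigma> by (rule fan_of_complete_fan[OF \<Sigma>])
  have rat: "rational_polyhedral_cone N C" if "C \<in> \<Sigma>" for C
    using \<Sigma> that by (simp add: complete_fan_def rational_fan_def)
  have "\<exists>d. d \<in> C \<and> primitive_in N d" if "C \<in> \<Sigma>" "dim C = 1" for C
    using ray_has_primitive[OF rat[OF that(1)] that(2)] by blast
  then obtain g where g: "\<And>C. C \<in> \<Sigma> \<Longrightarrow> dim C = 1 \<Longrightarrow> g C \<in> C \<and> primitive_in N (g C)" by metis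
  define D where "D = g ` {C \<in> \<Sigma>. dim C = 1}"
  have D: "d \<in> N" "d \<noteq> 0" "deg d \<notin> \<int>" if d: "d \<in> D" for d
  proof -
    obtain C where C: "C \<in> \<Sigma>" "dim C = 1" "d = g C" using d unfolding D_def by blast
    have p: "primitive_in N d" "d \<in> C" using g[OF C(1,2)] C(3) by auto
    show "d \<in> N" using p(1) by (simp add: primitive_in_def)
    show "deg d \<notin> \<int>" by (rule ray[OF C(1,2) p(2,1)])
    show "d \<noteq> 0"
    proof
      assume "d = 0"
      then have "0 \<in> N" "\<forall>n\<in>N. \<forall>k::nat. (0 :: 'a) = of_nat k *\<^sub>R n \<longrightarrow> k = 1"
        using p(1) unfolding primitive_in_def by auto
      then show False by (metis of_nat_0 scaleR_zero_left zero_neq_one)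
    qed
  qed
  have fin: "finite D" using finite_fan by (simp add: D_def)
  obtain ord :: "'a \<Rightarrow> nat" where ord: "inj_on ord D"
    using finite_imp_inj_to_nat_seg[OF fin] by blast
  have ray_in: "\<exists>d\<in>D. d \<in> C" if C: "C \<in> \<Sigma>" "C \<noteq> {0}" for C
  proof -
    obtain R where R: "R \<in> \<Sigma>" "R \<subseteq> C" "dim R = 1" using exists_one_dimensional[OF C] by blast
    then have "g R \<in> D" "g R \<in> R" using g by (auto simp: D_def)
    then show ?thesis using R(2) by blast
  qed
  have "toric N r B \<Sigma> D ord deg"
  proof unfold_locales
    show "D \<subseteq> span N" using D(1) by (auto intro: span_base)
  qed (use fin D ord ray_in rat lin in auto)
  then show ?thesis by blast
qed

theorem theorem2p10:
  fixes N :: "'v::euclidean_space set" and r :: nat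
    and deg :: "'v \<Rightarrow> complex" and \<Sigma> :: "'v set set"
  assumes "lattice_of_rank N r"
    and "complete_fan N \<Sigma>"
    and "\<And>C. C \<in> \<Sigma> \<Longrightarrow> linear_on_cone N deg C"
    and "\<And>C d. C \<in> \<Sigma> \<Longrightarrow> dim C = 1 \<Longrightarrow> d \<in> C \<Longrightarrow> primitive_in N d \<Longrightarrow> deg d \<notin> \<int>"
  shows "(\<exists>\<epsilon>>0.
            (\<forall>q. norm q < \<epsilon> \<longrightarrow>
               (\<lambda>m. norm (toric_rho N r deg \<Sigma> q m)) summable_on dual_lattice N) \<and>
            uniform_limit {q. norm q < \<epsilon>}
              (\<lambda>F q. \<Sum>m\<in>F. toric_rho N r deg \<Sigma> q m)
              (\<lambda>q. \<Sum>\<^sub>\<infinity>m\<in>dual_lattice N. toric_rho N r deg \<Sigma> q m)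
              (finite_subsets_at_top (dual_lattice N))) \<and>
         (\<exists>A :: 'v \<Rightarrow> complex fps.
            (\<forall>m\<in>dual_lattice N. (\<lambda>q. toric_rho N r deg \<Sigma> q m) has_fps_expansion A m) \<and>
            (\<forall>k. finite {m \<in> dual_lattice N. fps_nth (A m) k \<noteq> 0}))"
proof -
  obtain B where B: "lattice N r B" using lattice_of_rankE[OF assms(1)] .
  have "\<exists>D ord. toric N r B \<Sigma> D ord deg" by (rule toric_of_fan[OF B assms(2)]) (fact assms(3,4))+
  then obtain D ord where "toric N r B \<Sigma> D ord deg" by blast
  then interpret toric N r B \<Sigma> D ord deg .
  obtain \<delta> K where b: "\<delta> > 0" "K \<ge> 0" "\<And>m q. m \<in> dual_lattice N \<Longrightarrow> norm q < radius \<Longrightarrow>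
    norm (toric_rho N r deg \<Sigma> q m) \<le> K * norm q ^ nat \<lfloor>\<delta> * norm m\<rfloor>"
    by (rule toric_rho_bound) blast
  \<comment> \<open>The majorant is the bound at the edge of the disc; the factor
    \<open>1 / radius\<close> pays for rounding the exponent down, which lowers it by less than
    1.\<close>
  let ?M = "\<lambda>m. K / radius * radius powr (\<delta> * norm m)"
  have sum_powr: "(\<lambda>m. radius powr (\<delta> * norm m)) summable_on dual_lattice N"
    by (rule summable_dual[OF radius(1,2) b(1)])
  then have summable: "?M summable_on dual_lattice N" by (rule summable_on_cmult_right)
  have le: "norm (toric_rho N r deg \<Sigma> q m) \<le> ?M m" if m: "m \<in> dual_lattice N" and q: "norm q < radius" for m q
  proof -
    let ?e = "nat \<lfloor>\<delta> * norm m\<rfloor>"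
    have "norm (toric_rho N r deg \<Sigma> q m) \<le> K * norm q ^ ?e" by (rule b(3)[OF m q])
    also have "\<dots> \<le> K * radius ^ ?e" using q b(2) by (intro mult_left_mono power_mono) auto
    also have "radius ^ ?e = radius powr real ?e" using radius(1) by (simp add: powr_realpow)
    also have "\<dots> \<le> radius powr (\<delta> * norm m - 1)"
    proof (rule powr_mono')
      have "real ?e = of_int \<lfloor>\<delta> * norm m\<rfloor>" using b(1) by simp
      then show "\<delta> * norm m - 1 \<le> real ?e" by linarith
    qed (use radius in auto)
    also have "\<dots> = radius powr (\<delta> * norm m) / radius" using radius(1) by (simp add: powr_diff)
    finally show ?thesis using b(2) by (simp add: mult_left_mono)
  qed
  show ?thesis
  proof (intro conjI exI[of _ radius] exI[of _ "\<lambda>m. fps_expansion (\<lambda>q. toric_rho N r deg \<Sigma> q m) 0"]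
      allI impI ballI)
    show "(\<lambda>m. norm (toric_rho N r deg \<Sigma> q m)) summable_on dual_lattice N" if "norm q < radius" for q
      using le that by (intro Infinite_Sum.abs_summable_on_comparison_test'[OF summable]) auto
    show "uniform_limit {q. norm q < radius} (\<lambda>F q. \<Sum>m\<in>F. toric_rho N r deg \<Sigma> q m)
        (\<lambda>q. \<Sum>\<^sub>\<infinity>m\<in>dual_lattice N. toric_rho N r deg \<Sigma> q m) (finite_subsets_at_top (dual_lattice N))"
      using le by (intro Weierstrass_m_test_general[OF _ summable]) auto
    show "(\<lambda>q. toric_rho N r deg \<Sigma> q m) has_fps_expansion fps_expansion (\<lambda>q. toric_rho N r deg \<Sigma> q m) 0"
      if "m \<in> dual_lattice N" for m
      using holomorphic_toric_rho[OF that] radius(1)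
      by (intro has_fps_expansion_fps_expansion[of "ball 0 radius"]) auto
    fix k
    \<comment> \<open>Beyond \<open>real k + 1\<close> the rounded exponent still exceeds
      \<open>k\<close>, so the coefficient of order \<open>k\<close> vanishes. For the remaining
      \<open>m\<close> the summands in \<open>sum_powr\<close> are bounded below, and summability
      leaves only finitely many of them.\<close>
    have "k < nat \<lfloor>\<delta> * norm m\<rfloor>" if "real k + 1 < \<delta> * norm m" for m :: 'v
      using that by linarith
    then have zero: "fps_nth (fps_expansion (\<lambda>q. toric_rho N r deg \<Sigma> q m) 0) k = 0"
      if "m \<in> dual_lattice N" "real k + 1 < \<delta> * norm m" for m
      using that b(3)[OF that(1)]
      by (intro fps_expansion_nth_eq_0[OF holomorphic_toric_rho radius(1)]) auto
    have "{m \<in> dual_lattice N. fps_nth (fps_expansion (\<lambda>q. toric_rho N r deg \<Sigma> q m) 0) k \<noteq> 0} \<subseteq>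
        {m \<in> dual_lattice N. radius powr (real k + 1) \<le> radius powr (\<delta> * norm m)}"
    proof (intro subsetI CollectI conjI)
      fix m assume m: "m \<in> {m \<in> dual_lattice N. fps_nth (fps_expansion (\<lambda>q. toric_rho N r deg \<Sigma> q m) 0) k \<noteq> 0}"
      then show "m \<in> dual_lattice N" by simp
      have "\<not> real k + 1 < \<delta> * norm m" using m zero[of m] by auto
      then show "radius powr (real k + 1) \<le> radius powr (\<delta> * norm m)"
        using radius(1,2) by (intro powr_mono') auto
    qed
    moreover have "finite {m \<in> dual_lattice N. radius powr (real k + 1) \<le> radius powr (\<delta> * norm m)}"
      using radius(1) by (intro finite_summable_ge[OF sum_powr]) auto
    ultimately show "finite {m \<in> dual_lattice N. fps_nth (fps_expansion (\<lambda>q. toric_rho N r deg \<Sigma> q m) 0) k \<noteq> 0}"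
      by (rule finite_subset)
  qed (rule radius(1))
qed

end
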